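(* Let $S$ be a discrete abelian cancellative semigroup with unit $e$ which contains no nontrivial prime ideals. Let $G=S^{-1}S$ be its group of quotients, let $A(X)=\{f|_X: f\in A(\widehat S)\}$, and let $S_1$ be the subsemigroup of $G$ generated by the supports of the Fourier transforms of the functions in $A(X)$. Then: 1) $S_1^{-1}\cap S_1=\{e\}$; 2) $\widehat S$ is a subsemigroup of $\widehat{S_1}$ in the sense that $S\subseteq S_1$ and the map of restriction to $S$, $\xi\mapsto\xi|_S$, is a topological isomorphism of some subsemigroup of $\widehat{S_1}$ onto the semigroup $\widehat S$; 3) with $\widehat S$ regarded as a subsemigroup of $\widehat{S_1}$ as in 2), the map of restriction to $\widehat S$, $f\mapsto f|_{\widehat S}$, is an isometric isomorphism of the Arens–Singer algebra $A_0(\widehat{S_1})$ onto the algebra $A(\widehat S)$; 4) the Gelfand spectrum of the algebra $A(\widehat S)$ can be identified with $\widehat{S_1}$.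
   Context: $S$ is a discrete abelian cancellative semigroup with unit $e$, written multiplicatively. For any such semigroup $T$ (here $T=S$ or $T=S_1$): a semicharacter of $T$ is a homomorphism $\psi$ from $T$ to the multiplicative semigroup $\overline{\mathbb D}=\{z\in\mathbb C:|z|\le 1\}$ that is not identically zero. $\widehat T$ is the set of all semicharacters with pointwise multiplication and the topology of pointwise convergence on $T$; it is a compact topological semigroup with unit $1$. The Arens–Singer algebra $A_0(\widehat T)$ is the uniform algebra on $\widehat T$ (closed subalgebra of $C(\widehat T)$, sup norm) generated by the functions $\widehat a(\xi)=\xi(a)$, $a\in T$. $X\subseteq\widehat S$ is the compact group of characters of $S$ (semicharacters of modulus $1$ everywhere). Characters of $S$ extend uniquely to the group $G$, so $X$ is identified with the dual group of the discrete group $G$; the Fourier transform of a continuous function $f$ on $X$ is the function $g\mapsto\int_X f(\chi)\overline{\chi(g)}\,d\chi$ on $G$, where $d\chi$ is normalized Haar measure on $X$. For a nonnegative semicharacter $\rho$ of $S$ and $\mathrm{Re}\,z>0$, $\rho^z(s)=\rho(s)^z$ (with $0^z=0$), and $\rho^0$ is the indicator function of $\{s:\rho(s)>0\}$. A function $f:\widehat S\setminus X\to\mathbb C$ is generalized analytic if for all $\rho,\psi\in\widehat S\setminus X$ with $\rho\ge 0$ the map $z\mapsto f(\rho^z\psi)$ is analytic in the open right half-plane $\{\mathrm{Re}\,z>0\}$ and continuous at $+0$. $A(\widehat S)$ is the uniform algebra (sup norm) of all functions continuous on $\widehat S$ and generalized analytic on $\widehat S\setminus X$. An ideal of $S$ is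 called prime (also "simple") if its complement in $S$ is a semigroup; prime ideals different from $S\setminus\{e\}$ are called nontrivial.
   Formalization: Assumes in addition that S is not a nontrivial group: such a group has no prime ideals, its semicharacters are all characters, A(Ŝ)=C(X) and S₁=G, so 1) fails. *)

theory Defs
  imports "HOL-Analysis.Analysis" "HOL-Algebra.Divisibility"
begin

section \<open>Semigroups\<close>

text \<open>
  Ideals are nonempty, and the semigroup complementary to a prime ideal is nonempty. The opposite
  convention would make the empty set (or the whole semigroup) a nontrivial prime ideal of every
  nontrivial semigroup.
\<close>

definition semigroup_ideal :: "'a monoid \<Rightarrow> 'a set \<Rightarrow> bool" where
  "semigroup_ideal S I \<longleftrightarrow>
     I \<subseteq> carrier S \<and> I \<noteq> {} \<and> (\<forall>a\<in>I. \<forall>s\<in>carrier S. a \<otimes>\<^bsub>S\<^esub> s \<in> I)"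

definition subsemigroup :: "'a monoid \<Rightarrow> 'a set \<Rightarrow> bool" where
  "subsemigroup S T \<longleftrightarrow> T \<subseteq> carrier S \<and> (\<forall>a\<in>T. \<forall>b\<in>T. a \<otimes>\<^bsub>S\<^esub> b \<in> T)"

definition semigroup_prime_ideal :: "'a monoid \<Rightarrow> 'a set \<Rightarrow> bool" where
  "semigroup_prime_ideal S I \<longleftrightarrow>
     semigroup_ideal S I \<and> carrier S - I \<noteq> {} \<and> subsemigroup S (carrier S - I)"

definition generated_subsemigroup :: "'a monoid \<Rightarrow> 'a set \<Rightarrow> 'a set" where
  "generated_subsemigroup S A = \<Inter>{T. subsemigroup S T \<and> A \<subseteq> T}"

definition group_of_quotients :: "'a monoid \<Rightarrow> 'a monoid \<Rightarrow> bool" where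
  "group_of_quotients S G \<longleftrightarrow>
     comm_group G \<and> carrier S \<subseteq> carrier G \<and> \<one>\<^bsub>S\<^esub> = \<one>\<^bsub>G\<^esub> \<and>
     (\<forall>a\<in>carrier S. \<forall>b\<in>carrier S. a \<otimes>\<^bsub>S\<^esub> b = a \<otimes>\<^bsub>G\<^esub> b) \<and>
     carrier G = {inv\<^bsub>G\<^esub> a \<otimes>\<^bsub>G\<^esub> b | a b. a \<in> carrier S \<and> b \<in> carrier S}"


section \<open>Semicharacters\<close>

text \<open>
  Functions on a set are represented by extensional total functions, so that equality of
  functions on the set is equality in HOL.
\<close>

definition semicharacters :: "'a monoid \<Rightarrow> ('a \<Rightarrow> complex) set" where
  "semicharacters T =
     {\<psi> \<in> extensional (carrier T).
        (\<forall>s\<in>carrier T. cmod (\<psi> s) \<le> 1) \<and>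
        (\<forall>s\<in>carrier T. \<forall>t\<in>carrier T. \<psi> (s \<otimes>\<^bsub>T\<^esub> t) = \<psi> s * \<psi> t) \<and>
        (\<exists>s\<in>carrier T. \<psi> s \<noteq> 0)}"

definition characters :: "'a monoid \<Rightarrow> ('a \<Rightarrow> complex) set" where
  "characters T = {\<eta> \<in> semicharacters T. \<forall>s\<in>carrier T. cmod (\<eta> s) = 1}"

definition semichar_mult ::
    "'a monoid \<Rightarrow> ('a \<Rightarrow> complex) \<Rightarrow> ('a \<Rightarrow> complex) \<Rightarrow> 'a \<Rightarrow> complex" where
  "semichar_mult T \<xi> \<psi> = (\<lambda>s\<in>carrier T. \<xi> s * \<psi> s)"

definition semichar_monoid :: "'a monoid \<Rightarrow> ('a \<Rightarrow> complex) monoid" where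
  "semichar_monoid T =
     \<lparr>carrier = semicharacters T, monoid.mult = semichar_mult T, one = (\<lambda>s\<in>carrier T. 1)\<rparr>"

definition semichar_topology :: "'a monoid \<Rightarrow> ('a \<Rightarrow> complex) topology" where
  "semichar_topology T =
     subtopology (product_topology (\<lambda>_. euclidean) (carrier T)) (semicharacters T)"

definition character_topology :: "'a monoid \<Rightarrow> ('a \<Rightarrow> complex) topology" where
  "character_topology T = subtopology (semichar_topology T) (characters T)"

text \<open>
  Library conventions: \<open>0 powr z = 0\<close> for every \<open>z\<close>, and \<open>x powr 0 = 1\<close> for \<open>x \<noteq> 0\<close>. Hence for
  \<open>z = 0\<close> this is the indicator function of the set where \<open>\<rho> > 0\<close>.
\<close>

definition semichar_power :: "'a monoid \<Rightarrow> ('a \<Rightarrow> complex) \<Rightarrow> complex \<Rightarrow> 'a \<Rightarrow> complex" where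
  "semichar_power T \<rho> z = (\<lambda>s\<in>carrier T. \<rho> s powr z)"


section \<open>Algebras of continuous functions\<close>

definition continuous_functions :: "'b topology \<Rightarrow> ('b \<Rightarrow> complex) set" where
  "continuous_functions X = {f \<in> extensional (topspace X). continuous_map X euclidean f}"

definition sup_norm :: "'b set \<Rightarrow> ('b \<Rightarrow> complex) \<Rightarrow> real" where
  "sup_norm K f = (SUP x\<in>K. cmod (f x))"

definition pw_add :: "'b set \<Rightarrow> ('b \<Rightarrow> complex) \<Rightarrow> ('b \<Rightarrow> complex) \<Rightarrow> 'b \<Rightarrow> complex" where
  "pw_add K f g = (\<lambda>x\<in>K. f x + g x)"

definition pw_mult :: "'b set \<Rightarrow> ('b \<Rightarrow> complex) \<Rightarrow> ('b \<Rightarrow> complex) \<Rightarrow> 'b \<Rightarrow> complex" where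
  "pw_mult K f g = (\<lambda>x\<in>K. f x * g x)"

definition pw_scale :: "'b set \<Rightarrow> complex \<Rightarrow> ('b \<Rightarrow> complex) \<Rightarrow> 'b \<Rightarrow> complex" where
  "pw_scale K c f = (\<lambda>x\<in>K. c * f x)"

definition closed_subalgebra :: "'b topology \<Rightarrow> ('b \<Rightarrow> complex) set \<Rightarrow> bool" where
  "closed_subalgebra X B \<longleftrightarrow>
     B \<subseteq> continuous_functions X \<and>
     (\<lambda>x\<in>topspace X. 0) \<in> B \<and>
     (\<forall>f\<in>B. \<forall>g\<in>B. pw_add (topspace X) f g \<in> B \<and> pw_mult (topspace X) f g \<in> B) \<and>
     (\<forall>c. \<forall>f\<in>B. pw_scale (topspace X) c f \<in> B) \<and>
     (\<forall>f\<in>continuous_functions X.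
        (\<forall>\<epsilon>>0. \<exists>g\<in>B. sup_norm (topspace X) (\<lambda>x. f x - g x) < \<epsilon>) \<longrightarrow> f \<in> B)"

definition isometric_algebra_iso ::
    "'b set \<Rightarrow> ('b \<Rightarrow> complex) set \<Rightarrow> 'c set \<Rightarrow> ('c \<Rightarrow> complex) set \<Rightarrow>
     (('b \<Rightarrow> complex) \<Rightarrow> ('c \<Rightarrow> complex)) \<Rightarrow> bool" where
  "isometric_algebra_iso K A L B \<Phi> \<longleftrightarrow>
     bij_betw \<Phi> A B \<and>
     (\<forall>f\<in>A. \<forall>g\<in>A. \<Phi> (pw_add K f g) = pw_add L (\<Phi> f) (\<Phi> g)) \<and>
     (\<forall>f\<in>A. \<forall>g\<in>A. \<Phi> (pw_mult K f g) = pw_mult L (\<Phi> f) (\<Phi> g)) \<and>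
     (\<forall>c. \<forall>f\<in>A. \<Phi> (pw_scale K c f) = pw_scale L c (\<Phi> f)) \<and>
     (\<forall>f\<in>A. sup_norm L (\<Phi> f) = sup_norm K f)"

text \<open>Nonzero complex homomorphisms of an algebra \<open>A\<close> of functions on \<open>K\<close>; the Gelfand topology
  is that of pointwise convergence on \<open>A\<close>.\<close>

definition complex_homs ::
    "'b set \<Rightarrow> ('b \<Rightarrow> complex) set \<Rightarrow> (('b \<Rightarrow> complex) \<Rightarrow> complex) set" where
  "complex_homs K A =
     {m \<in> extensional A.
        (\<forall>f\<in>A. \<forall>g\<in>A. m (pw_add K f g) = m f + m g) \<and>
        (\<forall>f\<in>A. \<forall>g\<in>A. m (pw_mult K f g) = m f * m g) \<and>
        (\<forall>c. \<forall>f\<in>A. m (pw_scale K c f) = c * m f) \<and>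
        (\<exists>f\<in>A. m f \<noteq> 0)}"

definition gelfand_spectrum ::
    "'b set \<Rightarrow> ('b \<Rightarrow> complex) set \<Rightarrow> (('b \<Rightarrow> complex) \<Rightarrow> complex) topology" where
  "gelfand_spectrum K A = subtopology (product_topology (\<lambda>_. euclidean) A) (complex_homs K A)"


section \<open>The Arens-Singer algebra and generalized analytic functions\<close>

definition arens_singer_algebra :: "'a monoid \<Rightarrow> (('a \<Rightarrow> complex) \<Rightarrow> complex) set" where
  "arens_singer_algebra T =
     \<Inter>{B. closed_subalgebra (semichar_topology T) B \<and>
          (\<forall>a\<in>carrier T. (\<lambda>\<xi>\<in>semicharacters T. \<xi> a) \<in> B)}"

text \<open>
  Only the values of \<open>f\<close> at semicharacters that are not characters matter here. For \<open>f\<close> continuous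
  on all semicharacters the condition at \<open>+0\<close> is automatic.
\<close>

definition generalized_analytic :: "'a monoid \<Rightarrow> (('a \<Rightarrow> complex) \<Rightarrow> complex) \<Rightarrow> bool" where
  "generalized_analytic S f \<longleftrightarrow>
     (\<forall>\<rho>\<in>semicharacters S - characters S. \<forall>\<psi>\<in>semicharacters S - characters S.
        (\<forall>s\<in>carrier S. \<rho> s \<in> \<real>\<^sub>\<ge>\<^sub>0) \<longrightarrow>
          (\<lambda>z. f (semichar_mult S (semichar_power S \<rho> z) \<psi>)) analytic_on {z. 0 < Re z} \<and>
          ((\<lambda>t. f (semichar_mult S (semichar_power S \<rho> (complex_of_real t)) \<psi>)) \<longlongrightarrow>
             f (semichar_mult S (semichar_power S \<rho> 0) \<psi>)) (at_right 0))"

definition gen_analytic_algebra :: "'a monoid \<Rightarrow> (('a \<Rightarrow> complex) \<Rightarrow> complex) set" where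
  "gen_analytic_algebra S =
     {f \<in> continuous_functions (semichar_topology S). generalized_analytic S f}"

definition boundary_algebra :: "'a monoid \<Rightarrow> (('a \<Rightarrow> complex) \<Rightarrow> complex) set" where
  "boundary_algebra S = (\<lambda>f. restrict f (characters S)) ` gen_analytic_algebra S"


section \<open>Fourier transform\<close>

text \<open>Normalized Haar measure: the translation-invariant regular Borel probability measure.\<close>

definition normalized_haar_measure :: "'a monoid \<Rightarrow> ('a \<Rightarrow> complex) measure \<Rightarrow> bool" where
  "normalized_haar_measure S \<mu> \<longleftrightarrow>
     emeasure \<mu> (space \<mu>) = 1 \<and>
     space \<mu> = characters S \<and>
     sets \<mu> = sigma_sets (characters S) (Collect (openin (character_topology S))) \<and>
     (\<forall>\<eta>\<in>characters S. \<forall>A\<in>sets \<mu>. emeasure \<mu> (semichar_mult S \<eta> ` A) = emeasure \<mu> A) \<and>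
     (\<forall>A\<in>sets \<mu>. emeasure \<mu> A =
        (INF U\<in>{U. openin (character_topology S) U \<and> A \<subseteq> U}. emeasure \<mu> U)) \<and>
     (\<forall>A\<in>sets \<mu>. emeasure \<mu> A =
        (SUP C\<in>{C. compactin (character_topology S) C \<and> closedin (character_topology S) C \<and> C \<subseteq> A}.
           emeasure \<mu> C))"

definition character_extension :: "'a monoid \<Rightarrow> 'a monoid \<Rightarrow> ('a \<Rightarrow> complex) \<Rightarrow> 'a \<Rightarrow> complex" where
  "character_extension S G \<eta> = (THE \<kappa>. \<kappa> \<in> characters G \<and> (\<forall>s\<in>carrier S. \<kappa> s = \<eta> s))"

definition fourier_transform ::
    "'a monoid \<Rightarrow> 'a monoid \<Rightarrow> ('a \<Rightarrow> complex) measure \<Rightarrow> (('a \<Rightarrow> complex) \<Rightarrow> complex) \<Rightarrow>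
     'a \<Rightarrow> complex" where
  "fourier_transform S G \<mu> f g = (LINT \<eta>|\<mu>. f \<eta> * cnj (character_extension S G \<eta> g))"

definition fourier_support ::
    "'a monoid \<Rightarrow> 'a monoid \<Rightarrow> ('a \<Rightarrow> complex) measure \<Rightarrow> (('a \<Rightarrow> complex) \<Rightarrow> complex) \<Rightarrow>
     'a set" where
  "fourier_support S G \<mu> f = {g \<in> carrier G. fourier_transform S G \<mu> f g \<noteq> 0}"

definition spectral_semigroup :: "'a monoid \<Rightarrow> 'a monoid \<Rightarrow> ('a \<Rightarrow> complex) measure \<Rightarrow> 'a monoid"
  where
  "spectral_semigroup S G \<mu> =
     G\<lparr>carrier := generated_subsemigroup G (\<Union>f\<in>boundary_algebra S. fourier_support S G \<mu> f)\<rparr>"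

end

theory Submission
  imports Defs "HOL-Complex_Analysis.Complex_Analysis" "HOL-Real_Asymp.Real_Asymp"
begin

text \<open>
  Since the ideals \<open>{s. \<psi> s = 0}\<close> and \<open>{s. \<bar>\<psi> s\<bar> < 1}\<close> are prime when nonempty, a semicharacter of \<open>S\<close> either
  vanishes nowhere, and then extends to \<open>G\<close>, or is the indicator function \<open>\<epsilon>\<close> of the unit; and off the
  unit it has modulus \<open>< 1\<close> unless it is a character. Let \<open>P\<close> consist of the unit and of all \<open>g\<close> in \<open>G\<close>
  with \<open>\<rho>(g) < 1\<close> for every positive semicharacter \<open>\<rho>\<close> that is not a character.

  For \<open>f\<close> in \<open>A\<close> and \<open>g\<close> in \<open>G\<close>, averaging \<open>f(\<rho>\<^sup>z \<eta>)\<close> over the characters \<open>\<eta>\<close> against the conjugate of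
  \<open>\<eta>(g)\<close> gives a holomorphic function of \<open>z\<close> that an imaginary translation by \<open>iy\<close> multiplies by \<open>\<rho>(g)\<^sup>i\<^sup>y\<close>,
  hence a multiple of \<open>\<rho>(g)\<^sup>z\<close>. Letting \<open>z\<close> tend to \<open>0\<close> and to infinity shows that the multiple is the
  Fourier coefficient at \<open>g\<close> and that it vanishes unless \<open>g\<close> is in \<open>P\<close>. Conversely a compactness argument
  bounds a power of \<open>\<bar>\<psi>(g)\<bar>\<close> by \<open>\<bar>\<psi>(u)\<bar>\<close> for \<open>g\<close> in \<open>P\<close> and \<open>u\<close> in \<open>S\<close> other than the unit, so that \<open>\<psi> \<mapsto> \<psi>(g)\<close> is
  continuous at \<open>\<epsilon>\<close> and belongs to \<open>A\<close>. So \<open>P\<close> is the semigroup \<open>S\<^sub>1\<close>, and convolution with a concentrated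
  kernel shows that polynomials in the elements of \<open>P\<close> are dense in \<open>A\<close>.

  For the isometry, a semicharacter of \<open>P\<close> maps a polynomial \<open>p\<close> to a number of modulus at most the sum of the
  moduli of the coefficients. Applied to \<open>p\<^sup>n\<close>, whose support grows polynomially in \<open>n\<close>, and combined with the
  bound of each coefficient by the supremum over the characters, this gives the bound of \<open>p\<close> by its supremum
  over the characters after taking \<open>n\<close>-th roots.
\<close>

section \<open>Extension of homomorphisms on abelian groups\<close>

text \<open>Two existence results carry the proof. \<open>P\<close> is defined by a condition on all
  elements of \<open>Pos\<close>, so an empty \<open>Pos\<close> would make it the whole of
  \<open>G\<close>; an element of \<open>Pos\<close> must therefore be produced whenever
  \<open>S\<close> is nontrivial. Take \<open>u\<close> in \<open>S\<close> other than the unit. The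
  elements dividing no power of \<open>u\<close> would form a prime ideal that misses
  \<open>u\<close>, so there are none, and \<open>u\<close> is an order unit of \<open>G\<close>
  ordered by the cone \<open>S\<close>. A Hahn-Banach argument for abelian groups yields an additive
  \<phi> on \<open>G\<close>, nonnegative on \<open>S\<close> and positive at \<open>u\<close>, and
  exp(-\<phi>) is the required semicharacter.

  Orthogonality of the characters is the other ingredient: for \<open>g\<close> other than the unit
  there must be a character with value different from 1 at \<open>g\<close>. It comes from
  divisibility of the circle and Zorn's lemma.

  One recurrent difficulty is the semicharacter \<open>eps\<close>, which does not extend to the
  group as a homomorphism. It extends to \<open>P\<close> by zero, and this is multiplicative
  exactly because no element of \<open>P\<close> other than the unit has its inverse in
  \<open>P\<close>.\<close>

definition partial_character :: "('a, 'b) monoid_scheme \<Rightarrow> ('a \<times> complex) set \<Rightarrow> bool" where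
  "partial_character G R \<longleftrightarrow>
     R \<subseteq> carrier G \<times> sphere 0 1 \<and> (\<one>\<^bsub>G\<^esub>, 1) \<in> R \<and>
     (\<forall>x z y w. (x, z) \<in> R \<longrightarrow> (y, w) \<in> R \<longrightarrow> (x \<otimes>\<^bsub>G\<^esub> y, z * w) \<in> R) \<and>
     (\<forall>x z. (x, z) \<in> R \<longrightarrow> (inv\<^bsub>G\<^esub> x, inverse z) \<in> R) \<and>
     (\<forall>z. (\<one>\<^bsub>G\<^esub>, z) \<in> R \<longrightarrow> z = 1)"

context comm_group
begin

lemma partial_character_unique:
  assumes "partial_character G R" "(x, z) \<in> R" "(x, w) \<in> R"
  shows "z = w"
proof -
  have x: "x \<in> carrier G" and w: "w \<noteq> 0"
    using assms by (auto simp: partial_character_def)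
  have "(x \<otimes> inv x, z * inverse w) \<in> R"
    using assms unfolding partial_character_def by blast
  then have "z * inverse w = 1"
    using assms x unfolding partial_character_def by (auto simp: r_inv)
  with w show ?thesis by (simp add: field_simps)
qed

lemma partial_character_int_pow:
  assumes R: "partial_character G R" and xz: "(x, z) \<in> R"
  shows "(x [^] (k::int), z powi k) \<in> R"
proof -
  have nat: "(x [^] (n::nat), z ^ n) \<in> R" for n
  proof (induction n)
    case 0
    then show ?case using R by (simp add: partial_character_def)
  next
    case (Suc n)
    then have "(x [^] n \<otimes> x, z ^ n * z) \<in> R"
      using R xz unfolding partial_character_def by blast
    then show ?case by (simp add: mult.commute)
  qed
  have x: "x \<in> carrier G"
    using R xz by (auto simp: partial_character_def)
  show ?thesis
  proof (cases "k \<ge> 0")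
    case True
    then obtain n where "k = int n" using nonneg_eq_int by blast
    then show ?thesis using nat[of n] by (simp add: int_pow_int)
  next
    case False
    then obtain n where k: "k = - int n"
      by (metis int_cases2 of_nat_0_le_iff)
    have "(inv (x [^] n), inverse (z ^ n)) \<in> R"
      using nat[of n] R unfolding partial_character_def by blast
    then show ?thesis using x
      by (simp add: k int_pow_neg int_pow_int power_int_minus)
  qed
qed

text \<open>Adjoining means multiplying old pairs by powers of \<open>(a, z)\<close>. The condition
  \<open>compat\<close> keeps the value over the unit equal to \<open>1\<close>: an equation
  \<open>h \<otimes> a [^] k = \<one>\<close> places \<open>a [^] k\<close> in the old domain, where
  its value has to be \<open>z powi k\<close>.\<close>

lemma partial_character_adjoin:
  assumes R: "partial_character G R" and a: "a \<in> carrier G" and z: "cmod z = 1"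
    and compat: "\<forall>(k::int) w. (a [^] k, w) \<in> R \<longrightarrow> w = z powi k"
  obtains R' where "partial_character G R'" "R \<subseteq> R'" "(a, z) \<in> R'"
proof
  let ?R' = "{(h \<otimes> a [^] k, w * z powi k) | h w (k::int). (h, w) \<in> R}"
  have RD: "R \<subseteq> carrier G \<times> sphere 0 1" "(\<one>, 1) \<in> R"
    "\<And>x z y w. (x, z) \<in> R \<Longrightarrow> (y, w) \<in> R \<Longrightarrow> (x \<otimes> y, z * w) \<in> R"
    "\<And>x z. (x, z) \<in> R \<Longrightarrow> (inv x, inverse z) \<in> R"
    using R unfolding partial_character_def by blast+
  have z0: "z \<noteq> 0" using z by auto
  show "partial_character G ?R'"
    unfolding partial_character_def
  proof (intro conjI allI impI)
    show "?R' \<subseteq> carrier G \<times> sphere 0 1"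
      using RD(1) a z by (auto simp: norm_mult norm_power_int)
    show "(\<one>, 1) \<in> ?R'"
    proof -
      have "(\<one>, 1) = (\<one> \<otimes> a [^] (0::int), 1 * z powi 0)" by simp
      then show ?thesis using RD(2) by blast
    qed
    fix x v y w
    assume "(x, v) \<in> ?R'" "(y, w) \<in> ?R'"
    then obtain h1 w1 h2 w2 and k1 k2 :: int where
      *: "x = h1 \<otimes> a [^] k1" "v = w1 * z powi k1" "(h1, w1) \<in> R"
      "y = h2 \<otimes> a [^] k2" "w = w2 * z powi k2" "(h2, w2) \<in> R" by blast
    have h: "h1 \<in> carrier G" "h2 \<in> carrier G" using * RD(1) by auto
    have "x \<otimes> y = (h1 \<otimes> h2) \<otimes> a [^] (k1 + k2)"
      unfolding *(1,4) using h a by (simp only: int_pow_mult m_ac m_closed int_pow_closed)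
    moreover have "v * w = (w1 * w2) * z powi (k1 + k2)"
      using * z0 by (simp add: power_int_add)
    moreover have "(h1 \<otimes> h2, w1 * w2) \<in> R" using * RD(3) by blast
    ultimately show "(x \<otimes> y, v * w) \<in> ?R'" by blast
  next
    fix x v
    assume "(x, v) \<in> ?R'"
    then obtain h1 w1 and k1 :: int where
      *: "x = h1 \<otimes> a [^] k1" "v = w1 * z powi k1" "(h1, w1) \<in> R" by blast
    have h: "h1 \<in> carrier G" using * RD(1) by auto
    have "inv x = inv h1 \<otimes> a [^] (- k1)"
      unfolding *(1) using h a by (simp only: inv_mult int_pow_neg int_pow_closed)
    moreover have "inverse v = inverse w1 * z powi (- k1)"
      using * z0 by (simp add: power_int_minus)
    moreover have "(inv h1, inverse w1) \<in> R" using * RD(4) by blast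
    ultimately show "(inv x, inverse v) \<in> ?R'" by blast
  next
    fix v
    assume "(\<one>, v) \<in> ?R'"
    then obtain h1 w1 and k1 :: int where
      *: "\<one> = h1 \<otimes> a [^] k1" "v = w1 * z powi k1" "(h1, w1) \<in> R" by blast
    have h: "h1 \<in> carrier G" using * RD(1) by auto
    have "a [^] k1 = inv h1"
      using *(1) h a inv_equality[of "a [^] k1" h1] m_comm[of h1 "a [^] k1"] inv_equality[of h1 "a [^] k1"]
      by (metis inv_inv int_pow_closed)
    then have "inverse w1 = z powi k1"
      using compat RD(4)[OF *(3)] by metis
    then have "w1 * inverse w1 = v" using *(2) by simp
    moreover have "w1 \<noteq> 0" using RD(1) *(3) by auto
    ultimately show "v = 1" by simp
  qed
  show "R \<subseteq> ?R'"
  proof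
    fix y assume y: "y \<in> R"
    obtain h w where hw: "y = (h, w)" by (cases y)
    then have "h \<in> carrier G" using RD(1) y by blast
    then have "y = (h \<otimes> a [^] (0::int), w * z powi 0)" by (simp add: hw)
    moreover have "(h, w) \<in> R" using y hw by simp
    ultimately show "y \<in> ?R'" by blast
  qed
  have "(a, z) = (\<one> \<otimes> a [^] (1::int), 1 * z powi 1)" using a by (simp add: int_pow_1)
  then show "(a, z) \<in> ?R'" using RD(2) by blast
qed

text \<open>Divisibility of the circle: if \<open>a [^] n\<close> is the first positive power in the
  domain, any \<open>n\<close>-th root of its value is compatible. The freedom in the choice of the
  root is spent on avoiding the value \<open>1\<close> at a new element, which is what later
  separates elements of the group.\<close>

lemma compatible_value_exists:
  assumes R: "partial_character G R" and a: "a \<in> carrier G"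
  obtains z where "cmod z = 1" "\<forall>(k::int) w. (a [^] k, w) \<in> R \<longrightarrow> w = z powi k"
    "a \<notin> Domain R \<longrightarrow> z \<noteq> 1"
proof (cases "\<exists>n::nat. n > 0 \<and> a [^] n \<in> Domain R")
  case False
  have "w = (-1) powi k" if "(a [^] k, w) \<in> R" for k :: int and w
  proof -
    have "k = 0"
    proof (rule ccontr)
      assume "k \<noteq> 0"
      have "(a [^] (sgn k * k), w powi sgn k) \<in> R"
        using partial_character_int_pow[OF R that, of "sgn k"] int_pow_pow[OF a, of k "sgn k"]
        by (simp add: mult.commute)
      moreover have "sgn k * k = int (nat \<bar>k\<bar>)" by (cases "k \<ge> 0") (auto simp: sgn_if)
      ultimately have "a [^] (nat \<bar>k\<bar>) \<in> Domain R"
        by (metis Domain.intros int_pow_int)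
      with False \<open>k \<noteq> 0\<close> show False
        by (metis zero_less_abs_iff zero_less_nat_eq)
    qed
    with that R show ?thesis by (auto simp: partial_character_def)
  qed
  \<comment> \<open>No nonzero power of \<open>a\<close> has a prescribed value, so every unimodular
    number is compatible; \<open>-1\<close> is one that differs from \<open>1\<close>.\<close>
  then show ?thesis using that[of "-1"] by simp
next
  case True
  define n where "n = (LEAST n::nat. n > 0 \<and> a [^] n \<in> Domain R)"
  have n: "n > 0" "a [^] n \<in> Domain R"
    using LeastI_ex[OF True] by (auto simp: n_def)
  have least: "n \<le> m" if "m > 0" "a [^] m \<in> Domain R" for m
    using that unfolding n_def by (auto intro: Least_le)
  obtain w0 where w0: "(a [^] n, w0) \<in> R" using n by blast
  then have w01: "cmod w0 = 1" using R by (auto simp: partial_character_def)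
  \<comment> \<open>The root with the principal argument equals \<open>1\<close> only if
    \<open>w0 = 1\<close>; in that case a primitive \<open>n\<close>-th root of unity replaces it.
    For \<open>n = 1\<close> there is no choice, but then \<open>a\<close> is already in the
    domain.\<close>
  define z0 where "z0 = (if w0 = 1 \<and> n \<ge> 2 then cis (2 * pi / n) else cis (Arg w0 / n))"
  have z0: "cmod z0 = 1" by (simp add: z0_def)
  have pow: "z0 ^ n = w0"
  proof (cases "w0 = 1 \<and> n \<ge> 2")
    case True
    then have "real n * (2 * pi / real n) = 2 * pi" by simp
    with True show ?thesis by (simp only: z0_def Complex.DeMoivre if_True simp_thms cis_2pi)
  next
    case False
    have "w0 \<noteq> 0" using w01 by auto
    then have "cis (Arg w0) = w0" using w01 by (simp add: cis_Arg sgn_div_norm)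
    then show ?thesis using False n by (auto simp: z0_def Complex.DeMoivre)
  qed
  \<comment> \<open>Division of \<open>k\<close> by \<open>n\<close> with remainder
    \<open>m\<close>: the power \<open>a [^] m\<close> lies in the domain too, so minimality of
    \<open>n\<close> forces \<open>m = 0\<close>.\<close>
  have dvd: "w = z0 powi k" if kw: "(a [^] k, w) \<in> R" for k :: int and w
  proof -
    have npow: "(a [^] n) [^] j = a [^] (int n * j)" for j :: int
      using int_pow_pow[OF a, of "int n" j] by (simp add: int_pow_int)
    define q m where "q = k div int n" and "m = k mod int n"
    have m: "0 \<le> m" "m < int n" "k = int n * q + m" using n by (auto simp: q_def m_def)
    have P: "((a [^] n) [^] q, w0 powi q) \<in> R"
      by (rule partial_character_int_pow[OF R w0])
    have "((a [^] n) [^] (-q), w0 powi (-q)) \<in> R"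
      by (rule partial_character_int_pow[OF R w0])
    then have "(a [^] k \<otimes> (a [^] n) [^] (-q), w * w0 powi (-q)) \<in> R"
      using kw R unfolding partial_character_def by blast
    moreover have "a [^] k \<otimes> (a [^] n) [^] (-q) = a [^] m"
    proof -
      have "(a [^] n) [^] (-q) = a [^] (- (int n * q))"
        by (simp add: npow)
      then have "a [^] k \<otimes> (a [^] n) [^] (-q) = a [^] (k + - (int n * q))"
        using a by (simp only: int_pow_mult)
      then show ?thesis using m by simp
    qed
    ultimately have "a [^] m \<in> Domain R" by auto
    then have "a [^] nat m \<in> Domain R" using m int_pow_int[of G a "nat m"] by simp
    then have "m = 0" using least[of "nat m"] m by (cases "m = 0") auto
    then have "(a [^] n) [^] q = a [^] k" using m by (simp add: npow)
    then have "w = w0 powi q"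
      using partial_character_unique[OF R kw] P by metis
    then show ?thesis using \<open>m = 0\<close> m pow by (simp add: power_int_mult)
  qed
  have "z0 \<noteq> 1" if aR: "a \<notin> Domain R"
  proof
    assume "z0 = 1"
    then have w: "w0 = 1" using pow by simp
    have "n \<noteq> 1" using n aR a by auto
    then have n2: "n \<ge> 2" using n by simp
    then have "z0 = cis (2 * pi / n)" using w by (simp add: z0_def)
    then have "cos (2 * pi / n) = 1" using \<open>z0 = 1\<close> by (metis cis.sel(1) one_complex.sel(1))
    then obtain j :: int where "2 * pi / n = of_int j * 2 * pi" by (auto simp: cos_one_2pi_int)
    then have "real_of_int (j * int n) = 1" using n2 by (simp add: field_simps)
    then have "j * int n = 1" by (simp only: of_int_eq_1_iff)
    then have "int n dvd 1" using dvd_triv_right[of "int n" j] by simp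
    then show False using n2 by simp
  qed
  with z0 dvd show ?thesis using that[of z0] by blast
qed

text \<open>The trivial partial character is first given a value other than \<open>1\<close> at
  \<open>g\<close>. A maximal extension, from Zorn's lemma for relations ordered by inclusion, is
  total because a compatible value could be adjoined at any missing element.\<close>

lemma group_character_separates:
  assumes g: "g \<in> carrier G" "g \<noteq> \<one>"
  obtains \<kappa> :: "'a \<Rightarrow> complex" where
    "\<And>x. x \<in> carrier G \<Longrightarrow> cmod (\<kappa> x) = 1"
    "\<And>x y. x \<in> carrier G \<Longrightarrow> y \<in> carrier G \<Longrightarrow> \<kappa> (x \<otimes> y) = \<kappa> x * \<kappa> y"
    "\<kappa> g \<noteq> 1"
proof -
  have R0: "partial_character G {(\<one>, 1)}" by (auto simp: partial_character_def)
  obtain z where z: "cmod z = 1" "\<forall>(k::int) w. (g [^] k, w) \<in> {(\<one>, 1)} \<longrightarrow> w = z powi k"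
    "g \<notin> Domain {(\<one>, 1::complex)} \<longrightarrow> z \<noteq> 1"
    using compatible_value_exists[OF R0 g(1)] by metis
  obtain R1 where R1: "partial_character G R1" "(g, z) \<in> R1"
    using partial_character_adjoin[OF R0 g(1) z(1,2)] by metis
  have z1: "z \<noteq> 1" using z g by auto
  let ?A = "{R. partial_character G R \<and> R1 \<subseteq> R}"
  have "\<exists>M\<in>?A. \<forall>Y\<in>?A. M \<subseteq> Y \<longrightarrow> Y = M"
  proof (rule subset_Zorn_nonempty)
    show "?A \<noteq> {}" using R1 by auto
    fix C assume C: "C \<noteq> {}" "subset.chain ?A C"
    then have CA: "\<And>R. R \<in> C \<Longrightarrow> partial_character G R" "\<And>R. R \<in> C \<Longrightarrow> R1 \<subseteq> R"
      by (auto simp: subset.chain_def)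
    have tot: "R \<subseteq> R' \<or> R' \<subseteq> R" if "R \<in> C" "R' \<in> C" for R R'
      using C(2) that unfolding subset.chain_def by blast
    have "partial_character G (\<Union>C)"
      unfolding partial_character_def
    proof (intro conjI allI impI)
      show "\<Union>C \<subseteq> carrier G \<times> sphere 0 1" using CA(1) unfolding partial_character_def by (intro Union_least) metis
      show "(\<one>, 1) \<in> \<Union>C" using C(1) CA(1) unfolding partial_character_def by blast
      fix x v y w assume "(x, v) \<in> \<Union>C" "(y, w) \<in> \<Union>C"
      then obtain R R' where *: "R \<in> C" "R' \<in> C" "(x, v) \<in> R" "(y, w) \<in> R'" by blast
      then obtain R'' where "R'' \<in> C" "(x, v) \<in> R''" "(y, w) \<in> R''"
        using tot[of R R'] by blast
      then show "(x \<otimes> y, v * w) \<in> \<Union>C" using CA(1) unfolding partial_character_def by blast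
    next
      fix x v assume "(x, v) \<in> \<Union>C"
      then show "(inv x, inverse v) \<in> \<Union>C" using CA(1) unfolding partial_character_def by blast
    next
      fix v assume "(\<one>, v) \<in> \<Union>C"
      then show "v = 1" using CA(1) unfolding partial_character_def by blast
    qed
    then show "\<Union>C \<in> ?A" using C(1) CA by blast
  qed
  then obtain M where M: "partial_character G M" "R1 \<subseteq> M"
    "\<And>Y. partial_character G Y \<Longrightarrow> R1 \<subseteq> Y \<Longrightarrow> M \<subseteq> Y \<Longrightarrow> Y = M" by auto
  have dom: "x \<in> Domain M" if x: "x \<in> carrier G" for x
  proof -
    obtain v where v: "cmod v = 1" "\<forall>(k::int) w. (x [^] k, w) \<in> M \<longrightarrow> w = v powi k"
      using compatible_value_exists[OF M(1) x] by metis
    obtain Y where "partial_character G Y" "M \<subseteq> Y" "(x, v) \<in> Y"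
      using partial_character_adjoin[OF M(1) x v] by metis
    then show ?thesis using M by blast
  qed
  define \<kappa> where "\<kappa> x = (SOME v. (x, v) \<in> M)" for x
  have \<kappa>: "(x, \<kappa> x) \<in> M" if "x \<in> carrier G" for x
    using dom[OF that] unfolding \<kappa>_def by (metis Domain.cases someI_ex)
  show ?thesis
  proof
    show "cmod (\<kappa> x) = 1" if "x \<in> carrier G" for x
      using \<kappa>[OF that] M by (auto simp: partial_character_def)
    show "\<kappa> (x \<otimes> y) = \<kappa> x * \<kappa> y" if "x \<in> carrier G" "y \<in> carrier G" for x y
    proof (rule partial_character_unique[OF M(1)])
      show "(x \<otimes> y, \<kappa> (x \<otimes> y)) \<in> M" using \<kappa> that by simp
      show "(x \<otimes> y, \<kappa> x * \<kappa> y) \<in> M"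
        using \<kappa>[OF that(1)] \<kappa>[OF that(2)] M(1) unfolding partial_character_def by blast
    qed
    show "\<kappa> g \<noteq> 1"
      using partial_character_unique[OF M(1) \<kappa>[OF g(1)]] M(2) R1 z1 by blast
  qed
qed

end

section \<open>Sublinear functions on abelian groups and states for an order unit\<close>

lemma le_cInf_add:
  fixes X Y :: "real set"
  assumes "X \<noteq> {}" "Y \<noteq> {}" "\<And>x y. x \<in> X \<Longrightarrow> y \<in> Y \<Longrightarrow> z \<le> x + y"
  shows "z \<le> Inf X + Inf Y"
proof -
  have "z - x \<le> Inf Y" if "x \<in> X" for x
    using assms(2) assms(3)[OF that] by (intro cInf_greatest) (auto simp: algebra_simps)
  then have "z - Inf Y \<le> Inf X"
    using assms(1) by (intro cInf_greatest) (auto simp: algebra_simps)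
  then show ?thesis by simp
qed

lemma le_mult_cInf:
  fixes X :: "real set"
  assumes "X \<noteq> {}" "k > 0" "\<And>x. x \<in> X \<Longrightarrow> z \<le> k * x"
  shows "z \<le> k * Inf X"
proof -
  have "z / k \<le> Inf X"
    using assms by (intro cInf_greatest) (auto simp: field_simps)
  with assms(2) show ?thesis by (simp add: field_simps)
qed

text \<open>The group version of a sublinear functional, with natural powers in the role of
  nonnegative scalar multiples.\<close>

definition sublinear :: "('a, 'b) monoid_scheme \<Rightarrow> ('a \<Rightarrow> real) \<Rightarrow> bool" where
  "sublinear G q \<longleftrightarrow>
     (\<forall>x\<in>carrier G. \<forall>y\<in>carrier G. q (x \<otimes>\<^bsub>G\<^esub> y) \<le> q x + q y) \<and>
     (\<forall>x\<in>carrier G. \<forall>n::nat. q (x [^]\<^bsub>G\<^esub> n) = real n * q x)"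

context comm_group
begin

lemma sublinear_one: "sublinear G q \<Longrightarrow> q \<one> = 0"
  unfolding sublinear_def using nat_pow_0 one_closed by (metis mult_zero_left of_nat_0)

lemma sublinear_ge:
  assumes "sublinear G q" "x \<in> carrier G" shows "- q (inv x) \<le> q x"
proof -
  have "q (x \<otimes> inv x) \<le> q x + q (inv x)"
    using assms unfolding sublinear_def by blast
  with sublinear_one[OF assms(1)] assms(2) show ?thesis by (simp add: r_inv)
qed

text \<open>In additive notation \<open>qa\<close> is the infimum of q(x + na) - n q(a), the
  function used in the proof of the Hahn-Banach theorem by minimal sublinear functionals. It lies
  below \<open>q\<close>, and its third property turns into superadditivity as soon as
  \<open>qa\<close> agrees with \<open>q\<close>.\<close>

lemma sublinear_shift:
  assumes q: "sublinear G q" and a: "a \<in> carrier G"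
  defines "qa \<equiv> \<lambda>x. INF n::nat. q (x \<otimes> a [^] n) - real n * q a"
  shows "sublinear G qa" "\<And>x. x \<in> carrier G \<Longrightarrow> qa x \<le> q x"
    "\<And>x. x \<in> carrier G \<Longrightarrow> qa x \<le> q (x \<otimes> a) - q a"
proof -
  have sub: "q (x \<otimes> y) \<le> q x + q y" if "x \<in> carrier G" "y \<in> carrier G" for x y
    using q that unfolding sublinear_def by blast
  have pow: "q (x [^] n) = real n * q x" if "x \<in> carrier G" for x and n :: nat
    using q that unfolding sublinear_def by blast
  define V where "V x = range (\<lambda>n::nat. q (x \<otimes> a [^] n) - real n * q a)" for x
  have qa: "qa x = Inf (V x)" for x by (simp add: qa_def V_def)
  have ne: "V x \<noteq> {}" for x by (simp add: V_def)
  have bdd: "bdd_below (V x)" if x: "x \<in> carrier G" for x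
  proof (rule bdd_belowI)
    fix v assume "v \<in> V x"
    then obtain n :: nat where v: "v = q (x \<otimes> a [^] n) - real n * q a" by (auto simp: V_def)
    have "q (inv x \<otimes> (x \<otimes> a [^] n)) \<le> q (inv x) + q (x \<otimes> a [^] n)"
      using x a by (intro sub) auto
    moreover have "inv x \<otimes> (x \<otimes> a [^] n) = a [^] n" using x a by (simp add: m_assoc[symmetric])
    ultimately show "- q (inv x) \<le> v" using pow[OF a, of n] v by simp
  qed
  have low: "qa x \<le> q (x \<otimes> a [^] n) - real n * q a" if "x \<in> carrier G" for x and n :: nat
    unfolding qa by (rule cInf_lower[OF _ bdd[OF that]]) (simp add: V_def)
  show "qa x \<le> q x" if "x \<in> carrier G" for x using low[OF that, of 0] that by simp
  show "qa x \<le> q (x \<otimes> a) - q a" if "x \<in> carrier G" for x using low[OF that, of 1] that a by simp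
  show "sublinear G qa"
    unfolding sublinear_def
  proof (intro conjI ballI allI)
    fix x y assume xy: "x \<in> carrier G" "y \<in> carrier G"
    show "qa (x \<otimes> y) \<le> qa x + qa y"
      unfolding qa[of x] qa[of y]
    proof (rule le_cInf_add[OF ne ne])
      fix v w assume "v \<in> V x" "w \<in> V y"
      then obtain n m :: nat where v: "v = q (x \<otimes> a [^] n) - real n * q a"
        and w: "w = q (y \<otimes> a [^] m) - real m * q a" by (auto simp: V_def)
      have "(x \<otimes> y) \<otimes> a [^] (n + m) = (x \<otimes> a [^] n) \<otimes> (y \<otimes> a [^] m)"
        using xy a by (simp add: nat_pow_mult[symmetric] m_ac)
      then have "q ((x \<otimes> y) \<otimes> a [^] (n + m)) \<le> q (x \<otimes> a [^] n) + q (y \<otimes> a [^] m)"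
        using sub[of "x \<otimes> a [^] n" "y \<otimes> a [^] m"] xy a by simp
      then show "qa (x \<otimes> y) \<le> v + w"
        using low[of "x \<otimes> y" "n + m"] xy v w by (simp add: algebra_simps)
    qed
  next
    fix x :: 'a and k :: nat assume x: "x \<in> carrier G"
    show "qa (x [^] k) = real k * qa x"
    proof (cases "k = 0")
      case True
      have "V \<one> = {0}" using pow[OF a] a by (auto simp: V_def)
      then show ?thesis using True by (simp add: qa)
    next
      case False
      then have k: "real k > 0" by simp
      have pk: "(x \<otimes> a [^] n) [^] k = x [^] k \<otimes> a [^] (k * n)" for n :: nat
        using x a by (simp add: nat_pow_distrib nat_pow_pow mult.commute)
      have qk: "q (x [^] k \<otimes> a [^] (k * n)) = real k * q (x \<otimes> a [^] n)" for n :: nat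
        using pow[of "x \<otimes> a [^] n" k] x a by (simp add: pk)
      show ?thesis
      proof (rule antisym)
        show "qa (x [^] k) \<le> real k * qa x"
          unfolding qa[of x]
        proof (rule le_mult_cInf[OF ne k])
          fix v assume "v \<in> V x"
          then obtain n :: nat where v: "v = q (x \<otimes> a [^] n) - real n * q a" by (auto simp: V_def)
          have "qa (x [^] k) \<le> q (x [^] k \<otimes> a [^] (k * n)) - real (k * n) * q a"
            using x by (intro low) simp
          also have "\<dots> = real k * v" unfolding qk v by (simp add: right_diff_distrib)
          finally show "qa (x [^] k) \<le> real k * v" .
        qed
        show "real k * qa x \<le> qa (x [^] k)"
          unfolding qa[of "x [^] k"]
        proof (rule cInf_greatest[OF ne])
          fix v assume "v \<in> V (x [^] k)"
          then obtain m :: nat where v: "v = q (x [^] k \<otimes> a [^] m) - real m * q a" by (auto simp: V_def)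
          have le: "m \<le> k * m" using False by simp
          \<comment> \<open>The exponent \<open>m\<close> need not be a multiple of
            \<open>k\<close>. Raising it to \<open>k * m\<close> can only lower the term, since
            \<open>q\<close> is subadditive and homogeneous on the powers of \<open>a\<close>; the
            raised term is \<open>k\<close> times a term of \<open>V x\<close>.\<close>
          have "x [^] k \<otimes> a [^] (k * m) = (x [^] k \<otimes> a [^] m) \<otimes> a [^] (k * m - m)"
            using x a le by (simp add: m_assoc nat_pow_mult)
          then have "q (x [^] k \<otimes> a [^] (k * m)) \<le> q (x [^] k \<otimes> a [^] m) + real (k * m - m) * q a"
            using sub[of "x [^] k \<otimes> a [^] m" "a [^] (k * m - m)"] x a le pow[OF a, of "k * m - m"]
            by (simp add: of_nat_diff)
          moreover have "real k * qa x \<le> real k * (q (x \<otimes> a [^] m) - real m * q a)"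
            using low[OF x, of m] k by (intro mult_left_mono) auto
          moreover have "real (k * m - m) = real k * real m - real m"
            using le by (simp add: of_nat_diff)
          ultimately show "real k * qa x \<le> v"
            using qk[of m] v by (simp add: algebra_simps)
        qed
      qed
    qed
  qed
qed

text \<open>The infimum is finite because every member is at least \<open>- p (inv x)\<close> at
  \<open>x\<close>. It is subadditive because two members are comparable, so that the smaller one
  serves both arguments at once.\<close>

lemma sublinear_chain_Inf:
  fixes C :: "('a \<Rightarrow> real) set" and p :: "'a \<Rightarrow> real"
  assumes C: "C \<noteq> {}" "\<And>q. q \<in> C \<Longrightarrow> sublinear G q"
    and dom: "\<And>q x. q \<in> C \<Longrightarrow> x \<in> carrier G \<Longrightarrow> q x \<le> p x"
    and tot: "\<And>q q'. q \<in> C \<Longrightarrow> q' \<in> C \<Longrightarrow>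
      (\<forall>x\<in>carrier G. q x \<le> q' x) \<or> (\<forall>x\<in>carrier G. q' x \<le> q x)"
  shows "sublinear G (\<lambda>x. INF q\<in>C. q x)"
    and "\<And>q x. q \<in> C \<Longrightarrow> x \<in> carrier G \<Longrightarrow> (INF q\<in>C. q x) \<le> q x"
proof -
  have bdd: "bdd_below ((\<lambda>q. q x) ` C)" if x: "x \<in> carrier G" for x
  proof (rule bdd_belowI2)
    fix q assume q: "q \<in> C"
    show "- p (inv x) \<le> q x"
      using sublinear_ge[OF C(2)[OF q] x] dom[OF q, of "inv x"] x by simp
  qed
  show low: "(INF q\<in>C. q x) \<le> q x" if "q \<in> C" "x \<in> carrier G" for q x
    using bdd that by (intro cINF_lower) auto
  show "sublinear G (\<lambda>x. INF q\<in>C. q x)"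
    unfolding sublinear_def
  proof (intro conjI ballI allI)
    fix x y assume xy: "x \<in> carrier G" "y \<in> carrier G"
    show "(INF q\<in>C. q (x \<otimes> y)) \<le> (INF q\<in>C. q x) + (INF q\<in>C. q y)"
    proof (rule le_cInf_add)
      fix v w assume "v \<in> (\<lambda>q. q x) ` C" "w \<in> (\<lambda>q. q y) ` C"
      then obtain q q' where *: "q \<in> C" "q' \<in> C" "v = q x" "w = q' y" by auto
      obtain q'' where "q'' \<in> C" "q'' x \<le> q x" "q'' y \<le> q' y"
        using tot[OF *(1,2)] * xy by (metis order_refl)
      moreover from this have "q'' (x \<otimes> y) \<le> q'' x + q'' y"
        using C(2) xy unfolding sublinear_def by blast
      ultimately show "(INF q\<in>C. q (x \<otimes> y)) \<le> v + w"
        using low[of q'' "x \<otimes> y"] xy * by auto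
    qed (use C in auto)
  next
    fix x :: 'a and n :: nat assume x: "x \<in> carrier G"
    have eq: "q (x [^] n) = real n * q x" if "q \<in> C" for q
      using C(2)[OF that] x unfolding sublinear_def by blast
    show "(INF q\<in>C. q (x [^] n)) = real n * (INF q\<in>C. q x)"
    proof (cases "n = 0")
      case True
      have "(\<lambda>q. q \<one>) ` C = {0}" using C sublinear_one by (auto simp: image_iff)
      then show ?thesis using True by simp
    next
      case False
      then have n: "real n > 0" by simp
      show ?thesis
      proof (rule antisym)
        show "(INF q\<in>C. q (x [^] n)) \<le> real n * (INF q\<in>C. q x)"
        proof (rule le_mult_cInf[OF _ n])
          fix v assume "v \<in> (\<lambda>q. q x) ` C"
          then obtain q where q: "q \<in> C" "v = q x" by auto
          then show "(INF q\<in>C. q (x [^] n)) \<le> real n * v"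
            using low[OF q(1), of "x [^] n"] eq[OF q(1)] x by simp
        qed (use C in auto)
        show "real n * (INF q\<in>C. q x) \<le> (INF q\<in>C. q (x [^] n))"
        proof (rule cINF_greatest[OF C(1)])
          fix q assume q: "q \<in> C"
          then show "real n * (INF q\<in>C. q x) \<le> q (x [^] n)"
            using low[OF q x] eq[OF q] n by simp
        qed
      qed
    qed
  qed
qed

text \<open>A minimal sublinear function below \<open>p\<close> is additive: otherwise its shift in
  \<open>sublinear_shift\<close> would be smaller.\<close>

lemma sublinear_dominates_additive:
  assumes p: "sublinear G p"
  obtains \<phi> :: "'a \<Rightarrow> real" where
    "\<And>x y. x \<in> carrier G \<Longrightarrow> y \<in> carrier G \<Longrightarrow> \<phi> (x \<otimes> y) = \<phi> x + \<phi> y"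
    "\<And>x. x \<in> carrier G \<Longrightarrow> \<phi> x \<le> p x"
proof -
  define A where "A = {q \<in> extensional (carrier G). sublinear G q \<and> (\<forall>x\<in>carrier G. q x \<le> p x)}"
  \<comment> \<open>The order is reversed: \<open>P q q'\<close> puts \<open>q'\<close> below
    \<open>q\<close>, so the maximal element given by Zorn's lemma is a minimal sublinear function.
    Restriction to extensional functions makes this order antisymmetric.\<close>
  define P where "P q q' \<longleftrightarrow> (\<forall>x\<in>carrier G. q' x \<le> q x)" for q q' :: "'a \<Rightarrow> real"
  have cong: "sublinear G (restrict q (carrier G))" if "sublinear G q" for q
    using that unfolding sublinear_def by simp
  have "\<exists>m\<in>A. \<forall>a\<in>A. P m a \<longrightarrow> a = m"
  proof (rule predicate_Zorn)
    show "partial_order_on A (relation_of P A)"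
      unfolding partial_order_on_def preorder_on_def
    proof (intro conjI)
      show "relation_of P A \<subseteq> A \<times> A" by (auto simp: relation_of_def)
      show "refl_on A (relation_of P A)"
        by (auto simp: relation_of_def refl_on_def P_def)
      show "trans (relation_of P A)"
        unfolding relation_of_def P_def by (rule transI) (auto intro: order_trans)
      show "antisym (relation_of P A)"
      proof (rule antisymI)
        fix q q' assume "(q, q') \<in> relation_of P A" "(q', q) \<in> relation_of P A"
        then have "q \<in> extensional (carrier G)" "q' \<in> extensional (carrier G)"
          "\<And>x. x \<in> carrier G \<Longrightarrow> q x = q' x"
          by (auto simp: relation_of_def A_def P_def intro: antisym)
        then show "q = q'" by (rule extensionalityI)
      qed
    qed
    fix C assume C: "C \<in> Chains (relation_of P A)"
    have CA: "q \<in> A" if "q \<in> C" for q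
      using C that unfolding Chains_def relation_of_def by blast
    show "\<exists>u\<in>A. \<forall>a\<in>C. P a u"
    proof (cases "C = {}")
      case True
      then show ?thesis
        using p cong[OF p] by (intro bexI[of _ "restrict p (carrier G)"]) (auto simp: A_def)
    next
      case False
      have 1: "sublinear G q" if "q \<in> C" for q using CA[OF that] by (simp add: A_def)
      have 2: "q x \<le> p x" if "q \<in> C" "x \<in> carrier G" for q x
        using CA[OF that(1)] that(2) by (simp add: A_def)
      have 3: "(\<forall>x\<in>carrier G. q x \<le> q' x) \<or> (\<forall>x\<in>carrier G. q' x \<le> q x)"
        if "q \<in> C" "q' \<in> C" for q q'
        using C that unfolding Chains_def relation_of_def P_def by blast
      have I1: "sublinear G (\<lambda>x. INF q\<in>C. q x)"
        by (rule sublinear_chain_Inf(1)[where C = C and p = p]) (use False 1 2 3 in blast)+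
      have I2: "(INF q\<in>C. q x) \<le> q x" if "q \<in> C" "x \<in> carrier G" for q x
        by (rule sublinear_chain_Inf(2)[where C = C and p = p]) (use False 1 2 3 that in blast)+
      let ?u = "restrict (\<lambda>x. INF q\<in>C. q x) (carrier G)"
      obtain q0 where q0: "q0 \<in> C" using False by blast
      have "(INF q\<in>C. q x) \<le> p x" if "x \<in> carrier G" for x
        using I2[OF q0 that] 2[OF q0 that] by simp
      then have "?u \<in> A" using cong[OF I1] by (simp add: A_def)
      moreover have "P a ?u" if "a \<in> C" for a
        using I2[OF that] by (simp add: P_def)
      ultimately show ?thesis by blast
    qed
  qed
  then obtain m where m: "sublinear G m" "\<And>x. x \<in> carrier G \<Longrightarrow> m x \<le> p x"
    "\<And>a. a \<in> A \<Longrightarrow> P m a \<Longrightarrow> a = m" by (auto simp: A_def)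
  have "m x + m a \<le> m (x \<otimes> a)" if xa: "x \<in> carrier G" "a \<in> carrier G" for x a
  proof -
    define ma where "ma = (\<lambda>x. INF n::nat. m (x \<otimes> a [^] n) - real n * m a)"
    have S: "sublinear G ma" "\<And>x. x \<in> carrier G \<Longrightarrow> ma x \<le> m x"
      "\<And>x. x \<in> carrier G \<Longrightarrow> ma x \<le> m (x \<otimes> a) - m a"
      unfolding ma_def by (rule sublinear_shift[OF m(1) xa(2)], assumption?)+
    have "restrict ma (carrier G) \<in> A"
      using cong[OF S(1)] S(2) m(2) by (auto simp: A_def intro: order_trans)
    then have "restrict ma (carrier G) = m"
      using m(3) S(2) by (simp add: P_def)
    then have "ma x = m x" using xa by (metis restrict_apply')
    then show ?thesis using S(3)[OF xa(1)] by simp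
  qed
  moreover have "m (x \<otimes> a) \<le> m x + m a" if "x \<in> carrier G" "a \<in> carrier G" for x a
    using m(1) that unfolding sublinear_def by blast
  ultimately show ?thesis using that[of m] m(2) by (meson antisym)
qed

text \<open>With \<open>T\<close> as positive cone, \<open>p g\<close> is the infimum of the
  rational multiples of \<open>u\<close> that dominate \<open>g\<close>. It is finite from above
  because \<open>u\<close> is an order unit and from below by \<open>proper\<close>. An additive
  function below \<open>p\<close> is nonnegative on \<open>T\<close>, since \<open>inv x\<close> is
  dominated by 0 for \<open>x\<close> in \<open>T\<close>, and at least 1 at \<open>u\<close>, since
  \<open>p (inv u)\<close> is at most -1.\<close>

lemma order_unit_state:
  assumes T: "T \<subseteq> carrier G" "\<one> \<in> T" "\<And>x y. x \<in> T \<Longrightarrow> y \<in> T \<Longrightarrow> x \<otimes> y \<in> T"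
    and u: "u \<in> T"
    and proper: "\<And>n::int. u [^] n \<in> T \<Longrightarrow> n \<ge> 0"
    and unit: "\<And>g. g \<in> carrier G \<Longrightarrow> \<exists>n::nat. u [^] n \<otimes> g \<in> T"
  obtains \<phi> :: "'a \<Rightarrow> real" where
    "\<And>x y. x \<in> carrier G \<Longrightarrow> y \<in> carrier G \<Longrightarrow> \<phi> (x \<otimes> y) = \<phi> x + \<phi> y"
    "\<And>x. x \<in> T \<Longrightarrow> \<phi> x \<ge> 0" "\<phi> u \<ge> 1"
proof -
  have uG: "u \<in> carrier G" using T u by auto
  have Tpow: "x [^] (n::nat) \<in> T" if "x \<in> T" for x n
    using that T by (induction n) auto
  \<comment> \<open>In the order given by the cone \<open>T\<close>, \<open>W g n m\<close> says
    that the \<open>m\<close>-th power of \<open>g\<close> is at most the \<open>n\<close>-th power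
    of \<open>u\<close>.\<close>
  define W where "W g n m \<longleftrightarrow> m > 0 \<and> u [^] n \<otimes> inv (g [^] int m) \<in> T"
    for g and n :: int and m :: nat
  define V where "V g = {real_of_int n / real m | n m. W g n m}" for g
  define p where "p g = Inf (V g)" for g
  have VI: "real_of_int n / real m \<in> V g" if "W g n m" for g n m
    using that by (auto simp: V_def)
  have ne: "V g \<noteq> {}" if g: "g \<in> carrier G" for g
  proof -
    obtain n :: nat where "u [^] n \<otimes> inv g \<in> T" using unit[OF inv_closed[OF g]] ..
    then have "W g (int n) 1" using g by (simp add: W_def int_pow_int)
    then show ?thesis using VI by blast
  qed
  have bdd: "bdd_below (V g)" if g: "g \<in> carrier G" for g
  proof -
    obtain k :: nat where k: "u [^] k \<otimes> g \<in> T" using unit g by blast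
    have "- real k \<le> v" if v: "v \<in> V g" for v
    proof -
      obtain n m where nm: "v = real_of_int n / real m" "m > 0" "u [^] n \<otimes> inv (g [^] int m) \<in> T"
        using v by (auto simp: V_def W_def)
      \<comment> \<open>Here \<open>g\<close> cancels and only a power of \<open>u\<close> with
        exponent \<open>k * m + n\<close> remains in \<open>T\<close>; by \<open>proper\<close> the
        exponent is nonnegative, that is, \<open>n / m\<close> is at least
        \<open>- k\<close>.\<close>
      have "(u [^] k \<otimes> g) [^] m \<otimes> (u [^] n \<otimes> inv (g [^] int m)) \<in> T"
        using T(3)[OF Tpow[OF k] nm(3)] by simp
      also have "(u [^] k \<otimes> g) [^] m = u [^] (int (k * m)) \<otimes> g [^] int m"
        using uG g by (simp only: int_pow_int nat_pow_distrib nat_pow_pow nat_pow_closed)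
      also have "u [^] (int (k * m)) \<otimes> g [^] int m \<otimes> (u [^] n \<otimes> inv (g [^] int m))
        = u [^] (int (k * m)) \<otimes> u [^] n \<otimes> (g [^] int m \<otimes> inv (g [^] int m))"
        using uG g by (simp only: m_ac m_closed int_pow_closed inv_closed)
      also have "\<dots> = u [^] (int (k * m) + n)"
        using uG g by (simp only: r_inv int_pow_closed int_pow_mult r_one m_closed)
      finally have "int (k * m) + n \<ge> 0" by (rule proper)
      then have "real k * real m + real_of_int n \<ge> 0"
        by (metis of_int_0_le_iff of_int_add of_int_of_nat_eq of_nat_mult)
      then have "- real k * real m \<le> real_of_int n" by simp
      then show ?thesis using nm by (simp add: pos_le_divide_eq)
    qed
    then show ?thesis by (rule bdd_belowI)
  qed
  have low: "p g \<le> real_of_int n / real m" if "g \<in> carrier G" "W g n m" for g n m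
    unfolding p_def using VI[OF that(2)] bdd[OF that(1)] by (rule cInf_lower)
  have "sublinear G p"
    unfolding sublinear_def
  proof (intro conjI ballI allI)
    fix x y assume xy: "x \<in> carrier G" "y \<in> carrier G"
    show "p (x \<otimes> y) \<le> p x + p y"
      unfolding p_def[of x] p_def[of y]
    proof (rule le_cInf_add[OF ne[OF xy(1)] ne[OF xy(2)]])
      fix v w assume "v \<in> V x" "w \<in> V y"
      then obtain n1 m1 n2 m2 where *: "v = real_of_int n1 / real m1" "W x n1 m1"
        "w = real_of_int n2 / real m2" "W y n2 m2" by (auto simp: V_def)
      have "(u [^] n1 \<otimes> inv (x [^] int m1)) [^] m2 \<otimes> (u [^] n2 \<otimes> inv (y [^] int m2)) [^] m1 \<in> T"
        using * T(3) Tpow unfolding W_def by blast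
      also have "(u [^] n1 \<otimes> inv (x [^] int m1)) [^] m2 = u [^] (n1 * int m2) \<otimes> inv (x [^] (int (m1 * m2)))"
        using uG xy by (simp add: int_pow_distrib int_pow_pow int_pow_inv[symmetric] int_pow_int[symmetric])
      also have "(u [^] n2 \<otimes> inv (y [^] int m2)) [^] m1 = u [^] (n2 * int m1) \<otimes> inv (y [^] (int (m1 * m2)))"
        using uG xy by (simp add: int_pow_distrib int_pow_pow int_pow_inv[symmetric] int_pow_int[symmetric] mult.commute)
      also have "u [^] (n1 * int m2) \<otimes> inv (x [^] int (m1 * m2)) \<otimes> (u [^] (n2 * int m1) \<otimes> inv (y [^] int (m1 * m2)))
        = u [^] (n1 * int m2) \<otimes> u [^] (n2 * int m1) \<otimes> (inv (x [^] int (m1 * m2)) \<otimes> inv (y [^] int (m1 * m2)))"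
        using uG xy by (simp only: m_ac m_closed int_pow_closed inv_closed)
      also have "\<dots> = u [^] (n1 * int m2 + n2 * int m1) \<otimes> inv ((x \<otimes> y) [^] int (m1 * m2))"
        using uG xy by (simp only: int_pow_mult int_pow_distrib inv_mult int_pow_closed m_closed)
      finally have "W (x \<otimes> y) (n1 * int m2 + n2 * int m1) (m1 * m2)"
        using * by (simp add: W_def)
      from low[OF _ this] xy have "p (x \<otimes> y) \<le> (n1 * int m2 + n2 * int m1) / real (m1 * m2)" by simp
      also have "\<dots> = v + w" using * by (simp add: W_def field_simps)
      finally show "p (x \<otimes> y) \<le> v + w" .
    qed
  next
    fix x :: 'a and k :: nat assume x: "x \<in> carrier G"
    show "p (x [^] k) = real k * p x"
    proof (cases "k = 0")
      case True
      have "0 \<le> p \<one>"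
        unfolding p_def using ne
      proof (rule cInf_greatest)
        fix v assume "v \<in> V \<one>"
        then obtain n m where "v = real_of_int n / real m" "W \<one> n m" by (auto simp: V_def)
        then show "0 \<le> v" using proper[of n] uG by (simp add: W_def)
      qed simp
      moreover have "W \<one> 0 1" using T by (simp add: W_def)
      then have "p \<one> \<le> 0" using low[of \<one> 0 1] by simp
      ultimately show ?thesis using True by simp
    next
      case False
      then have k: "real k > 0" by simp
      have kk: "(x [^] k) [^] int m = x [^] int (k * m)" for m
        by (simp only: int_pow_int nat_pow_pow[OF x])
      show ?thesis
      proof (rule antisym)
        show "p (x [^] k) \<le> real k * p x"
          unfolding p_def[of x]
        proof (rule le_mult_cInf[OF ne[OF x] k])
          fix v assume "v \<in> V x"
          then obtain n m where *: "v = real_of_int n / real m" "W x n m" by (auto simp: V_def)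
          have "(u [^] n \<otimes> inv (x [^] int m)) [^] k \<in> T" using * Tpow by (auto simp: W_def)
          also have "(u [^] n \<otimes> inv (x [^] int m)) [^] k = u [^] (n * int k) \<otimes> inv ((x [^] k) [^] int m)"
            unfolding kk using uG x
            by (simp add: int_pow_distrib int_pow_pow int_pow_inv[symmetric] int_pow_int[symmetric] mult.commute)
          finally have "W (x [^] k) (n * int k) m" using * by (simp add: W_def)
          from low[OF _ this] x have "p (x [^] k) \<le> real_of_int (n * int k) / real m" by simp
          then show "p (x [^] k) \<le> real k * v" using * by (simp add: mult.commute)
        qed
        show "real k * p x \<le> p (x [^] k)"
          unfolding p_def[of "x [^] k"]
        proof (rule cInf_greatest[OF ne])
          fix v assume "v \<in> V (x [^] k)"
          then obtain n m where *: "v = real_of_int n / real m" "W (x [^] k) n m" by (auto simp: V_def)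
          then have "W x n (k * m)" using False unfolding W_def kk by simp
          from low[OF x this] have "real k * p x \<le> real k * (real_of_int n / real (k * m))"
            using k by (intro mult_left_mono) auto
          also have "\<dots> = v" using k * by simp
          finally show "real k * p x \<le> v" .
        qed (use x in simp)
      qed
    qed
  qed
  then obtain \<phi> where \<phi>: "\<And>x y. x \<in> carrier G \<Longrightarrow> y \<in> carrier G \<Longrightarrow> \<phi> (x \<otimes> y) = \<phi> x + \<phi> y"
    "\<And>x. x \<in> carrier G \<Longrightarrow> \<phi> x \<le> p x"
    using sublinear_dominates_additive by metis
  have \<phi>1: "\<phi> \<one> = 0" using \<phi>(1)[of \<one> \<one>] by simp
  have \<phi>inv: "\<phi> (inv x) = - \<phi> x" if "x \<in> carrier G" for x
    using \<phi>(1)[of x "inv x"] that \<phi>1 by (simp add: r_inv)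
  show ?thesis
  proof
    show "\<phi> (x \<otimes> y) = \<phi> x + \<phi> y" if "x \<in> carrier G" "y \<in> carrier G" for x y
      using \<phi>(1) that by blast
    show "\<phi> x \<ge> 0" if "x \<in> T" for x
    proof -
      have x: "x \<in> carrier G" using that T by blast
      then have "W (inv x) 0 1" using that by (simp add: W_def)
      then show ?thesis using low[of "inv x" 0 1] \<phi>(2)[of "inv x"] \<phi>inv x by simp
    qed
    have "W (inv u) (-1) 1" using T uG by (simp add: W_def int_pow_neg l_inv)
    then show "\<phi> u \<ge> 1" using low[of "inv u" "-1" 1] \<phi>(2)[of "inv u"] \<phi>inv uG by simp
  qed
qed

end

section \<open>The space of semicharacters\<close>

text \<open>Coordinates outside \<open>I\<close> are constant on extensional functions, so they add
  no open sets. This replaces the abstract product topologies of the definitions by subspaces of the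
  function space, where \<open>compact\<close>, \<open>continuous_on\<close> and limits are
  available.\<close>

lemma subtopology_product_extensional:
  fixes A :: "('a \<Rightarrow> 'b::topological_space) set"
  assumes A: "A \<subseteq> extensional I"
  shows "subtopology (product_topology (\<lambda>_. euclidean) I) A = top_of_set A"
proof -
  let ?X = "subtopology (product_topology (\<lambda>_. euclidean) I) A"
  have top: "topspace ?X = A" using A by (auto simp: PiE_def)
  have "continuous_map ?X (product_topology (\<lambda>_. euclidean) UNIV) (\<lambda>x. x)"
    unfolding continuous_map_componentwise_UNIV
  proof
    fix i
    show "continuous_map ?X euclidean (\<lambda>x. x i)"
    proof (cases "i \<in> I")
      case True
      then show ?thesis
        by (intro continuous_map_from_subtopology continuous_map_product_projection)
    next
      case False
      have "continuous_map ?X euclidean (\<lambda>x. undefined)" by simp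
      then show ?thesis
        by (rule continuous_map_eq) (use A False top in \<open>auto simp: extensional_def\<close>)
    qed
  qed
  then have "continuous_map ?X (top_of_set A) (\<lambda>x. x)"
    by (simp add: euclidean_product_topology continuous_map_in_subtopology top)
  moreover have "continuous_map (top_of_set A) ?X (\<lambda>x. x)"
    using A by (auto simp: continuous_map_in_subtopology continuous_map_componentwise
        intro: continuous_on_product_then_coordinatewise)
  ultimately have "openin ?X U \<longleftrightarrow> openin (top_of_set A) U" for U
    using openin_continuous_map_preimage[of ?X "top_of_set A" "\<lambda>x. x" U]
      openin_continuous_map_preimage[of "top_of_set A" ?X "\<lambda>x. x" U]
      openin_subset[of ?X U] openin_subset[of "top_of_set A" U] top
    by (metis (no_types, lifting) Collect_cong Collect_mem_eq subset_iff topspace_euclidean_subtopology)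
  then show ?thesis by (simp add: topology_eq)
qed

lemma semichar_topology_eq: "semichar_topology T = top_of_set (semicharacters T)"
  unfolding semichar_topology_def
  by (rule subtopology_product_extensional) (auto simp: semicharacters_def)

lemma character_topology_eq: "character_topology T = top_of_set (characters T)"
  unfolding character_topology_def semichar_topology_eq
  by (simp add: subtopology_subtopology characters_def Int_absorb1 subset_iff)

lemma continuous_on_coordinate [continuous_intros]:
  "continuous_on A (\<lambda>x. x i :: 'b::topological_space)"
  by (rule continuous_on_subset[OF continuous_on_product_coordinates]) simp

lemma compact_PiE:
  fixes K :: "'a \<Rightarrow> 'b::topological_space set"
  assumes "\<And>i. i \<in> I \<Longrightarrow> compact (K i)"
  shows "compact (PiE I K)"
proof -
  have "compactin (product_topology (\<lambda>_. euclidean) I) (PiE I K)"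
    using assms by (auto simp: compactin_PiE)
  then have "compact_space (top_of_set (PiE I K))"
    by (simp add: compactin_subspace subtopology_product_extensional PiE_def)
  then have "compactin euclidean (PiE I K)" by (simp add: compactin_subspace)
  then show ?thesis by simp
qed

text \<open>For a multiplicative function, being not identically zero amounts to having the value 1
  at the unit. In that form the semicharacters are cut out of a product of closed discs by closed
  conditions.\<close>

lemma compact_semicharacters:
  assumes one: "\<one>\<^bsub>T\<^esub> \<in> carrier T" "\<And>s. s \<in> carrier T \<Longrightarrow> \<one>\<^bsub>T\<^esub> \<otimes>\<^bsub>T\<^esub> s = s"
  shows "compact (semicharacters T)"
proof -
  have "semicharacters T = (PiE (carrier T) (\<lambda>_. cball 0 1)) \<inter>
     ((\<Inter>s\<in>carrier T. \<Inter>t\<in>carrier T. {\<psi>. \<psi> (s \<otimes>\<^bsub>T\<^esub> t) = \<psi> s * \<psi> t}) \<inter> {\<psi>. \<psi> \<one>\<^bsub>T\<^esub> = 1})"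
    (is "_ = ?K \<inter> ?C")
  proof (intro equalityI subsetI)
    fix \<psi> assume \<psi>: "\<psi> \<in> semicharacters T"
    then obtain s where s: "s \<in> carrier T" "\<psi> s \<noteq> 0" by (auto simp: semicharacters_def)
    have "\<psi> (\<one>\<^bsub>T\<^esub> \<otimes>\<^bsub>T\<^esub> s) = \<psi> \<one>\<^bsub>T\<^esub> * \<psi> s"
      using \<psi> s(1) one(1) unfolding semicharacters_def by blast
    then have "\<psi> \<one>\<^bsub>T\<^esub> = 1" using s one by simp
    with \<psi> show "\<psi> \<in> ?K \<inter> ?C" by (auto simp: semicharacters_def PiE_def)
  next
    fix \<psi> assume \<psi>: "\<psi> \<in> ?K \<inter> ?C"
    then have "\<psi> \<one>\<^bsub>T\<^esub> = 1" by auto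
    then have "\<exists>s\<in>carrier T. \<psi> s \<noteq> 0" using one by force
    with \<psi> show "\<psi> \<in> semicharacters T" by (auto simp: semicharacters_def PiE_def Pi_def)
  qed
  moreover have "closed ?C"
    by (intro closed_Int closed_INT ballI closed_Collect_eq continuous_intros)
  ultimately show ?thesis by (simp add: compact_PiE compact_Int_closed)
qed

lemma compact_characters:
  assumes "\<one>\<^bsub>T\<^esub> \<in> carrier T" "\<And>s. s \<in> carrier T \<Longrightarrow> \<one>\<^bsub>T\<^esub> \<otimes>\<^bsub>T\<^esub> s = s"
  shows "compact (characters T)"
proof -
  have "characters T = semicharacters T \<inter> (\<Inter>s\<in>carrier T. {\<psi>. cmod (\<psi> s) = 1})"
    by (auto simp: characters_def)
  moreover have "closed (\<Inter>s\<in>carrier T. {\<psi>::'a \<Rightarrow> complex. cmod (\<psi> s) = 1})"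
    by (intro closed_INT ballI closed_Collect_eq continuous_intros)
  ultimately show ?thesis
    using compact_semicharacters[OF assms] by (simp add: compact_Int_closed)
qed

section \<open>Polynomials\<close>

text \<open>A list of pairs \<open>(c, g)\<close> represents the formal sum of the terms \<open>c g\<close>; the elements \<open>g\<close> may be repeated.\<close>

definition peval :: "(complex \<times> 'a) list \<Rightarrow> ('a \<Rightarrow> complex) \<Rightarrow> complex" where
  "peval xs \<xi> = (\<Sum>(c, g)\<leftarrow>xs. c * \<xi> g)"

definition pmul ::
    "('a, 'b) monoid_scheme \<Rightarrow> (complex \<times> 'a) list \<Rightarrow> (complex \<times> 'a) list \<Rightarrow> (complex \<times> 'a) list" where
  "pmul G xs ys = concat (map (\<lambda>(c, g). map (\<lambda>(d, h). (c * d, g \<otimes>\<^bsub>G\<^esub> h)) ys) xs)"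

definition pscale :: "complex \<Rightarrow> (complex \<times> 'a) list \<Rightarrow> (complex \<times> 'a) list" where
  "pscale a xs = map (\<lambda>(c, g). (a * c, g)) xs"

definition coef :: "(complex \<times> 'a) list \<Rightarrow> 'a \<Rightarrow> complex" where
  "coef xs g = (\<Sum>(c, h)\<leftarrow>xs. if h = g then c else 0)"

lemma peval_Nil [simp]: "peval [] \<xi> = 0"
  and peval_Cons [simp]: "peval ((c, g) # xs) \<xi> = c * \<xi> g + peval xs \<xi>"
  and peval_append [simp]: "peval (xs @ ys) \<xi> = peval xs \<xi> + peval ys \<xi>"
  by (simp_all add: peval_def)

lemma peval_pscale [simp]: "peval (pscale a xs) \<xi> = a * peval xs \<xi>"
  by (induction xs) (auto simp: pscale_def algebra_simps)

lemma snd_pscale [simp]: "snd ` set (pscale a xs) = snd ` set xs"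
  by (induction xs) (auto simp: pscale_def)

lemma peval_pmul:
  assumes "\<And>g h. g \<in> P \<Longrightarrow> h \<in> P \<Longrightarrow> \<xi> (g \<otimes>\<^bsub>G\<^esub> h) = \<xi> g * \<xi> h"
    and "snd ` set xs \<subseteq> P" "snd ` set ys \<subseteq> P"
  shows "peval (pmul G xs ys) \<xi> = peval xs \<xi> * peval ys \<xi>"
proof -
  have *: "peval (map (\<lambda>(d, h). (c * d, g \<otimes>\<^bsub>G\<^esub> h)) ys) \<xi> = c * \<xi> g * peval ys \<xi>" if "g \<in> P" for c g
    using assms(3) by (induction ys) (auto simp: assms(1) that algebra_simps)
  show ?thesis
    using assms(2) by (induction xs) (auto simp: pmul_def * algebra_simps)
qed

lemma snd_pmul: "snd ` set (pmul G xs ys) = (\<lambda>(g, h). g \<otimes>\<^bsub>G\<^esub> h) ` (snd ` set xs \<times> snd ` set ys)"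
  by (force simp: pmul_def image_iff)

lemma peval_coef:
  assumes "finite A" "snd ` set xs \<subseteq> A"
  shows "peval xs \<xi> = (\<Sum>g\<in>A. coef xs g * \<xi> g)"
  using assms(2)
proof (induction xs)
  case (Cons x xs)
  obtain c h where x: "x = (c, h)" by (cases x)
  have "(\<Sum>g\<in>A. coef (x # xs) g * \<xi> g)
    = (\<Sum>g\<in>A. (if h = g then c * \<xi> g else 0) + coef xs g * \<xi> g)"
    by (intro sum.cong refl) (auto simp: coef_def x algebra_simps)
  also have "\<dots> = c * \<xi> h + (\<Sum>g\<in>A. coef xs g * \<xi> g)"
    using Cons.prems assms(1) x by (simp add: sum.distrib sum.delta')
  finally show ?case using Cons x by simp
qed (simp add: coef_def)

section \<open>Supports of powers of a polynomial\<close>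

primrec monomial :: "('a, 'b) monoid_scheme \<Rightarrow> 'a list \<Rightarrow> nat list \<Rightarrow> 'a" where
  "monomial G [] ks = \<one>\<^bsub>G\<^esub>"
| "monomial G (g # gs) ks = g [^]\<^bsub>G\<^esub> hd ks \<otimes>\<^bsub>G\<^esub> monomial G gs (tl ks)"

primrec ppow :: "('a, 'b) monoid_scheme \<Rightarrow> (complex \<times> 'a) list \<Rightarrow> nat \<Rightarrow> (complex \<times> 'a) list" where
  "ppow G xs 0 = [(1, \<one>\<^bsub>G\<^esub>)]"
| "ppow G xs (Suc n) = pmul G xs (ppow G xs n)"

context comm_monoid
begin

lemma monomial_closed [simp]:
  "set gs \<subseteq> carrier G \<Longrightarrow> monomial G gs ks \<in> carrier G"
  by (induction gs arbitrary: ks) auto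

lemma monomial_mult_generator:
  assumes "set gs \<subseteq> carrier G" "length ks = length gs" "i < length gs"
  shows "gs ! i \<otimes> monomial G gs ks = monomial G gs (ks[i := Suc (ks ! i)])"
  using assms
proof (induction gs arbitrary: ks i)
  case (Cons g gs)
  then obtain k ks' where ks: "ks = k # ks'" by (cases ks) auto
  show ?case
  proof (cases i)
    case 0
    then show ?thesis using Cons.prems by (simp add: ks m_ac)
  next
    case (Suc j)
    have c: "gs ! j \<in> carrier G" using Cons.prems Suc by auto
    have "gs ! j \<otimes> (g [^] k \<otimes> monomial G gs ks') = g [^] k \<otimes> (gs ! j \<otimes> monomial G gs ks')"
      using Cons.prems c by (simp add: m_lcomm)
    then show ?thesis using Cons.prems Cons.IH[of ks' j] Suc by (simp add: ks)
  qed
qed simp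

lemma monomial_zero: "set gs \<subseteq> carrier G \<Longrightarrow> monomial G gs (replicate (length gs) 0) = \<one>"
  by (induction gs) auto

text \<open>By commutativity a product of \<open>n\<close> listed elements depends only on how often
  each is used. The support of the \<open>n\<close>-th power is thus indexed by exponent vectors
  with entries at most \<open>n\<close>, whose number is polynomial in \<open>n\<close>.\<close>

lemma support_ppow:
  assumes "snd ` set xs \<subseteq> carrier G"
  shows "snd ` set (ppow G xs n) \<subseteq>
    monomial G (map snd xs) ` {ks. set ks \<subseteq> {0..n} \<and> length ks = length xs}"
proof (induction n)
  case 0
  have "\<one> = monomial G (map snd xs) (replicate (length xs) 0)"
    using monomial_zero[of "map snd xs"] assms by simp
  moreover have "replicate (length xs) (0::nat) \<in> {ks. set ks \<subseteq> {0..0} \<and> length ks = length xs}"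
    by auto
  ultimately show ?case by auto
next
  case (Suc n)
  show ?case
  proof
    fix a assume "a \<in> snd ` set (ppow G xs (Suc n))"
    then obtain g h where gh: "a = g \<otimes> h" "g \<in> snd ` set xs" "h \<in> snd ` set (ppow G xs n)"
      by (auto simp: snd_pmul)
    then obtain ks where ks: "h = monomial G (map snd xs) ks" "set ks \<subseteq> {0..n}" "length ks = length xs"
      using Suc.IH by blast
    obtain i where i: "i < length xs" "g = map snd xs ! i"
      using gh(2) by (metis in_set_conv_nth length_map set_map)
    have "a = monomial G (map snd xs) (ks[i := Suc (ks ! i)])"
      unfolding gh(1) ks(1) i(2)
      by (rule monomial_mult_generator) (use assms ks i in auto)
    moreover have "set (ks[i := Suc (ks ! i)]) \<subseteq> insert (Suc (ks ! i)) (set ks)"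
      by (rule set_update_subset_insert)
    moreover have "ks ! i \<in> set ks" using i ks by simp
    ultimately show "a \<in> monomial G (map snd xs) ` {ks. set ks \<subseteq> {0..Suc n} \<and> length ks = length xs}"
      using ks by fastforce
  qed
qed

lemma card_support_ppow:
  assumes "snd ` set xs \<subseteq> carrier G"
  shows "card (snd ` set (ppow G xs n)) \<le> (n + 1) ^ length xs"
proof -
  let ?K = "{ks. set ks \<subseteq> {0..n} \<and> length ks = length xs}"
  have fin: "finite ?K" by (rule finite_lists_length_eq) simp
  have "card (snd ` set (ppow G xs n)) \<le> card (monomial G (map snd xs) ` ?K)"
    using support_ppow[OF assms] fin by (intro card_mono) auto
  also have "\<dots> \<le> card ?K" using fin by (rule card_image_le)
  also have "\<dots> = (n + 1) ^ length xs" by (simp add: card_lists_length_eq)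
  finally show ?thesis .
qed

end

text \<open>If \<open>M < y\<close>, the geometric decay of \<open>(M / y) ^ n\<close> beats the
  polynomial factor.\<close>

lemma le_if_power_le_polynomial_times_power:
  fixes y M :: real
  assumes "0 \<le> M" and le: "\<And>n. y ^ n \<le> real (n + 1) ^ L * M ^ n"
  shows "y \<le> M"
proof (rule ccontr)
  assume "\<not> y \<le> M"
  then have yM: "M < y" by simp
  show False
  proof (cases "M = 0")
    case True
    then show False using le[of 1] yM by simp
  next
    case False
    define q where "q = M / y"
    have q: "0 < q" "q < 1" using False assms(1) yM by (auto simp: q_def)
    have "(\<lambda>n. real (n + 1) ^ L * q ^ n) \<longlonglongrightarrow> 0"
      using q by real_asymp
    moreover have "1 \<le> real (n + 1) ^ L * q ^ n" for n
      using le[of n] yM assms(1) by (simp add: q_def power_divide field_simps)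
    ultimately have "(1::real) \<le> 0"
      by (intro LIMSEQ_le_const) auto
    then show False by simp
  qed
qed

text \<open>The powers of a polynomial have supports of polynomially growing size, so the bound on the
  coefficients loses only a factor that disappears after taking roots.\<close>

lemma (in comm_monoid) multiplicative_le_sup:
  assumes P: "P \<subseteq> carrier G" "\<one> \<in> P" "\<And>g h. g \<in> P \<Longrightarrow> h \<in> P \<Longrightarrow> g \<otimes> h \<in> P"
    and X: "\<And>\<eta> g h. \<eta> \<in> X \<Longrightarrow> g \<in> P \<Longrightarrow> h \<in> P \<Longrightarrow> \<eta> (g \<otimes> h) = \<eta> g * \<eta> h"
      "\<And>\<eta>. \<eta> \<in> X \<Longrightarrow> \<eta> \<one> = 1"
    and coef: "\<And>xs M g. snd ` set xs \<subseteq> P \<Longrightarrow> (\<And>\<eta>. \<eta> \<in> X \<Longrightarrow> cmod (peval xs \<eta>) \<le> M) \<Longrightarrow> cmod (coef xs g) \<le> M"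
    and \<xi>: "\<And>g h. g \<in> P \<Longrightarrow> h \<in> P \<Longrightarrow> \<xi> (g \<otimes> h) = \<xi> g * \<xi> h" "\<xi> \<one> = 1"
      "\<And>g. g \<in> P \<Longrightarrow> cmod (\<xi> g) \<le> 1"
    and xs: "snd ` set xs \<subseteq> P" and M: "0 \<le> M" "\<And>\<eta>. \<eta> \<in> X \<Longrightarrow> cmod (peval xs \<eta>) \<le> M"
  shows "cmod (peval xs \<xi>) \<le> M"
proof (rule le_if_power_le_polynomial_times_power[OF M(1)])
  fix n
  have supp: "snd ` set (ppow G xs n) \<subseteq> P" for n
  proof (induction n)
    case (Suc n)
    then show ?case using xs P(3) by (auto simp: snd_pmul)
  qed (use P in simp)
  have pow: "peval (ppow G xs n) \<zeta> = peval xs \<zeta> ^ n"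
    if "\<And>g h. g \<in> P \<Longrightarrow> h \<in> P \<Longrightarrow> \<zeta> (g \<otimes> h) = \<zeta> g * \<zeta> h" "\<zeta> \<one> = 1" for \<zeta> n
  proof (induction n)
    case (Suc n)
    have "peval (pmul G xs (ppow G xs n)) \<zeta> = peval xs \<zeta> * peval (ppow G xs n) \<zeta>"
      by (rule peval_pmul[where P = P]) (use that xs supp in auto)
    then show ?case using Suc by simp
  qed (use that in simp)
  have c: "cmod (coef (ppow G xs n) g) \<le> M ^ n" for g
  proof (rule coef[OF supp])
    fix \<eta> assume \<eta>: "\<eta> \<in> X"
    then show "cmod (peval (ppow G xs n) \<eta>) \<le> M ^ n"
      using pow[of \<eta> n] X M(2)[OF \<eta>] by (simp add: norm_power power_mono)
  qed
  let ?A = "snd ` set (ppow G xs n)"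
  have "cmod (peval xs \<xi>) ^ n = cmod (peval (ppow G xs n) \<xi>)"
    using pow[of \<xi> n] \<xi> by (simp add: norm_power)
  also have "\<dots> = cmod (\<Sum>g\<in>?A. coef (ppow G xs n) g * \<xi> g)"
    by (subst peval_coef[of ?A]) auto
  also have "\<dots> \<le> (\<Sum>g\<in>?A. M ^ n)"
  proof (rule sum_norm_le)
    fix g assume "g \<in> ?A"
    then have "cmod (\<xi> g) \<le> 1" using supp \<xi>(3) by blast
    then have "cmod (coef (ppow G xs n) g) * cmod (\<xi> g) \<le> M ^ n * 1"
      using c M(1) by (intro mult_mono) auto
    then show "cmod (coef (ppow G xs n) g * \<xi> g) \<le> M ^ n" by (simp add: norm_mult)
  qed
  also have "\<dots> = real (card ?A) * M ^ n" by simp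
  also have "\<dots> \<le> real ((n + 1) ^ length xs) * M ^ n"
    using card_support_ppow[of xs n] xs P M(1)
    by (intro mult_right_mono) (auto simp del: of_nat_power)
  finally show "cmod (peval xs \<xi>) ^ n \<le> real (n + 1) ^ length xs * M ^ n" by simp
qed

section \<open>Semigroups without nontrivial prime ideals\<close>

text \<open>A group satisfies \<open>prime_ideals\<close> vacuously, its only ideal being the whole
  group. In a nontrivial group all semicharacters are characters, all continuous functions belong to
  the algebra and the spectral semigroup is \<open>G\<close>, contrary to the first claim;
  \<open>not_nontrivial_group\<close> excludes this case.\<close>

locale no_nontrivial_prime_ideals =
  fixes S :: "'a monoid" and G :: "'a monoid" (structure)
  assumes S: "comm_monoid_cancel S"
    and prime_ideals: "\<And>I. semigroup_prime_ideal S I \<Longrightarrow> I = carrier S - {\<one>\<^bsub>S\<^esub>}"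
    and not_nontrivial_group: "Units S = carrier S \<Longrightarrow> carrier S = {\<one>\<^bsub>S\<^esub>}"
    and quotients: "group_of_quotients S G"
begin

sublocale comm_group G
  using quotients by (simp add: group_of_quotients_def)

sublocale S: comm_monoid_cancel S
  by (rule S)

abbreviation "M \<equiv> carrier S"
abbreviation "X \<equiv> characters S"
abbreviation "SC \<equiv> semicharacters S"

lemma M_subset: "M \<subseteq> carrier G"
  and one_S [simp]: "\<one>\<^bsub>S\<^esub> = \<one>"
  and mult_S: "a \<in> M \<Longrightarrow> b \<in> M \<Longrightarrow> a \<otimes>\<^bsub>S\<^esub> b = a \<otimes> b"
  using quotients by (auto simp: group_of_quotients_def)

lemma M_carrier [simp]: "a \<in> M \<Longrightarrow> a \<in> carrier G"
  using M_subset by auto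

lemma one_M [simp]: "\<one> \<in> M"
  using S.one_closed by simp

lemma M_closed [simp]: "a \<in> M \<Longrightarrow> b \<in> M \<Longrightarrow> a \<otimes> b \<in> M"
  using S.m_closed[of a b] by (simp add: mult_S)

lemma M_pow [simp]: "a \<in> M \<Longrightarrow> a [^] (n::nat) \<in> M"
  by (induction n) auto

lemma quotient_repr:
  assumes "g \<in> carrier G"
  obtains a b where "a \<in> M" "b \<in> M" "g = inv a \<otimes> b"
  using assms quotients unfolding group_of_quotients_def by blast

lemma inv_mult_eq_iff:
  assumes "a \<in> M" "b \<in> M" "a' \<in> M" "b' \<in> M"
  shows "inv a \<otimes> b = inv a' \<otimes> b' \<longleftrightarrow> b \<otimes> a' = b' \<otimes> a"
proof -
  have c: "a \<in> carrier G" "b \<in> carrier G" "a' \<in> carrier G" "b' \<in> carrier G" using assms by auto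
  have "inv a \<otimes> b = inv a' \<otimes> b' \<longleftrightarrow> (a \<otimes> a') \<otimes> (inv a \<otimes> b) = (a \<otimes> a') \<otimes> (inv a' \<otimes> b')"
    using c l_cancel[of "a \<otimes> a'" "inv a \<otimes> b" "inv a' \<otimes> b'"] by auto
  also have "(a \<otimes> a') \<otimes> (inv a \<otimes> b) = (a \<otimes> inv a) \<otimes> (b \<otimes> a')"
    using c by (simp only: m_ac m_closed inv_closed)
  also have "(a \<otimes> a') \<otimes> (inv a' \<otimes> b') = (a' \<otimes> inv a') \<otimes> (b' \<otimes> a)"
    using c by (simp only: m_ac m_closed inv_closed)
  finally show ?thesis using c by (simp add: r_inv)
qed

lemma prime_ideal_M:
  assumes "I \<subseteq> M" "I \<noteq> {}" "\<one> \<notin> I"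
    and "\<And>a s. a \<in> I \<Longrightarrow> s \<in> M \<Longrightarrow> a \<otimes> s \<in> I"
    and "\<And>a b. a \<in> M \<Longrightarrow> b \<in> M \<Longrightarrow> a \<notin> I \<Longrightarrow> b \<notin> I \<Longrightarrow> a \<otimes> b \<notin> I"
  shows "I = M - {\<one>}"
proof -
  have "semigroup_prime_ideal S I"
    unfolding semigroup_prime_ideal_def semigroup_ideal_def subsemigroup_def
  proof (intro conjI ballI)
    fix a s assume "a \<in> I" "s \<in> M"
    then show "a \<otimes>\<^bsub>S\<^esub> s \<in> I" using assms(1) assms(4)[of a s] mult_S[of a s] by auto
  next
    show "M - I \<noteq> {}" using assms(3) one_M by blast
  next
    fix a b assume "a \<in> M - I" "b \<in> M - I"
    then show "a \<otimes>\<^bsub>S\<^esub> b \<in> M - I" using assms(5)[of a b] mult_S[of a b] by simp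
  qed (use assms in auto)
  then show ?thesis using prime_ideals by simp
qed

text \<open>The non-units form a prime ideal as soon as there are any. Being equal to
  \<open>M - {\<one>}\<close>, it leaves \<open>\<one>\<close> as the only unit; if there are no
  non-units, \<open>not_nontrivial_group\<close> applies.\<close>

lemma units_trivial:
  assumes "a \<in> M" "b \<in> M" "a \<otimes> b = \<one>"
  shows "a = \<one>"
proof (rule ccontr)
  assume a: "a \<noteq> \<one>"
  define U where "U = {x \<in> M. \<exists>y\<in>M. x \<otimes> y = \<one>}"
  have "M - U \<noteq> {}"
  proof
    assume "M - U = {}"
    then have "Units S = M"
      using mult_S by (force simp: Units_def U_def S.m_comm)
    then have "M = {\<one>}" using not_nontrivial_group by simp
    with a assms show False by auto
  qed
  have "M - U = M - {\<one>}"
  proof (rule prime_ideal_M)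
    show "\<one> \<notin> M - U" by (auto simp: U_def intro!: bexI[of _ \<one>])
    show "x \<otimes> s \<in> M - U" if "x \<in> M - U" "s \<in> M" for x s
    proof -
      have "x \<in> U" if "x \<otimes> s \<in> U"
      proof -
        obtain y where y: "y \<in> M" "(x \<otimes> s) \<otimes> y = \<one>" using \<open>x \<otimes> s \<in> U\<close> by (auto simp: U_def)
        then have "x \<otimes> (s \<otimes> y) = \<one>" using \<open>x \<in> M - U\<close> \<open>s \<in> M\<close> by (simp add: m_assoc)
        then show ?thesis using y \<open>x \<in> M - U\<close> \<open>s \<in> M\<close> by (auto simp: U_def)
      qed
      then show ?thesis using that by auto
    qed
    show "x \<otimes> z \<notin> M - U" if xz: "x \<in> M" "z \<in> M" "x \<notin> M - U" "z \<notin> M - U" for x z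
    proof -
      obtain x' z' where *: "x' \<in> M" "x \<otimes> x' = \<one>" "z' \<in> M" "z \<otimes> z' = \<one>"
        using xz by (auto simp: U_def)
      have "(x \<otimes> z) \<otimes> (x' \<otimes> z') = (x \<otimes> x') \<otimes> (z \<otimes> z')"
        using *(1,3) xz(1,2) by (simp only: m_ac M_carrier m_closed)
      then have "(x \<otimes> z) \<otimes> (x' \<otimes> z') = \<one>" using * by simp
      then show ?thesis using * by (auto simp: U_def intro!: bexI[of _ "x' \<otimes> z'"])
    qed
  qed (use \<open>M - U \<noteq> {}\<close> in auto)
  moreover have "a \<in> U" using assms by (auto simp: U_def)
  ultimately show False using a assms by blast
qed

text \<open>The divisors of powers of \<open>a\<close> are closed under products, and a divisor of
  such a divisor is again one. If they did not exhaust \<open>M\<close>, their complement would be a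
  prime ideal, hence \<open>M - {\<one>}\<close>, although it does not contain
  \<open>a\<close>.\<close>

lemma archimedean:
  assumes a: "a \<in> M" "a \<noteq> \<one>" and b: "b \<in> M"
  obtains n :: nat and c where "c \<in> M" "a [^] n = b \<otimes> c"
proof -
  define D where "D = {b \<in> M. \<exists>(n::nat). \<exists>c\<in>M. a [^] n = b \<otimes> c}"
  have aD: "a \<in> D" using a by (auto simp: D_def intro!: exI[of _ 1] bexI[of _ \<one>])
  have "M - D = {}"
  proof (rule ccontr)
    assume ne: "M - D \<noteq> {}"
    have "M - D = M - {\<one>}"
    proof (rule prime_ideal_M)
      show "\<one> \<notin> M - D" by (auto simp: D_def intro!: exI[of _ 0] bexI[of _ \<one>])
      show "x \<otimes> s \<in> M - D" if "x \<in> M - D" "s \<in> M" for x s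
      proof -
        have "x \<in> D" if "x \<otimes> s \<in> D"
        proof -
          obtain n :: nat and y where y: "y \<in> M" "a [^] n = (x \<otimes> s) \<otimes> y"
            using \<open>x \<otimes> s \<in> D\<close> by (auto simp: D_def)
          then have "a [^] n = x \<otimes> (s \<otimes> y)" using \<open>x \<in> M - D\<close> \<open>s \<in> M\<close> by (simp add: m_assoc)
          moreover have "s \<otimes> y \<in> M" "x \<in> M" using y \<open>x \<in> M - D\<close> \<open>s \<in> M\<close> by auto
          ultimately show ?thesis unfolding D_def by blast
        qed
        then show ?thesis using that by auto
      qed
      show "x \<otimes> z \<notin> M - D" if xz: "x \<in> M" "z \<in> M" "x \<notin> M - D" "z \<notin> M - D" for x z
      proof -
        obtain n m :: nat and x' z' where *: "x' \<in> M" "a [^] n = x \<otimes> x'" "z' \<in> M" "a [^] m = z \<otimes> z'"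
          using xz by (auto simp: D_def)
        have "a [^] (n + m) = (x \<otimes> x') \<otimes> (z \<otimes> z')"
          using * a by (simp flip: nat_pow_mult)
        also have "\<dots> = (x \<otimes> z) \<otimes> (x' \<otimes> z')"
          using *(1,3) xz(1,2) by (simp only: m_ac M_carrier m_closed)
        finally have "a [^] (n + m) = (x \<otimes> z) \<otimes> (x' \<otimes> z')" .
        moreover have "x' \<otimes> z' \<in> M" "x \<otimes> z \<in> M" using * xz by auto
        ultimately have "x \<otimes> z \<in> D" unfolding D_def by blast
        then show ?thesis by simp
      qed
    qed (use ne in auto)
    with aD a show False by auto
  qed
  then have "b \<in> D" using b by auto
  then show ?thesis using that by (auto simp: D_def)
qed

subsection \<open>Semicharacters\<close>

lemma SC_mult: "\<psi> \<in> SC \<Longrightarrow> a \<in> M \<Longrightarrow> b \<in> M \<Longrightarrow> \<psi> (a \<otimes> b) = \<psi> a * \<psi> b"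
  and SC_le: "\<psi> \<in> SC \<Longrightarrow> a \<in> M \<Longrightarrow> cmod (\<psi> a) \<le> 1"
  and SC_ext: "\<psi> \<in> SC \<Longrightarrow> \<psi> \<in> extensional M"
  by (auto simp: semicharacters_def mult_S)

lemma SC_one:
  assumes "\<psi> \<in> SC" shows "\<psi> \<one> = 1"
proof -
  obtain s where s: "s \<in> M" "\<psi> s \<noteq> 0" using assms by (auto simp: semicharacters_def)
  then show ?thesis using SC_mult[OF assms one_M s(1)] by simp
qed

lemma SC_I:
  assumes "\<psi> \<in> extensional M" "\<And>s. s \<in> M \<Longrightarrow> cmod (\<psi> s) \<le> 1"
    "\<And>s t. s \<in> M \<Longrightarrow> t \<in> M \<Longrightarrow> \<psi> (s \<otimes> t) = \<psi> s * \<psi> t" "\<psi> \<one> = 1"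
  shows "\<psi> \<in> SC"
  using assms by (auto simp: semicharacters_def mult_S intro!: bexI[of _ \<one>])

lemma X_SC: "\<eta> \<in> X \<Longrightarrow> \<eta> \<in> SC"
  and X_cmod: "\<eta> \<in> X \<Longrightarrow> s \<in> M \<Longrightarrow> cmod (\<eta> s) = 1"
  by (auto simp: characters_def)

definition nonvan :: "('a \<Rightarrow> complex) \<Rightarrow> bool" where
  "nonvan \<psi> \<longleftrightarrow> (\<forall>s\<in>M. \<psi> s \<noteq> 0)"

lemma X_nonvan: "\<eta> \<in> X \<Longrightarrow> nonvan \<eta>"
  using X_cmod by (fastforce simp: nonvan_def)

lemma SC_zero:
  assumes \<psi>: "\<psi> \<in> SC" "\<not> nonvan \<psi>" and s: "s \<in> M" "s \<noteq> \<one>"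
  shows "\<psi> s = 0"
proof -
  have "{s \<in> M. \<psi> s = 0} = M - {\<one>}"
    by (rule prime_ideal_M) (use \<psi> SC_mult[OF \<psi>(1)] SC_one[OF \<psi>(1)] in \<open>auto simp: nonvan_def\<close>)
  then show ?thesis using s by blast
qed

lemma SC_nonvan_if: "\<psi> \<in> SC \<Longrightarrow> s \<in> M \<Longrightarrow> s \<noteq> \<one> \<Longrightarrow> \<psi> s \<noteq> 0 \<Longrightarrow> nonvan \<psi>"
  using SC_zero by blast

lemma SC_less_one:
  assumes \<psi>: "\<psi> \<in> SC" "\<psi> \<notin> X" and s: "s \<in> M" "s \<noteq> \<one>"
  shows "cmod (\<psi> s) < 1"
proof -
  have "{s \<in> M. cmod (\<psi> s) < 1} = M - {\<one>}"
  proof (rule prime_ideal_M)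
    show "{s \<in> M. cmod (\<psi> s) < 1} \<noteq> {}"
      using \<psi> SC_le[OF \<psi>(1)] by (force simp: characters_def)
    show "a \<otimes> s \<in> {s \<in> M. cmod (\<psi> s) < 1}" if "a \<in> {s \<in> M. cmod (\<psi> s) < 1}" "s \<in> M" for a s
    proof -
      have "cmod (\<psi> a) * cmod (\<psi> s) \<le> cmod (\<psi> a) * 1"
        using that SC_le[OF \<psi>(1)] by (intro mult_left_mono) auto
      then show ?thesis using that SC_mult[OF \<psi>(1)] by (simp add: norm_mult)
    qed
    show "a \<otimes> b \<notin> {s \<in> M. cmod (\<psi> s) < 1}"
      if ab: "a \<in> M" "b \<in> M" "a \<notin> {s \<in> M. cmod (\<psi> s) < 1}" "b \<notin> {s \<in> M. cmod (\<psi> s) < 1}" for a b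
    proof -
      have "cmod (\<psi> a) = 1" "cmod (\<psi> b) = 1"
        using ab SC_le[OF \<psi>(1) ab(1)] SC_le[OF \<psi>(1) ab(2)] by auto
      then show ?thesis using ab SC_mult[OF \<psi>(1)] by (simp add: norm_mult)
    qed
  qed (use \<psi> SC_one[OF \<psi>(1)] in auto)
  then show ?thesis using s by blast
qed

abbreviation smult :: "('a \<Rightarrow> complex) \<Rightarrow> ('a \<Rightarrow> complex) \<Rightarrow> 'a \<Rightarrow> complex" where
  "smult \<equiv> semichar_mult S"

lemma smult_apply [simp]: "s \<in> M \<Longrightarrow> smult \<psi> \<phi> s = \<psi> s * \<phi> s"
  by (simp add: semichar_mult_def)

lemma smult_ext [simp]: "smult \<psi> \<phi> \<in> extensional M"
  by (simp add: semichar_mult_def)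

lemma smult_SC [simp]:
  assumes "\<psi> \<in> SC" "\<phi> \<in> SC" shows "smult \<psi> \<phi> \<in> SC"
proof (rule SC_I)
  show "cmod (smult \<psi> \<phi> s) \<le> 1" if "s \<in> M" for s
    using that SC_le[OF assms(1) that] SC_le[OF assms(2) that] by (simp add: norm_mult mult_le_one)
qed (use assms in \<open>auto simp: SC_mult SC_one\<close>)

lemma smult_X [simp]: "\<psi> \<in> X \<Longrightarrow> \<phi> \<in> X \<Longrightarrow> smult \<psi> \<phi> \<in> X"
  using smult_SC[of \<psi> \<phi>] by (simp add: characters_def norm_mult)

lemma smult_commute: "smult \<psi> \<phi> = smult \<phi> \<psi>"
  by (auto simp: semichar_mult_def restrict_def mult.commute)

lemma smult_assoc: "smult (smult \<psi> \<phi>) \<theta> = smult \<psi> (smult \<phi> \<theta>)"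
  by (rule extensionalityI[of _ M]) (auto simp: mult.assoc)

definition onec :: "'a \<Rightarrow> complex" where "onec = (\<lambda>s\<in>M. 1)"
definition invc :: "('a \<Rightarrow> complex) \<Rightarrow> 'a \<Rightarrow> complex" where "invc \<eta> = (\<lambda>s\<in>M. cnj (\<eta> s))"

lemma onec_X [simp]: "onec \<in> X"
  unfolding characters_def onec_def by (auto intro!: SC_I)

lemma smult_onec [simp]: "\<psi> \<in> SC \<Longrightarrow> smult \<psi> onec = \<psi>" "\<psi> \<in> SC \<Longrightarrow> smult onec \<psi> = \<psi>"
  by (rule extensionalityI[of _ M]; auto simp: onec_def SC_ext)+

lemma invc_X [simp]: "\<eta> \<in> X \<Longrightarrow> invc \<eta> \<in> X"
  unfolding characters_def invc_def by (auto intro!: SC_I simp: SC_mult SC_le SC_one)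

lemma smult_invc [simp]: "\<eta> \<in> X \<Longrightarrow> smult \<eta> (invc \<eta>) = onec" "\<eta> \<in> X \<Longrightarrow> smult (invc \<eta>) \<eta> = onec"
  by (rule extensionalityI[of _ M];
      auto simp: onec_def invc_def complex_norm_square[symmetric] X_cmod mult.commute[of "cnj _"])+

definition eps :: "'a \<Rightarrow> complex" where "eps = (\<lambda>s\<in>M. if s = \<one> then 1 else 0)"

text \<open>Multiplicativity requires that a product equal to \<open>\<one>\<close> has both factors
  equal to \<open>\<one>\<close>, which is the triviality of the units.\<close>

lemma eps_SC [simp]: "eps \<in> SC"
proof (rule SC_I)
  fix s t assume st: "s \<in> M" "t \<in> M"
  have "s = \<one> \<and> t = \<one>" if "s \<otimes> t = \<one>"
    using st that units_trivial[of s t] units_trivial[of t s] m_comm[of s t] by auto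
  then show "eps (s \<otimes> t) = eps s * eps t" using st by (auto simp: eps_def)
qed (auto simp: eps_def)

lemma SC_eps: "\<psi> \<in> SC \<Longrightarrow> \<not> nonvan \<psi> \<Longrightarrow> \<psi> = eps"
  by (rule extensionalityI[of _ M]) (auto simp: SC_ext SC_zero SC_one eps_def)

subsection \<open>Extension to the group of quotients\<close>

text \<open>For \<open>g \<noteq> \<one>\<close> a vanishing semicharacter gets the value \<open>0\<close>, because \<open>x / 0 = 0\<close>.\<close>

definition ext :: "('a \<Rightarrow> complex) \<Rightarrow> 'a \<Rightarrow> complex" where
  "ext \<psi> g = (if g = \<one> then 1 else (SOME z. \<exists>a\<in>M. \<exists>b\<in>M. g = inv a \<otimes> b \<and> z = \<psi> b / \<psi> a))"

lemma ext_one [simp]: "ext \<psi> \<one> = 1"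
  by (simp add: ext_def)

text \<open>The exception is \<open>\<one>\<close> written as \<open>inv a \<otimes> a\<close> for a
  vanishing semicharacter, where the quotient may be 0/0 = 0 while \<open>ext\<close> has the value
  1. For a vanishing semicharacter and \<open>g \<noteq> \<one>\<close> all representations give 0:
  either the denominator is not at \<open>\<one>\<close> and is 0, or the numerator is not at
  \<open>\<one>\<close> and is 0.\<close>

lemma ext_quotient:
  assumes \<psi>: "\<psi> \<in> SC" and ab: "a \<in> M" "b \<in> M" and g: "g = inv a \<otimes> b" "g \<noteq> \<one> \<or> nonvan \<psi>"
  shows "ext \<psi> g = \<psi> b / \<psi> a"
proof (cases "g = \<one>")
  case True
  then have "inv a \<otimes> b = inv \<one> \<otimes> \<one>" using g by simp
  then have "b = a" using inv_mult_eq_iff[OF ab one_M one_M] ab by simp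
  then show ?thesis using True g ab by (auto simp: nonvan_def)
next
  case False
  have uniq: "\<psi> b' / \<psi> a' = \<psi> b / \<psi> a" if ab': "a' \<in> M" "b' \<in> M" "g = inv a' \<otimes> b'" for a' b'
  proof (cases "nonvan \<psi>")
    case True
    have "b' \<otimes> a = b \<otimes> a'" using inv_mult_eq_iff[OF ab' (1,2) ab] ab'(3) g(1) by simp
    then have "\<psi> b' * \<psi> a = \<psi> b * \<psi> a'" using ab ab' SC_mult[OF \<psi>] by metis
    then show ?thesis using True ab ab' by (simp add: nonvan_def field_simps)
  next
    case F: False
    have "\<psi> d / \<psi> c = 0" if "c \<in> M" "d \<in> M" "g = inv c \<otimes> d" for c d
    proof (cases "c = \<one>")
      case True
      then have "d \<noteq> \<one>" using that False by auto
      then show ?thesis using SC_zero[OF \<psi> F that(2)] by simp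
    qed (use SC_zero[OF \<psi> F that(1)] in simp)
    then show ?thesis using ab ab' g by metis
  qed
  have "\<exists>a'\<in>M. \<exists>b'\<in>M. g = inv a' \<otimes> b' \<and> ext \<psi> g = \<psi> b' / \<psi> a'"
    unfolding ext_def if_not_P[OF False] by (rule someI_ex) (use ab g in blast)
  then show ?thesis using uniq by metis
qed

lemma ext_M [simp]:
  assumes "\<psi> \<in> SC" "s \<in> M" shows "ext \<psi> s = \<psi> s"
proof (cases "s = \<one>")
  case False
  then show ?thesis using ext_quotient[OF assms(1) one_M assms(2), of s] assms by (simp add: SC_one)
qed (use assms in \<open>simp add: SC_one\<close>)

lemma ext_eps: "g \<in> carrier G \<Longrightarrow> g \<noteq> \<one> \<Longrightarrow> \<psi> \<in> SC \<Longrightarrow> \<not> nonvan \<psi> \<Longrightarrow> ext \<psi> g = 0"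
proof -
  assume g: "g \<in> carrier G" "g \<noteq> \<one>" and \<psi>: "\<psi> \<in> SC" "\<not> nonvan \<psi>"
  obtain a b where ab: "a \<in> M" "b \<in> M" "g = inv a \<otimes> b" using quotient_repr g by blast
  have "ext \<psi> g = \<psi> b / \<psi> a" using ext_quotient[OF \<psi>(1) ab] g by simp
  moreover have "b \<noteq> \<one>" if "a = \<one>" using ab g that by auto
  ultimately show "ext \<psi> g = 0" using SC_zero[OF \<psi>] ab by (cases "a = \<one>") auto
qed

lemma ext_mult:
  assumes "\<psi> \<in> SC" "nonvan \<psi>" "g \<in> carrier G" "h \<in> carrier G"
  shows "ext \<psi> (g \<otimes> h) = ext \<psi> g * ext \<psi> h"
proof -
  obtain a b where ab: "a \<in> M" "b \<in> M" "g = inv a \<otimes> b" using quotient_repr assms by blast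
  obtain c d where cd: "c \<in> M" "d \<in> M" "h = inv c \<otimes> d" using quotient_repr assms by blast
  have "g \<otimes> h = inv (a \<otimes> c) \<otimes> (b \<otimes> d)"
    unfolding ab cd using ab cd by (simp add: inv_mult m_ac)
  then have "ext \<psi> (g \<otimes> h) = \<psi> (b \<otimes> d) / \<psi> (a \<otimes> c)"
    using assms ab cd by (intro ext_quotient) auto
  then show ?thesis
    using ext_quotient[OF assms(1) ab] ext_quotient[OF assms(1) cd] assms ab cd by (simp add: SC_mult)
qed

lemma ext_nonzero: "\<psi> \<in> SC \<Longrightarrow> nonvan \<psi> \<Longrightarrow> g \<in> carrier G \<Longrightarrow> ext \<psi> g \<noteq> 0"
  using ext_mult[of \<psi> g "inv g"] by (auto simp: r_inv)

lemma ext_inv: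
  assumes "\<psi> \<in> SC" "nonvan \<psi>" "g \<in> carrier G"
  shows "ext \<psi> (inv g) = inverse (ext \<psi> g)"
  using ext_mult[OF assms, of "inv g"] ext_nonzero[OF assms] assms(3) by (simp add: r_inv field_simps)

lemma ext_smult:
  assumes "\<psi> \<in> SC" "\<phi> \<in> SC" "g \<in> carrier G"
  shows "ext (smult \<psi> \<phi>) g = ext \<psi> g * ext \<phi> g"
proof (cases "g = \<one>")
  case False
  obtain a b where ab: "a \<in> M" "b \<in> M" "g = inv a \<otimes> b" using quotient_repr assms by blast
  show ?thesis
    using ext_quotient[OF assms(1) ab] ext_quotient[OF assms(2) ab] ext_quotient[OF _ ab, of "smult \<psi> \<phi>"]
      False assms ab by simp
qed simp

lemma ext_restrict:
  assumes "\<And>g h. g \<in> carrier G \<Longrightarrow> h \<in> carrier G \<Longrightarrow> \<kappa> (g \<otimes> h) = \<kappa> g * \<kappa> h"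
    "\<And>s. s \<in> M \<Longrightarrow> \<kappa> s \<noteq> 0" "restrict \<kappa> M \<in> SC" "g \<in> carrier G"
  shows "ext (restrict \<kappa> M) g = \<kappa> g"
proof -
  obtain a b where ab: "a \<in> M" "b \<in> M" "g = inv a \<otimes> b" using quotient_repr assms by blast
  have "a \<otimes> g = b" using ab by (simp add: m_assoc[symmetric] r_inv)
  then have "\<kappa> a * \<kappa> g = \<kappa> b" using assms(1)[of a g] assms ab by simp
  moreover have "ext (restrict \<kappa> M) g = restrict \<kappa> M b / restrict \<kappa> M a"
    using assms ab by (intro ext_quotient) (auto simp: nonvan_def)
  moreover have "\<kappa> a \<noteq> 0" using ab assms(2) by blast
  ultimately show ?thesis using ab(1,2)
    by (metis nonzero_mult_div_cancel_left restrict_apply')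
qed

lemma ext_X [simp]:
  assumes "\<eta> \<in> X" "g \<in> carrier G" shows "cmod (ext \<eta> g) = 1"
proof -
  obtain a b where ab: "a \<in> M" "b \<in> M" "g = inv a \<otimes> b" using quotient_repr assms by blast
  have "ext \<eta> g = \<eta> b / \<eta> a" using assms ab X_SC X_nonvan by (intro ext_quotient) auto
  then show ?thesis using ab assms by (simp add: norm_divide X_cmod)
qed

lemma characters_separate:
  assumes "g \<in> carrier G" "g \<noteq> \<one>"
  obtains \<eta> where "\<eta> \<in> X" "ext \<eta> g \<noteq> 1"
proof -
  obtain \<kappa> where \<kappa>: "\<And>x. x \<in> carrier G \<Longrightarrow> cmod (\<kappa> x) = 1"
    "\<And>x y. x \<in> carrier G \<Longrightarrow> y \<in> carrier G \<Longrightarrow> \<kappa> (x \<otimes> y) = \<kappa> x * \<kappa> y" "\<kappa> g \<noteq> 1"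
    using group_character_separates[OF assms] by blast
  have nz: "\<kappa> x \<noteq> 0" if "x \<in> carrier G" for x using \<kappa>(1)[OF that] by auto
  have "\<kappa> \<one> = 1" using \<kappa>(2)[of \<one> \<one>] nz[of \<one>] by simp
  then have SC: "restrict \<kappa> M \<in> SC" using \<kappa> by (intro SC_I) auto
  then have "restrict \<kappa> M \<in> X" using \<kappa> by (auto simp: characters_def)
  moreover have "ext (restrict \<kappa> M) g = \<kappa> g"
    using \<kappa> nz SC assms by (intro ext_restrict) auto
  ultimately show ?thesis using that \<kappa> by metis
qed

text \<open>Every element of \<open>G\<close> is a quotient of elements of \<open>S\<close>, so a
  character of \<open>G\<close> is determined by its values on \<open>S\<close>; this is the
  uniqueness required by the definite description.\<close>

lemma character_extension_eq:
  assumes \<eta>: "\<eta> \<in> X" and g: "g \<in> carrier G"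
  shows "character_extension S G \<eta> g = ext \<eta> g"
proof -
  let ?k = "restrict (ext \<eta>) (carrier G)"
  have k: "?k \<in> characters G"
    using \<eta> ext_mult[OF X_SC[OF \<eta>] X_nonvan[OF \<eta>]]
    by (auto simp: characters_def semicharacters_def intro!: bexI[of _ \<one>])
  have "character_extension S G \<eta> = ?k"
    unfolding character_extension_def
  proof (rule the_equality)
    show "?k \<in> characters G \<and> (\<forall>s\<in>M. ?k s = \<eta> s)" using k \<eta> X_SC by simp
    fix k' assume k': "k' \<in> characters G \<and> (\<forall>s\<in>M. k' s = \<eta> s)"
    then have ex: "k' \<in> extensional (carrier G)"
      and mult: "\<And>g h. g \<in> carrier G \<Longrightarrow> h \<in> carrier G \<Longrightarrow> k' (g \<otimes> h) = k' g * k' h"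
      by (auto simp: characters_def semicharacters_def)
    have eq: "restrict k' M = \<eta>"
      using k' \<eta> X_SC SC_ext by (intro extensionalityI[of _ M]) auto
    show "k' = ?k"
    proof (rule extensionalityI[OF ex])
      fix h assume h: "h \<in> carrier G"
      have "ext (restrict k' M) h = k' h"
        using mult eq k' \<eta> X_SC X_nonvan h by (intro ext_restrict) (auto simp: nonvan_def)
      then show "k' h = ?k h" using eq h by simp
    qed simp
  qed
  then show ?thesis using g by simp
qed

subsection \<open>Positive semicharacters\<close>

definition Pos :: "('a \<Rightarrow> complex) set" where
  "Pos = {\<rho> \<in> SC - X. \<forall>s\<in>M. \<rho> s \<in> \<real>\<^sub>\<ge>\<^sub>0 - {0}}"

lemma Pos_SC [simp]: "\<rho> \<in> Pos \<Longrightarrow> \<rho> \<in> SC" and Pos_X: "\<rho> \<in> Pos \<Longrightarrow> \<rho> \<notin> X"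
  and Pos_nonvan [simp]: "\<rho> \<in> Pos \<Longrightarrow> nonvan \<rho>"
  by (auto simp: Pos_def nonvan_def)

text \<open>Take \<rho> = exp(-\<phi>) for a state \<phi> of \<open>G\<close> ordered by the cone
  \<open>M\<close>. That \<open>u\<close> is an order unit is \<open>archimedean\<close>; that no
  negative power of \<open>u\<close> lies in \<open>M\<close> is \<open>units_trivial\<close>. Since
  \<phi>(u) is at least 1, \<rho> is not a character.\<close>

lemma Pos_exists:
  assumes u: "u \<in> M" "u \<noteq> \<one>"
  obtains \<rho> where "\<rho> \<in> Pos"
proof -
  obtain \<phi> :: "'a \<Rightarrow> real" where \<phi>:
    "\<And>x y. x \<in> carrier G \<Longrightarrow> y \<in> carrier G \<Longrightarrow> \<phi> (x \<otimes> y) = \<phi> x + \<phi> y"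
    "\<And>x. x \<in> M \<Longrightarrow> \<phi> x \<ge> 0" "\<phi> u \<ge> 1"
  proof (rule order_unit_state[OF M_subset one_M _ u(1)])
    show "n \<ge> 0" if n: "u [^] n \<in> M" for n :: int
    proof (rule ccontr)
      assume "\<not> n \<ge> 0"
      then obtain m where m: "n = - int (Suc m)" by (cases n) auto
      have "u [^] n = inv (u [^] Suc m)" unfolding m by (rule int_pow_neg_int) (use u in simp)
      then have "u [^] n \<otimes> u [^] Suc m = \<one>"
        using u l_inv[of "u [^] Suc m"] by (simp del: nat_pow_Suc)
      then have "u \<otimes> (u [^] m \<otimes> u [^] n) = \<one>"
        using u n by (simp add: m_ac)
      then show False using units_trivial[of u "u [^] m \<otimes> u [^] n"] u n by simp
    qed
    show "\<exists>n::nat. u [^] n \<otimes> g \<in> M" if g: "g \<in> carrier G" for g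
    proof -
      obtain a b where ab: "a \<in> M" "b \<in> M" "g = inv a \<otimes> b" using quotient_repr g by blast
      obtain n :: nat and c where c: "c \<in> M" "u [^] n = a \<otimes> c" using archimedean[OF u ab(1)] by blast
      have "u [^] n \<otimes> g = (a \<otimes> inv a) \<otimes> (c \<otimes> b)"
        unfolding c ab using ab c by (simp only: m_ac m_closed inv_closed M_carrier)
      then have "u [^] n \<otimes> g = c \<otimes> b" using ab c by (simp add: r_inv)
      then show ?thesis using ab c by (metis M_closed)
    qed
  qed auto
  have \<phi>1: "\<phi> \<one> = 0" using \<phi>(1)[of \<one> \<one>] by simp
  define \<rho> where "\<rho> = (\<lambda>s\<in>M. of_real (exp (- \<phi> s)) :: complex)"
  have "\<rho> \<in> SC"
    by (rule SC_I) (auto simp: \<rho>_def \<phi> \<phi>1 mult_exp_exp simp flip: of_real_mult)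
  moreover have "cmod (\<rho> u) \<noteq> 1" using u \<phi>(3) by (simp add: \<rho>_def)
  then have "\<rho> \<notin> X" using X_cmod u by blast
  moreover have "\<rho> s \<in> \<real>\<^sub>\<ge>\<^sub>0 - {0}" if "s \<in> M" for s
    using that by (simp add: \<rho>_def)
  ultimately have "\<rho> \<in> Pos" unfolding Pos_def by blast
  then show ?thesis by (rule that)
qed

lemma Pos_ext:
  assumes "\<rho> \<in> Pos" "g \<in> carrier G"
  shows "ext \<rho> g = of_real (cmod (ext \<rho> g))" "cmod (ext \<rho> g) > 0"
proof -
  obtain a b where ab: "a \<in> M" "b \<in> M" "g = inv a \<otimes> b" using quotient_repr assms by blast
  have "ext \<rho> g = \<rho> b / \<rho> a" using assms by (intro ext_quotient ab) auto
  moreover have "\<rho> b = of_real (cmod (\<rho> b))" "\<rho> a = of_real (cmod (\<rho> a))"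
    using assms(1) ab unfolding Pos_def by (auto simp del: Pos_SC simp: nonneg_Reals_def)
  ultimately show "ext \<rho> g = of_real (cmod (ext \<rho> g))"
    by (metis norm_divide of_real_divide)
  show "cmod (ext \<rho> g) > 0" using ext_nonzero[OF Pos_SC Pos_nonvan] assms by simp
qed

lemma Pos_apply:
  assumes "\<rho> \<in> Pos" "s \<in> M"
  shows "\<rho> s = of_real (cmod (\<rho> s))" "cmod (\<rho> s) > 0"
  using Pos_ext[OF assms(1), of s] assms by auto

abbreviation spow :: "('a \<Rightarrow> complex) \<Rightarrow> complex \<Rightarrow> 'a \<Rightarrow> complex" where
  "spow \<equiv> semichar_power S"

lemma spow_apply:
  "\<rho> \<in> Pos \<Longrightarrow> s \<in> M \<Longrightarrow> spow \<rho> z s = exp (z * of_real (ln (cmod (\<rho> s))))"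
  using Pos_apply[of \<rho> s] Ln_of_real[of "cmod (\<rho> s)"]
  by (auto simp: semichar_power_def powr_def)

lemma spow_cmod: "\<rho> \<in> Pos \<Longrightarrow> s \<in> M \<Longrightarrow> cmod (spow \<rho> z s) = cmod (\<rho> s) powr Re z"
  using Pos_apply[of \<rho> s] by (auto simp: spow_apply powr_def)

lemma spow_ext [simp]: "spow \<rho> z \<in> extensional M"
  by (simp add: semichar_power_def)

lemma spow_SC:
  assumes "\<rho> \<in> Pos" "Re z \<ge> 0" shows "spow \<rho> z \<in> SC"
proof (rule SC_I)
  show "spow \<rho> z \<in> extensional M" by (simp add: semichar_power_def)
  show "cmod (spow \<rho> z s) \<le> 1" if "s \<in> M" for s
    using that assms SC_le[of \<rho> s] Pos_apply[of \<rho> s] by (simp add: spow_cmod powr_le1)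
  show "spow \<rho> z (s \<otimes> t) = spow \<rho> z s * spow \<rho> z t" if "s \<in> M" "t \<in> M" for s t
    using that assms Pos_apply[of \<rho> s] Pos_apply[of \<rho> t]
    by (simp add: spow_apply SC_mult norm_mult ln_mult ring_distribs exp_add)
  show "spow \<rho> z \<one> = 1" using assms by (simp add: spow_apply SC_one)
qed

lemma spow_imaginary: "\<rho> \<in> Pos \<Longrightarrow> Re z = 0 \<Longrightarrow> spow \<rho> z \<in> X"
  using spow_SC[of \<rho> z] Pos_apply[of \<rho>] by (simp add: characters_def spow_cmod)

lemma spow_nonvan: "\<rho> \<in> Pos \<Longrightarrow> nonvan (spow \<rho> z)"
  by (simp add: nonvan_def spow_apply)

lemma spow_zero [simp]: "\<rho> \<in> Pos \<Longrightarrow> spow \<rho> 0 = onec"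
  by (rule extensionalityI[of _ M]) (auto simp: spow_apply onec_def)

lemma spow_one [simp]: assumes \<rho>: "\<rho> \<in> Pos" shows "spow \<rho> 1 = \<rho>"
proof (rule extensionalityI[of _ M])
  fix s assume s: "s \<in> M"
  have "spow \<rho> 1 s = of_real (exp (ln (cmod (\<rho> s))))"
    using \<rho> s by (simp add: spow_apply exp_of_real)
  then show "spow \<rho> 1 s = \<rho> s" using Pos_apply[OF \<rho> s] by simp
qed (use \<rho> in \<open>auto simp: SC_ext\<close>)

lemma spow_add: "\<rho> \<in> Pos \<Longrightarrow> spow \<rho> (z + w) = smult (spow \<rho> z) (spow \<rho> w)"
  by (rule extensionalityI[of _ M])
    (auto simp: spow_apply ring_distribs exp_add)

lemma ext_spow:
  assumes \<rho>: "\<rho> \<in> Pos" and z: "Re z \<ge> 0" and g: "g \<in> carrier G"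
  shows "ext (spow \<rho> z) g = exp (z * of_real (ln (cmod (ext \<rho> g))))"
proof -
  obtain a b where ab: "a \<in> M" "b \<in> M" "g = inv a \<otimes> b" using quotient_repr g by blast
  have "ext (spow \<rho> z) g = spow \<rho> z b / spow \<rho> z a"
    using assms spow_SC spow_nonvan by (intro ext_quotient ab) auto
  moreover have "ext \<rho> g = \<rho> b / \<rho> a" using \<rho> by (intro ext_quotient ab) auto
  ultimately show ?thesis
    using \<rho> ab Pos_apply[OF \<rho>] by (simp add: spow_apply norm_divide ln_div exp_diff right_diff_distrib)
qed

lemma spow_Pos:
  assumes "\<rho> \<in> Pos" "t > 0" shows "spow \<rho> (of_real t) \<in> Pos"
proof -
  have "spow \<rho> (of_real t) s \<in> \<real>\<^sub>\<ge>\<^sub>0 - {0}" if "s \<in> M" for s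
  proof -
    have "spow \<rho> (of_real t) s = of_real (exp (t * ln (cmod (\<rho> s))))"
      unfolding spow_apply[OF assms(1) that] by (simp flip: exp_of_real)
    then show ?thesis by simp
  qed
  moreover have "spow \<rho> (of_real t) \<notin> X"
  proof
    assume X: "spow \<rho> (of_real t) \<in> X"
    have "cmod (\<rho> s) = 1" if "s \<in> M" for s
    proof -
      have "cmod (\<rho> s) powr t = 1" using X_cmod[OF X that] spow_cmod[OF assms(1) that] by simp
      then have "t * ln (cmod (\<rho> s)) = 0" using Pos_apply(2)[OF assms(1) that] by (simp add: powr_def)
      then show ?thesis using assms(2) Pos_apply(2)[OF assms(1) that] by simp
    qed
    then have "\<rho> \<in> X" using assms by (simp add: characters_def)
    with assms Pos_X show False by blast
  qed
  moreover have "spow \<rho> (of_real t) \<in> SC" using assms by (intro spow_SC) auto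
  ultimately show ?thesis unfolding Pos_def by blast
qed

definition absc :: "('a \<Rightarrow> complex) \<Rightarrow> 'a \<Rightarrow> complex" where
  "absc \<psi> = (\<lambda>s\<in>M. of_real (cmod (\<psi> s)))"

definition phase :: "('a \<Rightarrow> complex) \<Rightarrow> 'a \<Rightarrow> complex" where
  "phase \<psi> = (\<lambda>s\<in>M. sgn (\<psi> s))"

lemma polar:
  assumes "\<psi> \<in> SC" "nonvan \<psi>"
  shows "\<psi> = smult (absc \<psi>) (phase \<psi>)" "phase \<psi> \<in> X"
proof -
  show "\<psi> = smult (absc \<psi>) (phase \<psi>)"
    using assms by (intro extensionalityI[of _ M])
      (auto simp: SC_ext absc_def phase_def sgn_eq nonvan_def)
  show "phase \<psi> \<in> X"
    unfolding characters_def
    using assms by (auto simp: phase_def nonvan_def norm_sgn SC_mult SC_one sgn_mult intro!: SC_I)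
qed

lemma absc_SC: "\<psi> \<in> SC \<Longrightarrow> absc \<psi> \<in> SC"
  by (rule SC_I) (auto simp: absc_def SC_le SC_mult SC_one norm_mult)

lemma absc_Pos:
  assumes "\<psi> \<in> SC" "nonvan \<psi>" "\<psi> \<notin> X" shows "absc \<psi> \<in> Pos"
proof -
  have "absc \<psi> \<notin> X" using assms by (auto simp: characters_def absc_def)
  moreover have "absc \<psi> s \<in> \<real>\<^sub>\<ge>\<^sub>0 - {0}" if "s \<in> M" for s
    using assms that by (simp add: absc_def nonvan_def)
  ultimately show ?thesis using absc_SC[OF assms(1)] unfolding Pos_def by blast
qed

lemma SC_cases:
  assumes "\<psi> \<in> SC"
  obtains (van) "\<psi> = eps" "\<not> nonvan \<psi>"
  | (char) "\<psi> \<in> X"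
  | (pos) \<rho> \<eta> where "\<rho> \<in> Pos" "\<eta> \<in> X" "\<psi> = smult \<rho> \<eta>" "nonvan \<psi>" "\<psi> \<notin> X" "\<rho> = absc \<psi>"
  using that(1)[OF SC_eps[OF assms]] that(2) that(3)[OF absc_Pos[OF assms] polar(2)[OF assms] polar(1)[OF assms]]
  by blast

subsection \<open>The semigroup dominated by all positive semicharacters\<close>

definition P :: "'a set" where
  "P = {g \<in> carrier G. g = \<one> \<or> (\<forall>\<rho>\<in>Pos. cmod (ext \<rho> g) < 1)}"

lemma P_carrier [simp]: "g \<in> P \<Longrightarrow> g \<in> carrier G" and one_P [simp]: "\<one> \<in> P"
  by (auto simp: P_def)

lemma P_I: "g \<in> carrier G \<Longrightarrow> (\<And>\<rho>. \<rho> \<in> Pos \<Longrightarrow> g \<noteq> \<one> \<Longrightarrow> cmod (ext \<rho> g) < 1) \<Longrightarrow> g \<in> P"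
  and P_D: "g \<in> P \<Longrightarrow> g \<noteq> \<one> \<Longrightarrow> \<rho> \<in> Pos \<Longrightarrow> cmod (ext \<rho> g) < 1"
  unfolding P_def by blast+

lemma M_P: "M \<subseteq> P"
proof
  fix s assume s: "s \<in> M"
  show "s \<in> P"
    by (rule P_I) (use s SC_less_one Pos_X in auto)
qed

lemma P_mult [simp]:
  assumes "g \<in> P" "h \<in> P" shows "g \<otimes> h \<in> P"
proof (cases "g = \<one> \<or> h = \<one>")
  case False
  have "cmod (ext \<rho> (g \<otimes> h)) < 1" if \<rho>: "\<rho> \<in> Pos" for \<rho>
  proof -
    have "cmod (ext \<rho> g) < 1" "cmod (ext \<rho> h) < 1" using False assms \<rho> by (auto intro: P_D)
    then have "cmod (ext \<rho> g) * cmod (ext \<rho> h) < 1 * 1" by (intro mult_strict_mono') auto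
    then show ?thesis using assms \<rho> by (simp add: ext_mult norm_mult)
  qed
  then show ?thesis using assms by (intro P_I) auto
qed (use assms in auto)

lemma nontrivial:
  assumes "g \<in> carrier G" "g \<noteq> \<one>"
  obtains u where "u \<in> M" "u \<noteq> \<one>"
proof -
  obtain a b where "a \<in> M" "b \<in> M" "g = inv a \<otimes> b" using quotient_repr assms by blast
  then show ?thesis using that assms by (cases "a = \<one>") auto
qed

text \<open>A single \<rho> in \<open>Pos\<close> decides: \<rho>(g) and \<rho>(inv g) have product
  1 and cannot both be less than 1. Such a \<rho> exists because an element other than
  \<open>\<one>\<close> has a numerator or a denominator other than \<open>\<one>\<close>.\<close>

lemma P_inv: "(\<lambda>a. inv a) ` P \<inter> P = {\<one>}"
proof -
  have "g = \<one>" if g: "g \<in> P" "inv g \<in> P" for g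
  proof (rule ccontr)
    assume g1: "g \<noteq> \<one>"
    obtain u where u: "u \<in> M" "u \<noteq> \<one>" using nontrivial[of g] g g1 by auto
    obtain \<rho> where \<rho>: "\<rho> \<in> Pos" using Pos_exists[OF u] by blast
    have "inv g \<noteq> \<one>" using g g1 inv_eq_1_iff by auto
    then have "cmod (ext \<rho> g) < 1" "cmod (ext \<rho> (inv g)) < 1" using g g1 \<rho> by (auto intro: P_D)
    then have "cmod (ext \<rho> g) * cmod (ext \<rho> (inv g)) < 1 * 1" by (intro mult_strict_mono') auto
    moreover have "ext \<rho> g * ext \<rho> (inv g) = 1" using ext_mult[of \<rho> g "inv g"] \<rho> g by (simp add: r_inv)
    then have "cmod (ext \<rho> g) * cmod (ext \<rho> (inv g)) = 1" by (metis norm_mult norm_one)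
    ultimately show False by simp
  qed
  then show ?thesis by (force intro!: image_eqI[of _ _ \<one>])
qed

lemma cmod_ext_absc:
  assumes "\<psi> \<in> SC" "g \<in> carrier G"
  shows "cmod (ext (absc \<psi>) g) = cmod (ext \<psi> g)"
proof (cases "g = \<one>")
  case False
  obtain a b where ab: "a \<in> M" "b \<in> M" "g = inv a \<otimes> b" using quotient_repr assms by blast
  show ?thesis
    using ext_quotient[OF assms(1) ab] ext_quotient[OF absc_SC[OF assms(1)] ab] False ab
    by (simp add: absc_def norm_divide)
qed simp

lemma ext_P_le:
  assumes \<psi>: "\<psi> \<in> SC" and g: "g \<in> P" shows "cmod (ext \<psi> g) \<le> 1"
  using \<psi>
proof (cases rule: SC_cases)
  case van
  then have "ext \<psi> g = 0" if "g \<noteq> \<one>" using ext_eps[OF P_carrier[OF g] that \<psi>] by blast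
  then show ?thesis by (cases "g = \<one>") simp_all
next
  case pos
  have "g = \<one> \<or> cmod (ext (absc \<psi>) g) < 1"
    using P_D[OF g _ pos(1)] unfolding pos(6) by argo
  then show ?thesis using cmod_ext_absc[OF \<psi> P_carrier[OF g]] by fastforce
next
  case char
  then show ?thesis using ext_X[OF char P_carrier[OF g]] by simp
qed

text \<open>For \<open>eps\<close> the claim is that the product of two elements of \<open>P\<close>
  other than \<open>\<one>\<close> is again not \<open>\<one>\<close>, which is
  \<open>P_inv\<close>.\<close>

lemma ext_P_mult:
  assumes \<psi>: "\<psi> \<in> SC" and g: "g \<in> P" "h \<in> P"
  shows "ext \<psi> (g \<otimes> h) = ext \<psi> g * ext \<psi> h"
proof (cases "nonvan \<psi> \<or> g = \<one> \<or> h = \<one>")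
  case False
  have "g \<otimes> h \<noteq> \<one>"
  proof
    assume "g \<otimes> h = \<one>"
    then have "h = inv g" using g by (metis P_carrier inv_equality m_comm)
    then show False using P_inv g False by blast
  qed
  then show ?thesis using False g \<psi> by (simp add: ext_eps)
qed (use g \<psi> in \<open>auto simp: ext_mult\<close>)

end

context no_nontrivial_prime_ideals
begin

subsection \<open>Generalized analytic functions\<close>

lemma compact_SC: "compact SC"
  and compact_X: "compact X"
  by (auto intro!: compact_semicharacters compact_characters simp: mult_S)

lemma continuous_smult:
  assumes "continuous_on A f" "continuous_on A g"
  shows "continuous_on A (\<lambda>x. smult (f x) (g x))"
proof (rule continuous_on_coordinatewise_then_product)
  fix s
  have "continuous_on A (\<lambda>x. f x s * g x s)"
    by (intro continuous_on_mult continuous_on_product_then_coordinatewise[OF assms(1)]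
        continuous_on_product_then_coordinatewise[OF assms(2)])
  then show "continuous_on A (\<lambda>x. smult (f x) (g x) s)"
    by (cases "s \<in> M") (simp_all add: semichar_mult_def)
qed

lemma continuous_spow:
  assumes "\<rho> \<in> Pos" shows "continuous_on A (\<lambda>z. spow \<rho> z)"
proof (rule continuous_on_coordinatewise_then_product)
  fix s
  have "continuous_on A (\<lambda>z. exp (z * of_real (ln (cmod (\<rho> s)))))"
    by (intro continuous_intros)
  then show "continuous_on A (\<lambda>z. spow \<rho> z s)"
  proof (cases "s \<in> M")
    case False
    then show ?thesis by (simp add: semichar_power_def)
  qed (use assms in \<open>simp add: spow_apply\<close>)
qed

lemma continuous_spow_smult:
  assumes "\<rho> \<in> Pos" shows "continuous_on A (\<lambda>z. smult (spow \<rho> z) \<psi>)"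
  using assms by (intro continuous_smult continuous_spow continuous_on_const)

text \<open>The working form of membership in the algebra. It places no condition outside
  \<open>SC\<close>, so sums, products and evaluations can be written as plain lambda terms;
  \<open>GA_iff\<close> makes the connection.\<close>

definition GA :: "(('a \<Rightarrow> complex) \<Rightarrow> complex) \<Rightarrow> bool" where
  "GA f \<longleftrightarrow> continuous_on SC f \<and>
    (\<forall>\<rho>\<in>Pos. \<forall>\<psi>\<in>SC - X. (\<lambda>z. f (smult (spow \<rho> z) \<psi>)) holomorphic_on {z. 0 < Re z})"

lemma GA_continuous: "GA f \<Longrightarrow> continuous_on SC f"
  by (simp add: GA_def)

lemma GA_cong:
  assumes "GA f" "\<And>\<psi>. \<psi> \<in> SC \<Longrightarrow> f \<psi> = g \<psi>" shows "GA g"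
  unfolding GA_def
proof (intro conjI ballI)
  show "continuous_on SC g"
    using assms by (simp add: GA_def cong: continuous_on_cong)
  fix \<rho> \<psi> assume *: "\<rho> \<in> Pos" "\<psi> \<in> SC - X"
  have "(\<lambda>z. f (smult (spow \<rho> z) \<psi>)) holomorphic_on {z. 0 < Re z}"
    using assms(1) * unfolding GA_def by blast
  then show "(\<lambda>z. g (smult (spow \<rho> z) \<psi>)) holomorphic_on {z. 0 < Re z}"
    by (rule holomorphic_transform) (use * assms(2) spow_SC in auto)
qed

lemma smult_eps: "\<psi> \<in> SC \<Longrightarrow> smult \<psi> eps = eps" "\<psi> \<in> SC \<Longrightarrow> smult eps \<psi> = eps"
  by (rule extensionalityI[of _ M]; auto simp: eps_def SC_one)+

lemma spow_eps: "spow eps z = eps"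
  by (rule extensionalityI[of _ M]) (auto simp: eps_def semichar_power_def)

lemma nonneg_cases:
  assumes "\<rho> \<in> SC - X" "\<forall>s\<in>M. \<rho> s \<in> \<real>\<^sub>\<ge>\<^sub>0"
  shows "\<rho> \<in> Pos \<or> \<rho> = eps"
  using assms SC_eps[of \<rho>] by (auto simp: Pos_def nonvan_def simp del: Pos_SC)

text \<open>A nonnegative semicharacter outside \<open>X\<close> is in \<open>Pos\<close> or equals
  \<open>eps\<close>. In the first case the limit at +0 comes from continuity of the powers on the
  closed half-line; in the second the orbit is the single point \<open>eps\<close> and the function
  along it is constant.\<close>

lemma GA_iff: "f \<in> gen_analytic_algebra S \<longleftrightarrow> f \<in> extensional SC \<and> GA f"
proof
  assume "f \<in> gen_analytic_algebra S"
  then have f: "f \<in> extensional SC" "continuous_on SC f" "generalized_analytic S f"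
    by (auto simp: gen_analytic_algebra_def continuous_functions_def semichar_topology_eq)
  have "(\<lambda>z. f (smult (spow \<rho> z) \<psi>)) holomorphic_on {z. 0 < Re z}"
    if \<rho>: "\<rho> \<in> Pos" and \<psi>: "\<psi> \<in> SC - X" for \<rho> \<psi>
  proof -
    have "\<rho> \<in> SC - X" "\<forall>s\<in>M. \<rho> s \<in> \<real>\<^sub>\<ge>\<^sub>0" using \<rho> unfolding Pos_def by auto
    then have "(\<lambda>z. f (smult (spow \<rho> z) \<psi>)) analytic_on {z. 0 < Re z}"
      using f(3) \<psi> unfolding generalized_analytic_def by blast
    then show ?thesis by (rule analytic_imp_holomorphic)
  qed
  with f show "f \<in> extensional SC \<and> GA f" by (auto simp: GA_def)
next
  assume f: "f \<in> extensional SC \<and> GA f"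
  have "generalized_analytic S f"
    unfolding generalized_analytic_def
  proof (intro ballI impI)
    fix \<rho> \<psi> assume \<rho>: "\<rho> \<in> SC - X" "\<forall>s\<in>M. \<rho> s \<in> \<real>\<^sub>\<ge>\<^sub>0" and \<psi>: "\<psi> \<in> SC - X"
    let ?g = "\<lambda>z. f (smult (spow \<rho> z) \<psi>)"
    let ?goal = "?g analytic_on {z. 0 < Re z} \<and> ((\<lambda>t. ?g (of_real t)) \<longlongrightarrow> ?g 0) (at_right 0)"
    show ?goal
    proof (cases "\<rho> \<in> Pos")
      case True
      have "?g holomorphic_on {z. 0 < Re z}"
        using f True \<psi> by (auto simp: GA_def)
      then have 1: "?g analytic_on {z. 0 < Re z}"
        by (simp add: analytic_on_open open_halfspace_Re_gt)
      have "continuous_on {0::real..} (\<lambda>t. smult (spow \<rho> (of_real t)) \<psi>)"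
        by (rule continuous_on_compose2[OF continuous_spow_smult[OF True, of UNIV]])
          (auto intro!: continuous_intros)
      then have "continuous_on {0::real..} (\<lambda>t. ?g (of_real t))"
        by (rule continuous_on_compose2[OF GA_continuous[OF conjunct2[OF f]]])
          (use True \<psi> spow_SC in auto)
      then have "((\<lambda>t. ?g (of_real t)) \<longlongrightarrow> ?g (of_real 0)) (at 0 within {0..})"
        unfolding continuous_on_def by (rule bspec) simp
      then have "((\<lambda>t. ?g (of_real t)) \<longlongrightarrow> ?g (of_real 0)) (at_right 0)"
        by (rule tendsto_within_subset) auto
      with 1 show ?thesis by simp
    next
      case False
      then have "\<rho> = eps" using nonneg_cases \<rho> by blast
      then have "smult (spow \<rho> z) \<psi> = eps" for z using \<psi> by (simp add: spow_eps smult_eps)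
      then show ?thesis by simp
    qed
  qed
  with f show "f \<in> gen_analytic_algebra S"
    by (auto simp: gen_analytic_algebra_def continuous_functions_def semichar_topology_eq GA_def)
qed

lemma restrict_GA: "restrict f SC \<in> gen_analytic_algebra S \<longleftrightarrow> GA f"
  unfolding GA_iff by (auto elim!: GA_cong)

lemma GA_const: "GA (\<lambda>_. c)"
  by (auto simp: GA_def)

lemma GA_add: "GA f \<Longrightarrow> GA g \<Longrightarrow> GA (\<lambda>\<psi>. f \<psi> + g \<psi>)"
  and GA_mult: "GA f \<Longrightarrow> GA g \<Longrightarrow> GA (\<lambda>\<psi>. f \<psi> * g \<psi>)"
  unfolding GA_def by (auto intro!: continuous_intros holomorphic_intros)

lemma GA_divide:
  assumes "GA f" "GA g" "\<And>\<psi>. \<psi> \<in> SC \<Longrightarrow> g \<psi> \<noteq> 0" shows "GA (\<lambda>\<psi>. f \<psi> / g \<psi>)"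
  unfolding GA_def
proof (intro conjI ballI)
  show "continuous_on SC (\<lambda>\<psi>. f \<psi> / g \<psi>)"
    using assms by (auto simp: GA_def intro!: continuous_intros)
  fix \<rho> \<psi> assume *: "\<rho> \<in> Pos" "\<psi> \<in> SC - X"
  show "(\<lambda>z. f (smult (spow \<rho> z) \<psi>) / g (smult (spow \<rho> z) \<psi>)) holomorphic_on {z. 0 < Re z}"
    using assms * spow_SC unfolding GA_def by (intro holomorphic_on_divide) auto
qed

text \<open>Uniform approximation on \<open>SC\<close> gives locally uniform convergence along each
  orbit, and this preserves holomorphy.\<close>

lemma GA_limit:
  assumes "\<And>e. e > 0 \<Longrightarrow> \<exists>g. GA g \<and> (\<forall>\<psi>\<in>SC. cmod (f \<psi> - g \<psi>) < e)"
  shows "GA f"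
proof -
  have "\<exists>g. GA g \<and> (\<forall>\<psi>\<in>SC. cmod (f \<psi> - g \<psi>) < inverse (real (Suc n)))" for n
    by (rule assms) simp
  then obtain g where g: "\<And>n. GA (g n)" "\<And>n \<psi>. \<psi> \<in> SC \<Longrightarrow> cmod (f \<psi> - g n \<psi>) < inverse (real (Suc n))"
    by metis
  have ul: "uniform_limit SC g f sequentially"
  proof (rule uniform_limitI)
    fix e :: real assume "e > 0"
    then obtain N where N: "inverse (real (Suc N)) < e" using reals_Archimedean by blast
    have "\<forall>\<psi>\<in>SC. dist (g n \<psi>) (f \<psi>) < e" if n: "n \<ge> N" for n
    proof
      fix \<psi> assume "\<psi> \<in> SC"
      have "inverse (real (Suc n)) \<le> inverse (real (Suc N))" using n by simp
      then show "dist (g n \<psi>) (f \<psi>) < e"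
        using g(2)[OF \<open>\<psi> \<in> SC\<close>, of n] N unfolding dist_norm norm_minus_commute[of "g n \<psi>"]
        by linarith
    qed
    then show "\<forall>\<^sub>F n in sequentially. \<forall>\<psi>\<in>SC. dist (g n \<psi>) (f \<psi>) < e"
      unfolding eventually_sequentially by blast
  qed
  show ?thesis
    unfolding GA_def
  proof (intro conjI ballI)
    show "continuous_on SC f"
      using g(1) GA_continuous by (intro uniform_limit_theorem[OF _ ul]) auto
    fix \<rho> \<psi> assume *: "\<rho> \<in> Pos" "\<psi> \<in> SC - X"
    show "(\<lambda>z. f (smult (spow \<rho> z) \<psi>)) holomorphic_on {z. 0 < Re z}"
    proof (rule holomorphic_uniform_sequence)
      show "open {z. 0 < Re z}" by (simp add: open_halfspace_Re_gt)
      show "(\<lambda>z. g n (smult (spow \<rho> z) \<psi>)) holomorphic_on {z. 0 < Re z}" for n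
        using g(1) * unfolding GA_def by blast
      fix z assume z: "z \<in> {z. 0 < Re z}"
      then obtain d where d: "d > 0" "cball z d \<subseteq> {z. 0 < Re z}"
        using open_contains_cball[of "{z. 0 < Re z}"] by (auto simp: open_halfspace_Re_gt)
      have "uniform_limit (cball z d) (\<lambda>n z. g n (smult (spow \<rho> z) \<psi>))
        (\<lambda>z. f (smult (spow \<rho> z) \<psi>)) sequentially"
      proof (rule uniform_limit_compose'[OF ul])
        show "(\<lambda>z. smult (spow \<rho> z) \<psi>) \<in> cball z d \<rightarrow> SC"
          using d * spow_SC by (auto simp: subset_iff less_imp_le)
      qed
      with d show "\<exists>d>0. cball z d \<subseteq> {z. 0 < Re z} \<and>
        uniform_limit (cball z d) (\<lambda>n z. g n (smult (spow \<rho> z) \<psi>))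
          (\<lambda>z. f (smult (spow \<rho> z) \<psi>)) sequentially" by blast
    qed
  qed
qed

text \<open>\<open>GA\<close> speaks of base points outside \<open>X\<close> only. A character
  \<eta> is reached by moving part of the exponent into the base point: \<rho>^z \<eta> =
  \<rho>^(z-d) (\<rho>^d \<eta>), where \<rho>^d \<eta> is not a character for d > 0. Taking
  \<open>d\<close> as half of \<open>Re z\<close> keeps \<open>z - d\<close> in the
  half-plane.\<close>

lemma GA_holomorphic_char:
  assumes f: "GA f" and \<rho>: "\<rho> \<in> Pos" and \<eta>: "\<eta> \<in> X"
  shows "(\<lambda>z. f (smult (spow \<rho> z) \<eta>)) holomorphic_on {z. 0 < Re z}"
proof -
  let ?g = "\<lambda>z. f (smult (spow \<rho> z) \<eta>)"
  have "?g field_differentiable (at z)" if z: "0 < Re z" for z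
  proof -
    define d where "d = Re z / 2"
    have d: "d > 0" using z by (simp add: d_def)
    let ?\<psi> = "smult (spow \<rho> (of_real d)) \<eta>"
    have "spow \<rho> (of_real d) \<in> Pos" using spow_Pos[OF \<rho> d] .
    have "?\<psi> \<in> SC - X"
    proof -
      obtain s where s: "s \<in> M" "cmod (spow \<rho> (of_real d) s) \<noteq> 1"
        using Pos_SC[OF spow_Pos[OF \<rho> d]] Pos_X[OF spow_Pos[OF \<rho> d]]
        unfolding characters_def by blast
      then have "cmod (?\<psi> s) \<noteq> 1" using \<eta> by (simp add: norm_mult X_cmod)
      then have "?\<psi> \<notin> X" using X_cmod[OF _ s(1), of ?\<psi>] by blast
      then show ?thesis using spow_Pos[OF \<rho> d] X_SC[OF \<eta>] by simp
    qed
    then have "(\<lambda>z. f (smult (spow \<rho> z) ?\<psi>)) holomorphic_on {z. 0 < Re z}"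
      using f \<rho> unfolding GA_def by blast
    then have "(\<lambda>z. f (smult (spow \<rho> z) ?\<psi>)) \<circ> (\<lambda>z. z - of_real d) holomorphic_on {z. d < Re z}"
      by (rule holomorphic_on_compose_gen[rotated]) (auto intro!: holomorphic_intros)
    moreover have "(\<lambda>z. f (smult (spow \<rho> z) ?\<psi>)) \<circ> (\<lambda>z. z - of_real d) = ?g"
    proof
      fix w
      have "smult (spow \<rho> (w - of_real d)) ?\<psi> = smult (spow \<rho> w) \<eta>"
        using spow_add[OF \<rho>, of "w - of_real d" "of_real d"] by (simp add: smult_assoc)
      then show "((\<lambda>z. f (smult (spow \<rho> z) ?\<psi>)) \<circ> (\<lambda>z. z - of_real d)) w = ?g w" by simp
    qed
    ultimately have "?g holomorphic_on {z. d < Re z}" by simp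
    moreover have "z \<in> {z. d < Re z}" using z by (simp add: d_def)
    ultimately show ?thesis
      using open_halfspace_Re_gt by (metis holomorphic_on_imp_differentiable_at)
  qed
  then show ?thesis by (simp add: holomorphic_on_def field_differentiable_at_within)
qed

subsection \<open>The functions given by the elements of the dominated semigroup\<close>

text \<open>On a compact set of normalized positive semicharacters the value at \<open>g\<close>
  stays below some c < 1, and a power of c is below the value 1/2 at \<open>u\<close>. Both sides of
  the claimed inequality scale alike under \<rho> \<mapsto> \<rho>^t, so the normalization loses
  nothing.\<close>

lemma P_domination:
  assumes g: "g \<in> P" "g \<noteq> \<one>" and u: "u \<in> M" "u \<noteq> \<one>"
  obtains k :: nat where "k > 0" "\<And>\<psi>. \<psi> \<in> SC \<Longrightarrow> cmod (ext \<psi> g) ^ k \<le> cmod (\<psi> u)"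
proof -
  obtain a b where ab: "a \<in> M" "b \<in> M" "g = inv a \<otimes> b" using quotient_repr[of g] g by auto
  \<comment> \<open>The value 1/2 at \<open>u\<close> keeps the set away from the constant 1 and
    from \<open>eps\<close>, so this closed part of the compact space \<open>SC\<close> lies inside
    \<open>Pos\<close>.\<close>
  define K where "K = {\<rho> \<in> SC. \<rho> u = 1/2 \<and> (\<forall>s\<in>M. \<rho> s \<in> \<real>\<^sub>\<ge>\<^sub>0)}"
  have KPos: "K \<subseteq> Pos"
  proof
    fix \<rho> assume \<rho>: "\<rho> \<in> K"
    then have h: "\<rho> \<in> SC" "\<rho> u = 1/2" by (auto simp: K_def)
    have "\<rho> u \<noteq> 0" "cmod (\<rho> u) \<noteq> 1" unfolding h(2) by simp_all
    with h(1) have "nonvan \<rho>" "\<rho> \<notin> X" using SC_nonvan_if[of \<rho> u] u X_cmod[of \<rho> u] by blast+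
    then show "\<rho> \<in> Pos" using \<rho> unfolding Pos_def K_def nonvan_def by blast
  qed
  have "compact K"
  proof -
    have "K = SC \<inter> ({\<rho>. \<rho> u = 1/2} \<inter> (\<Inter>s\<in>M. {\<rho>. \<rho> s \<in> \<real>\<^sub>\<ge>\<^sub>0}))" by (auto simp: K_def)
    moreover have "closed {\<rho>::'a \<Rightarrow> complex. \<rho> s \<in> \<real>\<^sub>\<ge>\<^sub>0}" for s
      using closed_vimage[OF closed_nonneg_Reals_complex continuous_on_product_coordinates[of s]]
      by (simp add: vimage_def)
    then have "closed ({\<rho>::'a \<Rightarrow> complex. \<rho> u = 1/2} \<inter> (\<Inter>s\<in>M. {\<rho>. \<rho> s \<in> \<real>\<^sub>\<ge>\<^sub>0}))"
      by (intro closed_Int closed_INT ballI closed_Collect_eq continuous_intros)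
    ultimately show ?thesis using compact_SC by (simp add: compact_Int_closed)
  qed
  have "\<exists>c. 0 < c \<and> c < 1 \<and> (\<forall>\<rho>\<in>K. cmod (ext \<rho> g) \<le> c)"
  proof (cases "K = {}")
    case True
    then show ?thesis by (intro exI[of _ "1/2"]) auto
  next
    case False
    have "continuous_on K (\<lambda>\<rho>. cmod (\<rho> b / \<rho> a))"
      using Pos_nonvan[OF subsetD[OF KPos]] ab(1) by (intro continuous_intros) (auto simp: nonvan_def)
    from continuous_attains_sup[OF \<open>compact K\<close> False this]
    obtain \<rho>0 where \<rho>0: "\<rho>0 \<in> K" "\<And>\<rho>. \<rho> \<in> K \<Longrightarrow> cmod (\<rho> b / \<rho> a) \<le> cmod (\<rho>0 b / \<rho>0 a)" by blast
    have eq: "ext \<rho> g = \<rho> b / \<rho> a" if "\<rho> \<in> K" for \<rho>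
      using that g by (intro ext_quotient ab) (auto simp: K_def)
    have P0: "\<rho>0 \<in> Pos" using KPos \<rho>0 by blast
    have "cmod (ext \<rho> g) \<le> cmod (ext \<rho>0 g)" if "\<rho> \<in> K" for \<rho>
      using \<rho>0(2)[OF that] unfolding eq[OF that] eq[OF \<rho>0(1)] .
    then show ?thesis
      using P_D[OF g P0] Pos_ext(2)[OF P0 P_carrier[OF g(1)]] by blast
  qed
  then obtain c where c: "0 < c" "c < 1" "\<And>\<rho>. \<rho> \<in> K \<Longrightarrow> cmod (ext \<rho> g) \<le> c" by blast
  \<comment> \<open>The bound 1/2 is the common value at \<open>u\<close> of the elements of
    \<open>K\<close>.\<close>
  obtain k where k: "c ^ k < 1/2" using real_arch_pow_inv[of "1/2" c] c by auto
  have k0: "k > 0" using k by (cases k) auto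
  show ?thesis
  proof (rule that[OF k0])
    fix \<psi> assume \<psi>: "\<psi> \<in> SC"
    then show "cmod (ext \<psi> g) ^ k \<le> cmod (\<psi> u)"
    proof (cases rule: SC_cases)
      case van
      then have "ext \<psi> g = 0" using ext_eps[OF P_carrier[OF g(1)] g(2) \<psi>] by blast
      then show ?thesis using k0 by (simp add: zero_power)
    next
      case char
      then show ?thesis using ext_X[OF char P_carrier[OF g(1)]] X_cmod[OF char u(1)] by simp
    next
      case (pos \<rho> \<eta>)
      define r where "r = cmod (\<psi> u)"
      define x where "x = cmod (ext \<psi> g)"
      have \<rho>u: "cmod (\<rho> u) = r" using pos(6) u by (simp add: absc_def r_def)
      have x: "cmod (ext \<rho> g) = x" using cmod_ext_absc[OF \<psi> P_carrier[OF g(1)]] pos(6) by (simp add: x_def)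
      have r: "0 < r" "r < 1" using SC_less_one[OF \<psi> pos(5) u] Pos_apply(2)[OF pos(1) u(1)] \<rho>u
        by (auto simp: r_def)
      have x0: "x > 0" using Pos_ext(2)[OF pos(1) P_carrier[OF g(1)]] x by simp
      \<comment> \<open>The exponent with r^t = 1/2, so that the power \<rho>^t lies in
        \<open>K\<close>.\<close>
      define t where "t = ln (1/2) / ln r"
      have t: "t > 0" unfolding t_def using r by (intro divide_neg_neg) (auto simp: ln_less_zero)
      have tr: "t * ln r = ln (1/2)" using r by (simp add: t_def)
      let ?\<rho> = "spow \<rho> (of_real t)"
      have P: "?\<rho> \<in> Pos" by (rule spow_Pos[OF pos(1) t])
      have "?\<rho> u = of_real (exp (t * ln r))"
        unfolding spow_apply[OF pos(1) u(1)] \<rho>u by (simp flip: exp_of_real)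
      also have "\<dots> = 1/2" unfolding tr by simp
      finally have "?\<rho> \<in> K" using P unfolding K_def Pos_def by blast
      then have "cmod (ext ?\<rho> g) \<le> c" by (rule c)
      then have "exp (t * ln x) \<le> c"
        using ext_spow[OF pos(1) _ P_carrier[OF g(1)], of "of_real t"] t x by simp
      then have 1: "t * ln x \<le> ln c" using c ln_le_cancel_iff[of "exp (t * ln x)" c] by simp
      have "real k * ln c < ln (1/2)" using k c ln_less_cancel_iff[of "c ^ k" "1/2"]
        by (simp add: ln_realpow)
      then have 2: "real k * ln c \<le> t * ln r" using tr by simp
      have "t * (real k * ln x) = real k * (t * ln x)" by simp
      also have "\<dots> \<le> real k * ln c" using 1 by (intro mult_left_mono) auto
      also have "\<dots> \<le> t * ln r" by (rule 2)
      finally have "real k * ln x \<le> ln r" using t by simp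
      then have "ln (x ^ k) \<le> ln r" using x0 by (simp add: ln_realpow)
      then have "x ^ k \<le> r" using x0 r by (subst (asm) ln_le_cancel_iff) auto
      then show ?thesis by (simp add: x_def r_def)
    qed
  qed
qed

lemma continuous_ext:
  assumes g: "g \<in> P" shows "continuous_on SC (\<lambda>\<psi>. ext \<psi> g)"
proof (cases "g = \<one>")
  case False
  obtain a b where ab: "a \<in> M" "b \<in> M" "g = inv a \<otimes> b" using quotient_repr[of g] g by auto
  have eq: "ext \<psi> g = \<psi> b / \<psi> a" if "\<psi> \<in> SC" for \<psi>
    using that False by (intro ext_quotient ab) auto
  show ?thesis
    unfolding continuous_on_def
  proof
    fix \<psi>0 assume \<psi>0: "\<psi>0 \<in> SC"
    have coord: "((\<lambda>\<psi>. \<psi> i) \<longlongrightarrow> \<psi>0 i) (at \<psi>0 within SC)" for i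
      using continuous_on_coordinate[of SC i] \<psi>0 unfolding continuous_on_def by blast
    show "((\<lambda>\<psi>. ext \<psi> g) \<longlongrightarrow> ext \<psi>0 g) (at \<psi>0 within SC)"
    proof (cases "\<psi>0 a = 0")
      case nz: False
      have "((\<lambda>\<psi>. \<psi> b / \<psi> a) \<longlongrightarrow> \<psi>0 b / \<psi>0 a) (at \<psi>0 within SC)"
        using nz by (intro tendsto_divide coord) auto
      then show ?thesis
        unfolding eq[OF \<psi>0]
        by (rule Lim_transform_eventually) (auto simp: eventually_at_filter eq)
    next
      case True
      then have "a \<noteq> \<one>" using SC_one[OF \<psi>0] by auto
      \<comment> \<open>The vanishing denominator itself is the dominating element: it tends to 0 at
        \<open>\<psi>0\<close> and carries \<open>ext \<psi> g\<close> along.\<close>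
      then obtain k :: nat where k: "k > 0" "\<And>\<psi>. \<psi> \<in> SC \<Longrightarrow> cmod (ext \<psi> g) ^ k \<le> cmod (\<psi> a)"
        using P_domination[OF g False ab(1)] by blast
      have "((\<lambda>\<psi>. ext \<psi> g) \<longlongrightarrow> 0) (at \<psi>0 within SC)"
      proof (rule tendstoI)
        fix e :: real assume e: "e > 0"
        then have "\<forall>\<^sub>F \<psi> in at \<psi>0 within SC. dist (\<psi> a) (\<psi>0 a) < e ^ k"
          by (intro tendstoD[OF coord]) simp
        moreover have "\<forall>\<^sub>F \<psi> in at \<psi>0 within SC. \<psi> \<in> SC" by (simp add: eventually_at_filter)
        ultimately show "\<forall>\<^sub>F \<psi> in at \<psi>0 within SC. dist (ext \<psi> g) 0 < e"
        proof eventually_elim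
          case (elim \<psi>)
          then have "cmod (ext \<psi> g) ^ k < e ^ k" using k(2)[OF elim(2)] True by simp
          then show ?case using e by (simp add: power_less_imp_less_base)
        qed
      qed
      then show ?thesis using eq[OF \<psi>0] True by simp
    qed
  qed
qed simp

lemma GA_ext:
  assumes g: "g \<in> P" shows "GA (\<lambda>\<psi>. ext \<psi> g)"
  unfolding GA_def
proof (intro conjI ballI)
  show "continuous_on SC (\<lambda>\<psi>. ext \<psi> g)" by (rule continuous_ext[OF g])
  fix \<rho> \<psi> assume *: "\<rho> \<in> Pos" "\<psi> \<in> SC - X"
  have "(\<lambda>z. exp (z * of_real (ln (cmod (ext \<rho> g)))) * ext \<psi> g) holomorphic_on {z. 0 < Re z}"
    by (intro holomorphic_intros)
  then show "(\<lambda>z. ext (smult (spow \<rho> z) \<psi>) g) holomorphic_on {z. 0 < Re z}"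
    by (rule holomorphic_transform)
      (use * g spow_SC in \<open>auto simp: ext_smult ext_spow\<close>)
qed

lemma GA_peval:
  "snd ` set xs \<subseteq> P \<Longrightarrow> GA (\<lambda>\<psi>. peval xs (ext \<psi>))"
proof (induction xs)
  case Nil
  show ?case by (simp add: GA_const)
next
  case (Cons x xs)
  obtain c g where x: "x = (c, g)" by (cases x)
  have "GA (\<lambda>\<psi>. c * ext \<psi> g + peval xs (ext \<psi>))"
    by (rule GA_add[OF GA_mult[OF GA_const GA_ext] Cons.IH]) (use Cons.prems x in auto)
  then show ?case by (simp add: x)
qed

end

section \<open>Fourier coefficients of generalized analytic functions\<close>

text \<open>Differentiation under the integral sign by dominated convergence along sequences. The
  difference quotients at \<open>z0\<close> are bounded uniformly: within distance \<open>r\<close>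
  by Cauchy's inequality for the derivative, farther away because the numerator is at most
  \<open>2 * B\<close>.\<close>

lemma holomorphic_integral:
  fixes h :: "'b \<Rightarrow> complex \<Rightarrow> complex"
  assumes fin: "finite_measure M" and U: "open U"
    and hol: "\<And>x. x \<in> space M \<Longrightarrow> h x holomorphic_on U"
    and bound: "\<And>x z. x \<in> space M \<Longrightarrow> z \<in> U \<Longrightarrow> cmod (h x z) \<le> B"
    and meas: "\<And>z. z \<in> U \<Longrightarrow> (\<lambda>x. h x z) \<in> borel_measurable M"
  shows "(\<lambda>z. \<integral>x. h x z \<partial>M) holomorphic_on U"
proof (cases "space M = {}")
  case True
  then have "(\<integral>x. h x z \<partial>M) = 0" for z by (simp add: Bochner_Integration.integral_empty)
  then show ?thesis by simp
next
  case False
  interpret finite_measure M by (rule fin)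
  show ?thesis
    unfolding holomorphic_on_def
  proof
    fix z0 assume z0: "z0 \<in> U"
    obtain x0 where x0: "x0 \<in> space M" using False by blast
    have B0: "B \<ge> 0" using bound[OF x0 z0] norm_ge_zero order_trans by blast
    obtain e where e: "e > 0" "cball z0 e \<subseteq> U" using U z0 open_contains_cball by blast
    define r where "r = e / 2"
    have r: "r > 0" using e by (simp add: r_def)
    have sub: "cball w r \<subseteq> U" if "w \<in> ball z0 r" for w
    proof -
      have "cball w r \<subseteq> cball z0 e"
      proof
        fix v assume "v \<in> cball w r"
        then show "v \<in> cball z0 e"
          using that dist_triangle[of z0 v w] by (simp add: r_def)
      qed
      with e show ?thesis by blast
    qed
    have quot: "cmod ((h x z - h x z0) / (z - z0)) \<le> 2 * B / r"
      if x: "x \<in> space M" and z: "z \<in> U" "z \<noteq> z0" for x z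
    proof (cases "z \<in> ball z0 r")
      case True
      have "cmod (h x z - h x z0) \<le> (B / r) * cmod (z - z0)"
      proof (rule field_differentiable_bound[where S = "ball z0 r" and f' = "deriv (h x)"])
        fix w assume w: "w \<in> ball z0 r"
        then have wU: "w \<in> U" using sub[OF w] r by (meson centre_in_cball less_imp_le subsetD)
        show "(h x has_field_derivative deriv (h x) w) (at w within ball z0 r)"
          using holomorphic_derivI[OF hol[OF x] U wU] by (rule has_field_derivative_at_within)
        have "cmod ((deriv ^^ 1) (h x) w) \<le> fact 1 * B / r ^ 1"
        proof (rule Cauchy_inequality)
          show "h x holomorphic_on ball w r"
            using hol[OF x] sub[OF w] by (meson ball_subset_cball holomorphic_on_subset subset_trans)
          show "continuous_on (cball w r) (h x)"
            using hol[OF x] sub[OF w] holomorphic_on_imp_continuous_on continuous_on_subset by blast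
          fix v assume "cmod (w - v) = r"
          then have "v \<in> U" using sub[OF w] by (auto simp: dist_norm)
          then show "cmod (h x v) \<le> B" using bound x by blast
        qed (rule r)
        then show "cmod (deriv (h x) w) \<le> B / r" by simp
      qed (use True r in auto)
      then have "cmod ((h x z - h x z0) / (z - z0)) \<le> B / r"
        using z by (simp add: norm_divide divide_le_eq)
      also have "\<dots> \<le> 2 * B / r" using B0 r by (intro divide_right_mono) auto
      finally show ?thesis .
    next
      case False
      then have rz: "r \<le> cmod (z - z0)" by (simp add: dist_norm norm_minus_commute)
      have "cmod (h x z - h x z0) \<le> B + B"
        using bound[OF x z(1)] bound[OF x z0] norm_triangle_ineq4[of "h x z" "h x z0"] by linarith
      then have "cmod (h x z - h x z0) / cmod (z - z0) \<le> (B + B) / r"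
        using rz r B0 by (intro frac_le) auto
      then show ?thesis by (simp add: norm_divide)
    qed
    have int: "integrable M (\<lambda>x. h x z)" if "z \<in> U" for z
      using bound that meas by (intro integrable_const_bound[where B = B] AE_I2) auto
    have "((\<lambda>z. \<integral>x. h x z \<partial>M) has_field_derivative (\<integral>x. deriv (h x) z0 \<partial>M)) (at z0 within U)"
      unfolding has_field_derivative_iff tendsto_at_iff_sequentially
    proof (intro allI impI)
      fix Z :: "nat \<Rightarrow> complex"
      assume Z: "\<forall>i. Z i \<in> U - {z0}" "Z \<longlonglongrightarrow> z0"
      let ?q = "\<lambda>i x. (h x (Z i) - h x z0) / (Z i - z0)"
      have lim: "(\<lambda>i. ?q i x) \<longlonglongrightarrow> deriv (h x) z0" if x: "x \<in> space M" for x
      proof -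
        have "(h x has_field_derivative deriv (h x) z0) (at z0 within U)"
          using holomorphic_derivI[OF hol[OF x] U z0] by (rule has_field_derivative_at_within)
        then show ?thesis
          using Z unfolding has_field_derivative_iff tendsto_at_iff_sequentially comp_def by blast
      qed
      have qm: "?q i \<in> borel_measurable M" for i
        using meas[of "Z i"] meas[OF z0] Z by (intro borel_measurable_divide borel_measurable_diff) auto
      have dm: "(\<lambda>x. deriv (h x) z0) \<in> borel_measurable M"
        by (rule borel_measurable_LIMSEQ_metric[OF qm lim])
      have "(\<lambda>i. \<integral>x. ?q i x \<partial>M) \<longlonglongrightarrow> (\<integral>x. deriv (h x) z0 \<partial>M)"
      proof (rule integral_dominated_convergence[where w = "\<lambda>_. 2 * B / r"])
        show "AE x in M. (\<lambda>i. ?q i x) \<longlonglongrightarrow> deriv (h x) z0" using lim by (intro AE_I2)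
        show "AE x in M. norm (?q i x) \<le> 2 * B / r" for i
          using quot Z by (intro AE_I2) auto
      qed (use dm qm in auto)
      moreover have "(\<integral>x. ?q i x \<partial>M) = ((\<integral>x. h x (Z i) \<partial>M) - (\<integral>x. h x z0 \<partial>M)) / (Z i - z0)" for i
        using int[of "Z i"] int[OF z0] Z by simp
      ultimately show "((\<lambda>y. ((\<integral>x. h x y \<partial>M) - (\<integral>x. h x z0 \<partial>M)) / (y - z0)) \<circ> Z)
          \<longlonglongrightarrow> (\<integral>x. deriv (h x) z0 \<partial>M)"
        by (simp only: comp_def)
    qed
    then show "(\<lambda>z. \<integral>x. h x z \<partial>M) field_differentiable (at z0 within U)"
      unfolding field_differentiable_def by blast
  qed
qed

text \<open>After division by the exponential the function does not depend on the imaginary part, so its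
  derivative vanishes.\<close>

lemma exponential_if_imaginary_translation:
  assumes hol: "H holomorphic_on {z. 0 < Re z}"
    and trans: "\<And>z y. 0 < Re z \<Longrightarrow> H (z + \<i> * of_real y) = exp (\<i> * of_real y * l) * H z"
  shows "\<exists>C. \<forall>z. 0 < Re z \<longrightarrow> H z = C * exp (z * l)"
proof -
  define W where "W z = H z * exp (- (z * l))" for z
  let ?U = "{z. 0 < Re z}"
  have op: "open ?U" by (simp add: open_halfspace_Re_gt)
  have Whol: "W holomorphic_on ?U"
    unfolding W_def by (intro holomorphic_intros hol)
  have Wt: "W (z + \<i> * of_real y) = W z" if "0 < Re z" for z y
    unfolding W_def trans[OF that] by (simp add: exp_diff exp_minus distrib_right exp_add field_simps)
  have "\<exists>c. \<forall>z\<in>?U. W z = c"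
  proof (rule has_field_derivative_zero_constant)
    show "convex ?U" by (rule convex_halfspace_Re_gt)
    fix z assume z: "z \<in> ?U"
    have D: "(W has_field_derivative deriv W z) (at z within ?U)"
      using holomorphic_derivI[OF Whol op z] by (rule has_field_derivative_at_within)
    define d where "d n = inverse (real (Suc n))" for n
    have d: "d n \<noteq> 0" "d \<longlonglongrightarrow> 0" for n
      unfolding d_def by (simp, rule LIMSEQ_inverse_real_of_nat)
    let ?Z = "\<lambda>n. z + \<i> * of_real (d n)"
    have "?Z \<longlonglongrightarrow> z + \<i> * of_real 0"
      by (intro tendsto_intros d)
    then have Zlim: "?Z \<longlonglongrightarrow> z" by simp
    have ZU: "\<forall>n. ?Z n \<in> ?U - {z}" using z d(1) by simp
    have quot: "(\<lambda>n. (W (Z n) - W z) / (Z n - z)) \<longlonglongrightarrow> deriv W z"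
      if "\<forall>n. Z n \<in> ?U - {z}" "Z \<longlonglongrightarrow> z" for Z
      using D that unfolding has_field_derivative_iff tendsto_at_iff_sequentially comp_def by blast
    have "(\<lambda>n. (W (?Z n) - W z) / (?Z n - z)) \<longlonglongrightarrow> deriv W z"
      by (rule quot[OF ZU Zlim])
    moreover have "(W (?Z n) - W z) / (?Z n - z) = 0" for n
      using Wt[of z] z by simp
    ultimately have "(\<lambda>n::nat. 0) \<longlonglongrightarrow> deriv W z" by (simp only:)
    then have "deriv W z = 0" using LIMSEQ_unique tendsto_const by blast
    with D show "(W has_field_derivative 0) (at z within ?U)" by simp
  qed
  then obtain C where C: "\<And>z. 0 < Re z \<Longrightarrow> W z = C" by auto
  have "H z = C * exp (z * l)" if "0 < Re z" for z
    using C[OF that] unfolding W_def by (simp add: exp_minus field_simps)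
  then show ?thesis by blast
qed

lemma tendsto_fun_componentwise:
  fixes f :: "'c \<Rightarrow> 'a \<Rightarrow> 'b::topological_space"
  assumes "\<And>i. ((\<lambda>n. f n i) \<longlongrightarrow> l i) F" shows "(f \<longlongrightarrow> l) F"
proof -
  have "limitin (product_topology (\<lambda>_. euclidean) UNIV) f l F"
    unfolding limitin_componentwise using assms by (simp add: limitin_canonical_iff)
  then show ?thesis by (simp add: euclidean_product_topology limitin_canonical_iff)
qed

section \<open>Integration over the group of characters\<close>

locale no_nontrivial_prime_ideals_haar = no_nontrivial_prime_ideals +
  fixes \<mu> :: "('a \<Rightarrow> complex) measure"
  assumes haar: "normalized_haar_measure S \<mu>"
begin

lemma space_haar [simp]: "space \<mu> = X"
  and sets_haar: "sets \<mu> = sigma_sets X (Collect (openin (top_of_set X)))"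
  and emeasure_haar: "emeasure \<mu> X = 1"
  and haar_invariant: "\<eta> \<in> X \<Longrightarrow> A \<in> sets \<mu> \<Longrightarrow> emeasure \<mu> (smult \<eta> ` A) = emeasure \<mu> A"
  using haar by (auto simp: normalized_haar_measure_def character_topology_eq)

sublocale finite_measure \<mu>
  by (rule finite_measureI) (simp add: emeasure_haar)

lemma measure_X [simp]: "measure \<mu> X = 1"
  by (simp add: measure_def emeasure_haar)

lemma openin_sets: "openin (top_of_set X) A \<Longrightarrow> A \<in> sets \<mu>"
  unfolding sets_haar by (rule sigma_sets.Basic) simp

lemma continuous_measurable:
  fixes \<phi> :: "('a \<Rightarrow> complex) \<Rightarrow> 'b::topological_space"
  assumes "continuous_on X \<phi>" shows "\<phi> \<in> borel_measurable \<mu>"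
proof (rule borel_measurableI)
  fix A :: "'b set" assume "open A"
  then have "openin (top_of_set X) (X \<inter> \<phi> -` A)"
    using assms by (intro continuous_openin_preimage_gen)
  then show "\<phi> -` A \<inter> space \<mu> \<in> sets \<mu>"
    using openin_sets by (simp add: Int_commute)
qed

lemma continuous_integrable:
  fixes \<phi> :: "('a \<Rightarrow> complex) \<Rightarrow> 'b::{banach, second_countable_topology}"
  assumes "continuous_on X \<phi>" shows "integrable \<mu> \<phi>"
proof -
  have "bounded (\<phi> ` X)"
    using assms compact_X by (intro compact_imp_bounded compact_continuous_image)
  then obtain B where "\<And>\<eta>. \<eta> \<in> X \<Longrightarrow> norm (\<phi> \<eta>) \<le> B" unfolding bounded_iff by auto
  then show ?thesis
    using continuous_measurable[OF assms] by (intro integrable_const_bound[where B = B] AE_I2) auto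
qed

lemma smult_vimage:
  assumes "\<eta> \<in> X" "A \<subseteq> X" shows "smult \<eta> -` A \<inter> X = smult (invc \<eta>) ` A"
proof (intro equalityI subsetI)
  fix x assume "x \<in> smult \<eta> -` A \<inter> X"
  then have "smult \<eta> x \<in> A" "x = smult (invc \<eta>) (smult \<eta> x)"
    using assms X_SC by (auto simp flip: smult_assoc)
  then show "x \<in> smult (invc \<eta>) ` A" by blast
next
  fix x assume "x \<in> smult (invc \<eta>) ` A"
  then obtain y where y: "y \<in> A" "x = smult (invc \<eta>) y" by blast
  then have "smult \<eta> x = y" using assms X_SC by (auto simp flip: smult_assoc)
  then show "x \<in> smult \<eta> -` A \<inter> X" using y assms by auto
qed

lemma continuous_smult_const: "continuous_on A (smult \<eta>)"
  using continuous_smult[OF continuous_on_const continuous_on_id] by simp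

lemma smult_measurable:
  assumes "\<eta> \<in> X" shows "smult \<eta> \<in> measurable \<mu> \<mu>"
proof (rule measurable_sigma_sets[OF sets_haar])
  show "Collect (openin (top_of_set X)) \<subseteq> Pow X" using openin_subset by force
  show "smult \<eta> \<in> space \<mu> \<rightarrow> X" using assms by simp
  fix A assume "A \<in> Collect (openin (top_of_set X))"
  then have "openin (top_of_set X) (X \<inter> smult \<eta> -` A)"
    using assms by (intro continuous_openin_preimage[OF continuous_smult_const, of _ X]) auto
  then show "smult \<eta> -` A \<inter> space \<mu> \<in> sets \<mu>"
    using openin_sets by (simp add: Int_commute)
qed

text \<open>The invariance of \<mu> concerns images of sets. The preimage under a translation is the
  image under the inverse translation, so the image measure is \<mu> itself.\<close>

lemma integral_invariant:
  fixes \<phi> :: "('a \<Rightarrow> complex) \<Rightarrow> complex"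
  assumes \<eta>: "\<eta> \<in> X" and \<phi>: "continuous_on X \<phi>"
  shows "(\<integral>x. \<phi> (smult \<eta> x) \<partial>\<mu>) = (\<integral>x. \<phi> x \<partial>\<mu>)"
proof -
  have "distr \<mu> \<mu> (smult \<eta>) = \<mu>"
  proof (rule measure_eqI)
    fix A assume "A \<in> sets (distr \<mu> \<mu> (smult \<eta>))"
    then have A: "A \<in> sets \<mu>" by simp
    then have "A \<subseteq> X" using sets.sets_into_space by fastforce
    then have "emeasure (distr \<mu> \<mu> (smult \<eta>)) A = emeasure \<mu> (smult (invc \<eta>) ` A)"
      using A \<eta> by (simp add: emeasure_distr smult_measurable smult_vimage)
    also have "\<dots> = emeasure \<mu> A" using A \<eta> by (intro haar_invariant) auto
    finally show "emeasure (distr \<mu> \<mu> (smult \<eta>)) A = emeasure \<mu> A" .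
  qed simp
  then have "(\<integral>x. \<phi> x \<partial>\<mu>) = (\<integral>x. \<phi> x \<partial>(distr \<mu> \<mu> (smult \<eta>)))" by simp
  also have "\<dots> = (\<integral>x. \<phi> (smult \<eta> x) \<partial>\<mu>)"
    by (rule integral_distr[OF smult_measurable[OF \<eta>] continuous_measurable[OF \<phi>]])
  finally show ?thesis by simp
qed

lemma continuous_ext_X:
  assumes "g \<in> carrier G" shows "continuous_on X (\<lambda>\<eta>. ext \<eta> g)"
proof -
  obtain a b where ab: "a \<in> M" "b \<in> M" "g = inv a \<otimes> b" using quotient_repr assms by blast
  have "continuous_on X (\<lambda>\<eta>. \<eta> b / \<eta> a)"
    using X_nonvan ab by (intro continuous_intros) (auto simp: nonvan_def)
  then show ?thesis
    by (rule continuous_on_eq) (use ab X_SC X_nonvan ext_quotient[OF _ ab] in auto)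
qed

text \<open>Translation by a character whose value at \<open>g\<close> is not 1 multiplies the
  integral by that value, yet leaves it unchanged.\<close>

lemma integral_ext:
  assumes g: "g \<in> carrier G" "g \<noteq> \<one>" shows "(\<integral>\<eta>. ext \<eta> g \<partial>\<mu>) = 0"
proof -
  obtain \<eta>0 where \<eta>0: "\<eta>0 \<in> X" "ext \<eta>0 g \<noteq> 1" using characters_separate[OF g] by blast
  let ?I = "\<integral>\<eta>. ext \<eta> g \<partial>\<mu>"
  have "?I = (\<integral>\<eta>. ext (smult \<eta>0 \<eta>) g \<partial>\<mu>)"
    by (rule integral_invariant[OF \<eta>0(1) continuous_ext_X[OF g(1)], symmetric])
  also have "\<dots> = (\<integral>\<eta>. ext \<eta>0 g * ext \<eta> g \<partial>\<mu>)"
    by (rule Bochner_Integration.integral_cong) (use \<eta>0 g X_SC in \<open>auto simp: ext_smult\<close>)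
  also have "\<dots> = ext \<eta>0 g * ?I" by simp
  finally show ?thesis using \<eta>0 by simp
qed

lemma ext_cnj:
  assumes "\<eta> \<in> X" "g \<in> carrier G" shows "cnj (ext \<eta> g) = ext \<eta> (inv g)"
proof -
  have "ext \<eta> g * cnj (ext \<eta> g) = 1"
    using ext_X[OF assms] by (simp add: complex_norm_square[symmetric])
  then have "cnj (ext \<eta> g) = inverse (ext \<eta> g)" by (metis inverse_unique)
  then show ?thesis using ext_inv[OF X_SC X_nonvan] assms by simp
qed

lemma integral_ext_cnj:
  assumes "g \<in> carrier G" "h \<in> carrier G"
  shows "(\<integral>\<eta>. ext \<eta> h * cnj (ext \<eta> g) \<partial>\<mu>) = (if h = g then 1 else 0)"
proof -
  have "(\<integral>\<eta>. ext \<eta> h * cnj (ext \<eta> g) \<partial>\<mu>) = (\<integral>\<eta>. ext \<eta> (h \<otimes> inv g) \<partial>\<mu>)"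
    by (rule Bochner_Integration.integral_cong)
      (use assms X_SC X_nonvan in \<open>auto simp: ext_cnj ext_mult\<close>)
  also have "\<dots> = (if h = g then 1 else 0)"
  proof (cases "h = g")
    case True
    then show ?thesis using assms by (simp add: r_inv)
  next
    case False
    then have "h \<otimes> inv g \<noteq> \<one>" using assms by (metis inv_inv inv_closed inv_equality)
    then show ?thesis using assms False by (simp add: integral_ext)
  qed
  finally show ?thesis .
qed

lemma continuous_peval_X:
  "snd ` set xs \<subseteq> carrier G \<Longrightarrow> continuous_on X (\<lambda>\<eta>. peval xs (ext \<eta>))"
proof (induction xs)
  case (Cons x xs)
  obtain c g where x: "x = (c, g)" by (cases x)
  show ?case
    unfolding x peval_Cons
    by (intro continuous_intros continuous_ext_X Cons.IH) (use Cons.prems x in auto)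
qed simp

lemma integral_peval:
  assumes "snd ` set xs \<subseteq> carrier G" "g \<in> carrier G"
  shows "(\<integral>\<eta>. peval xs (ext \<eta>) * cnj (ext \<eta> g) \<partial>\<mu>) = coef xs g"
  using assms(1)
proof (induction xs)
  case (Cons x xs)
  obtain c h where x: "x = (c, h)" by (cases x)
  have h: "h \<in> carrier G" and xs: "snd ` set xs \<subseteq> carrier G" using Cons.prems x by auto
  have "(\<integral>\<eta>. peval (x # xs) (ext \<eta>) * cnj (ext \<eta> g) \<partial>\<mu>)
    = (\<integral>\<eta>. c * (ext \<eta> h * cnj (ext \<eta> g)) + peval xs (ext \<eta>) * cnj (ext \<eta> g) \<partial>\<mu>)"
    by (simp add: x algebra_simps)
  also have "\<dots> = (\<integral>\<eta>. c * (ext \<eta> h * cnj (ext \<eta> g)) \<partial>\<mu>) + (\<integral>\<eta>. peval xs (ext \<eta>) * cnj (ext \<eta> g) \<partial>\<mu>)"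
    using assms(2) h xs
    by (intro Bochner_Integration.integral_add continuous_integrable continuous_intros
        continuous_ext_X continuous_peval_X)
  also have "\<dots> = coef (x # xs) g"
    using Cons.IH[OF xs] integral_ext_cnj[OF assms(2) h] by (simp add: x coef_def)
  finally show ?case .
qed (simp add: coef_def)

text \<open>A coefficient is an integral of the polynomial against a unimodular function for a
  probability measure.\<close>

lemma coef_le_sup:
  assumes xs: "snd ` set xs \<subseteq> carrier G" and M: "\<And>\<eta>. \<eta> \<in> X \<Longrightarrow> cmod (peval xs (ext \<eta>)) \<le> B"
  shows "cmod (coef xs g) \<le> B"
proof (cases "g \<in> carrier G")
  case g: True
  have B0: "0 \<le> B" using M[OF onec_X] norm_ge_zero order_trans by blast
  have "cmod (coef xs g) \<le> (\<integral>\<eta>. cmod (peval xs (ext \<eta>) * cnj (ext \<eta> g)) \<partial>\<mu>)"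
    unfolding integral_peval[OF xs g, symmetric] by (rule integral_norm_bound)
  also have "\<dots> \<le> (\<integral>\<eta>. B \<partial>\<mu>)"
    by (rule integral_mono)
      (use M g xs in \<open>auto intro!: continuous_integrable continuous_intros continuous_ext_X
        continuous_peval_X simp: norm_mult\<close>)
  finally show ?thesis by simp
next
  case False
  have "coef xs g = 0" using xs False by (induction xs) (auto simp: coef_def)
  moreover have "0 \<le> B" using M[OF onec_X] norm_ge_zero order_trans by blast
  ultimately show ?thesis by simp
qed

section \<open>Fourier coefficients along the orbits of the character group\<close>

definition fhat :: "(('a \<Rightarrow> complex) \<Rightarrow> complex) \<Rightarrow> 'a \<Rightarrow> complex" where
  "fhat f g = (\<integral>\<eta>. f \<eta> * cnj (ext \<eta> g) \<partial>\<mu>)"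

text \<open>The component of \<open>f\<close> of weight \<open>g\<close> for the action of
  \<open>X\<close> on \<open>SC\<close> by multiplication. At the trivial character it is the
  Fourier coefficient.\<close>

definition proj :: "(('a \<Rightarrow> complex) \<Rightarrow> complex) \<Rightarrow> 'a \<Rightarrow> ('a \<Rightarrow> complex) \<Rightarrow> complex" where
  "proj f g \<psi> = (\<integral>\<eta>. f (smult \<psi> \<eta>) * cnj (ext \<eta> g) \<partial>\<mu>)"

lemma fourier_transform_eq:
  assumes "g \<in> carrier G" shows "fourier_transform S G \<mu> (restrict f X) g = fhat f g"
  unfolding fourier_transform_def fhat_def
  by (rule Bochner_Integration.integral_cong) (use assms in \<open>auto simp: character_extension_eq\<close>)

lemma proj_onec: "proj f g onec = fhat f g"
  unfolding proj_def fhat_def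
  by (rule Bochner_Integration.integral_cong) (use X_SC in auto)

lemma continuous_translate:
  assumes f: "continuous_on SC f" and \<psi>: "\<psi> \<in> SC"
  shows "continuous_on X (\<lambda>\<eta>. f (smult \<psi> \<eta>))"
  by (rule continuous_on_compose2[OF f continuous_smult_const]) (use \<psi> X_SC in auto)

lemma continuous_proj_integrand:
  assumes f: "continuous_on SC f" and \<psi>: "\<psi> \<in> SC" and g: "g \<in> carrier G"
  shows "continuous_on X (\<lambda>\<eta>. f (smult \<psi> \<eta>) * cnj (ext \<eta> g))"
  by (intro continuous_on_mult continuous_translate f \<psi> continuous_on_cnj continuous_ext_X g)

lemma proj_smult:
  assumes f: "continuous_on SC f" and \<psi>: "\<psi> \<in> SC" and g: "g \<in> carrier G" and \<eta>0: "\<eta>0 \<in> X"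
  shows "proj f g (smult \<eta>0 \<psi>) = ext \<eta>0 g * proj f g \<psi>"
proof -
  have "ext \<eta>0 g * proj f g \<psi> = (\<integral>\<eta>. ext \<eta>0 g * (f (smult \<psi> \<eta>) * cnj (ext \<eta> g)) \<partial>\<mu>)"
    by (simp add: proj_def)
  also have "\<dots> = (\<integral>\<eta>. ext \<eta>0 g * (f (smult \<psi> (smult \<eta>0 \<eta>)) * cnj (ext (smult \<eta>0 \<eta>) g)) \<partial>\<mu>)"
    by (rule integral_invariant[OF \<eta>0, symmetric])
      (intro continuous_intros continuous_proj_integrand f \<psi> g)
  also have "\<dots> = proj f g (smult \<eta>0 \<psi>)"
    unfolding proj_def
  proof (rule Bochner_Integration.integral_cong)
    fix \<eta> assume "\<eta> \<in> space \<mu>"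
    then have \<eta>: "\<eta> \<in> X" by simp
    have "ext \<eta>0 g * cnj (ext \<eta>0 g) = 1"
      using ext_X[OF \<eta>0 g] by (simp add: complex_norm_square[symmetric])
    then have "ext \<eta>0 g * (y * (cnj (ext \<eta>0 g) * w)) = y * w" for y w
      by (metis (no_types, lifting) mult.assoc mult.left_commute mult_1)
    moreover have "smult \<psi> (smult \<eta>0 \<eta>) = smult (smult \<eta>0 \<psi>) \<eta>"
      by (metis smult_assoc smult_commute)
    ultimately show "ext \<eta>0 g * (f (smult \<psi> (smult \<eta>0 \<eta>)) * cnj (ext (smult \<eta>0 \<eta>) g))
      = f (smult (smult \<eta>0 \<psi>) \<eta>) * cnj (ext \<eta> g)"
      using X_SC \<eta> \<eta>0 g by (simp add: ext_smult)
  qed simp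
  finally show ?thesis by simp
qed

lemma bounded_on_SC:
  fixes f :: "('a \<Rightarrow> complex) \<Rightarrow> complex"
  assumes "continuous_on SC f"
  obtains B where "0 \<le> B" "\<And>\<psi>. \<psi> \<in> SC \<Longrightarrow> cmod (f \<psi>) \<le> B"
proof -
  have "bounded (f ` SC)"
    using assms compact_SC by (intro compact_imp_bounded compact_continuous_image)
  then obtain B where B: "\<And>\<psi>. \<psi> \<in> SC \<Longrightarrow> cmod (f \<psi>) \<le> B" unfolding bounded_iff by auto
  show ?thesis
  proof (rule that)
    show "0 \<le> max 0 B" by simp
    show "cmod (f \<psi>) \<le> max 0 B" if "\<psi> \<in> SC" for \<psi> using B[OF that] by simp
  qed
qed

lemma proj_LIMSEQ:
  assumes f: "continuous_on SC f" and g: "g \<in> carrier G"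
    and \<psi>: "\<And>n. \<psi>s n \<in> SC" "\<psi> \<in> SC" "\<psi>s \<longlonglongrightarrow> \<psi>"
  shows "(\<lambda>n. proj f g (\<psi>s n)) \<longlonglongrightarrow> proj f g \<psi>"
proof -
  obtain B where B: "\<And>\<psi>. \<psi> \<in> SC \<Longrightarrow> cmod (f \<psi>) \<le> B" using bounded_on_SC[OF f] by blast
  show ?thesis
    unfolding proj_def
  proof (rule integral_dominated_convergence[where w = "\<lambda>_. B"])
    show "(\<lambda>\<eta>. f (smult \<psi> \<eta>) * cnj (ext \<eta> g)) \<in> borel_measurable \<mu>"
      by (intro continuous_measurable continuous_proj_integrand f g \<psi>)
    show "(\<lambda>\<eta>. f (smult (\<psi>s n) \<eta>) * cnj (ext \<eta> g)) \<in> borel_measurable \<mu>" for n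
      by (intro continuous_measurable continuous_proj_integrand f g \<psi>)
    show "AE \<eta> in \<mu>. (\<lambda>n. f (smult (\<psi>s n) \<eta>) * cnj (ext \<eta> g))
        \<longlonglongrightarrow> f (smult \<psi> \<eta>) * cnj (ext \<eta> g)"
    proof (rule AE_I2)
      fix \<eta> assume "\<eta> \<in> space \<mu>"
      then have \<eta>: "\<eta> \<in> SC" using X_SC by simp
      have c: "continuous_on SC (\<lambda>\<psi>. f (smult \<eta> \<psi>))"
        by (rule continuous_on_compose2[OF f continuous_smult_const]) (use \<eta> in auto)
      have "(\<lambda>n. f (smult \<eta> (\<psi>s n))) \<longlonglongrightarrow> f (smult \<eta> \<psi>)"
        by (rule continuous_on_tendsto_compose[OF c \<psi>(3,2)]) (simp add: \<psi>)
      then show "(\<lambda>n. f (smult (\<psi>s n) \<eta>) * cnj (ext \<eta> g))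
          \<longlonglongrightarrow> f (smult \<psi> \<eta>) * cnj (ext \<eta> g)"
        by (intro tendsto_intros) (simp add: smult_commute)
    qed
    show "AE \<eta> in \<mu>. cmod (f (smult (\<psi>s n) \<eta>) * cnj (ext \<eta> g)) \<le> B" for n
      using B \<psi> g X_SC by (intro AE_I2) (auto simp: norm_mult)
  qed simp
qed

lemma proj_spow:
  assumes f: "GA f" and \<rho>: "\<rho> \<in> Pos" and g: "g \<in> carrier G" and z: "0 < Re z"
  shows "proj f g (spow \<rho> z) = fhat f g * exp (z * of_real (ln (cmod (ext \<rho> g))))"
proof -
  let ?l = "of_real (ln (cmod (ext \<rho> g))) :: complex"
  define H where "H z = proj f g (spow \<rho> z)" for z
  have fc: "continuous_on SC f" by (rule GA_continuous[OF f])
  obtain B where B: "0 \<le> B" "\<And>\<psi>. \<psi> \<in> SC \<Longrightarrow> cmod (f \<psi>) \<le> B" using bounded_on_SC[OF fc] by blast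
  have "H holomorphic_on {z. 0 < Re z}"
    unfolding H_def proj_def
  proof (rule holomorphic_integral[where B = B])
    show "finite_measure \<mu>" by (rule finite_measure_axioms)
    show "open {z. 0 < Re z}" by (simp add: open_halfspace_Re_gt)
    show "(\<lambda>z. f (smult (spow \<rho> z) \<eta>) * cnj (ext \<eta> g)) holomorphic_on {z. 0 < Re z}"
      if "\<eta> \<in> space \<mu>" for \<eta>
      using that GA_holomorphic_char[OF f \<rho>] by (intro holomorphic_intros) auto
    show "cmod (f (smult (spow \<rho> z) \<eta>) * cnj (ext \<eta> g)) \<le> B"
      if "\<eta> \<in> space \<mu>" "z \<in> {z. 0 < Re z}" for \<eta> z
      using that B(2)[of "smult (spow \<rho> z) \<eta>"] spow_SC[OF \<rho>, of z] X_SC g by (simp add: norm_mult)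
    show "(\<lambda>\<eta>. f (smult (spow \<rho> z) \<eta>) * cnj (ext \<eta> g)) \<in> borel_measurable \<mu>"
      if "z \<in> {z. 0 < Re z}" for z
      using that spow_SC[OF \<rho>, of z] by (intro continuous_measurable continuous_proj_integrand fc g) auto
  qed
  moreover have "H (z + \<i> * of_real y) = exp (\<i> * of_real y * ?l) * H z" if "0 < Re z" for z y
  proof -
    \<comment> \<open>A purely imaginary power of \<rho> is a character, so the translation is an
      action of \<open>X\<close> and \<open>proj_smult\<close> gives the factor.\<close>
    have "spow \<rho> (z + \<i> * of_real y) = smult (spow \<rho> (\<i> * of_real y)) (spow \<rho> z)"
      by (simp only: spow_add[OF \<rho>] add.commute[of z])
    then have "H (z + \<i> * of_real y) = ext (spow \<rho> (\<i> * of_real y)) g * H z"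
      unfolding H_def using that by (simp add: proj_smult fc spow_SC \<rho> g spow_imaginary)
    then show ?thesis by (simp add: ext_spow \<rho> g)
  qed
  ultimately obtain C where C: "\<And>z. 0 < Re z \<Longrightarrow> H z = C * exp (z * ?l)"
    using exponential_if_imaginary_translation[of H ?l] by blast
  let ?t = "\<lambda>n. of_real (inverse (real (Suc n))) :: complex"
  have t0: "?t \<longlonglongrightarrow> of_real 0" by (intro tendsto_of_real LIMSEQ_inverse_real_of_nat)
  have "(\<lambda>n. spow \<rho> (?t n)) \<longlonglongrightarrow> spow \<rho> (of_real 0)"
    by (rule continuous_on_tendsto_compose[OF continuous_spow[OF \<rho>, of UNIV] t0]) auto
  then have "(\<lambda>n. H (?t n)) \<longlonglongrightarrow> proj f g onec"
    unfolding H_def using \<rho> X_SC by (intro proj_LIMSEQ fc g spow_SC) auto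
  moreover have "(\<lambda>n. C * exp (?t n * ?l)) \<longlonglongrightarrow> C * exp (of_real 0 * ?l)"
    by (intro tendsto_intros t0)
  ultimately have "fhat f g = C"
    using C by (simp add: LIMSEQ_unique proj_onec)
  then show ?thesis using C[OF z] by (simp add: H_def)
qed

text \<open>Multiplication by \<open>eps\<close> sends every character to \<open>eps\<close>, so the
  integrand is the constant \<open>f eps\<close> times a conjugated character.\<close>

lemma proj_eps:
  assumes "g \<in> carrier G" shows "proj f g eps = (if g = \<one> then f eps else 0)"
proof -
  have "proj f g eps = (\<integral>\<eta>. f eps * ext \<eta> (inv g) \<partial>\<mu>)"
    unfolding proj_def
    by (rule Bochner_Integration.integral_cong) (use assms X_SC in \<open>auto simp: smult_eps ext_cnj\<close>)
  also have "\<dots> = (if g = \<one> then f eps else 0)"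
    using assms integral_ext[of "inv g"] by (auto simp: inv_eq_1_iff)
  finally show ?thesis .
qed

lemma spow_tendsto_eps:
  assumes \<rho>: "\<rho> \<in> Pos" shows "(\<lambda>n. spow \<rho> (of_nat n)) \<longlonglongrightarrow> eps"
proof (rule tendsto_fun_componentwise)
  fix s
  show "(\<lambda>n. spow \<rho> (of_nat n) s) \<longlonglongrightarrow> eps s"
  proof (cases "s \<in> M \<and> s \<noteq> \<one>")
    case True
    have r: "cmod (\<rho> s) < 1" "cmod (\<rho> s) > 0"
      using True SC_less_one[OF Pos_SC[OF \<rho>] Pos_X[OF \<rho>]] Pos_apply(2)[OF \<rho>] by auto
    have "cmod (spow \<rho> (of_nat n) s) = cmod (\<rho> s) ^ n" for n
      using r True spow_cmod[OF \<rho>, of s "of_nat n"] by (simp add: powr_realpow)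
    then have "(\<lambda>n. cmod (spow \<rho> (of_nat n) s)) \<longlonglongrightarrow> 0"
      using r by (simp add: LIMSEQ_power_zero)
    then have "(\<lambda>n. spow \<rho> (of_nat n) s) \<longlonglongrightarrow> 0" by (rule tendsto_norm_zero_cancel)
    then show ?thesis using True by (simp add: eps_def)
  next
    case False
    have "spow \<rho> (of_nat n) s = eps s" for n
    proof (cases "s \<in> M")
      case True
      then have "s = \<one>" using False by blast
      then show ?thesis using SC_one[OF spow_SC[OF \<rho>, of "of_nat n"]] by (simp add: eps_def)
    next
      case False
      then show ?thesis by (simp add: eps_def semichar_power_def)
    qed
    then show ?thesis by simp
  qed
qed

lemma fhat_limit:
  assumes f: "GA f" and \<rho>: "\<rho> \<in> Pos" and g: "g \<in> carrier G"
  shows "(\<lambda>n. fhat f g * exp (of_nat n * of_real (ln (cmod (ext \<rho> g))))) \<longlonglongrightarrow>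
    (if g = \<one> then f eps else 0)"
proof -
  have "(\<lambda>n. proj f g (spow \<rho> (of_nat n))) \<longlonglongrightarrow> proj f g eps"
    using \<rho> by (intro proj_LIMSEQ GA_continuous f g spow_tendsto_eps spow_SC) auto
  moreover have "\<forall>\<^sub>F n in sequentially. proj f g (spow \<rho> (of_nat n))
      = fhat f g * exp (of_nat n * of_real (ln (cmod (ext \<rho> g))))"
    using eventually_gt_at_top[of 0] by eventually_elim (use proj_spow[OF f \<rho> g] in simp)
  ultimately show ?thesis
    unfolding proj_eps[OF g] by (rule Lim_transform_eventually)
qed

text \<open>If \<rho>(g) were at least 1 for some \<rho> in \<open>Pos\<close>, the moduli of the
  multiples of the coefficient by \<rho>(g)^n would stay at or above its own modulus, while for
  \<open>g \<noteq> \<one>\<close> they tend to 0.\<close>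

lemma fhat_support:
  assumes f: "GA f" and g: "g \<in> carrier G" and nz: "fhat f g \<noteq> 0" shows "g \<in> P"
proof (rule P_I[OF g])
  fix \<rho> assume \<rho>: "\<rho> \<in> Pos" and g1: "g \<noteq> \<one>"
  define l where "l = ln (cmod (ext \<rho> g))"
  have "(\<lambda>n. fhat f g * exp (of_nat n * of_real l)) \<longlonglongrightarrow> 0"
    using fhat_limit[OF f \<rho> g] g1 by (simp add: l_def)
  then have "(\<lambda>n. cmod (fhat f g * exp (of_nat n * of_real l))) \<longlonglongrightarrow> 0"
    by (rule tendsto_norm_zero)
  then have lim: "(\<lambda>n. cmod (fhat f g) * exp (real n * l)) \<longlonglongrightarrow> 0"
    by (simp add: norm_mult)
  have "l < 0"
  proof (rule ccontr)
    assume "\<not> l < 0"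
    then have "cmod (fhat f g) * 1 \<le> cmod (fhat f g) * exp (real n * l)" for n
      by (intro mult_left_mono) auto
    then have "cmod (fhat f g) * 1 \<le> 0" using lim by (intro LIMSEQ_le_const[OF lim]) blast
    with nz show False by simp
  qed
  then show "cmod (ext \<rho> g) < 1" using Pos_ext(2)[OF \<rho> g] by (simp add: l_def ln_less_zero_iff)
qed

lemma proj_eq:
  assumes f: "GA f" and g: "g \<in> carrier G" and \<psi>: "\<psi> \<in> SC"
  shows "proj f g \<psi> = fhat f g * ext \<psi> g"
  using \<psi>
proof (cases rule: SC_cases)
  case char
  have "proj f g (smult \<psi> onec) = ext \<psi> g * proj f g onec"
    using char X_SC by (intro proj_smult GA_continuous f g) auto
  then show ?thesis using \<psi> by (simp add: proj_onec)
next
  case (pos \<rho> \<eta>)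
  have e: "exp (1 * of_real (ln (cmod (ext \<rho> g)))) = ext \<rho> g"
    using ext_spow[OF pos(1) _ g, of 1] pos(1) by simp
  have "proj f g (smult \<eta> \<rho>) = ext \<eta> g * proj f g \<rho>"
    using pos(1,2) by (intro proj_smult GA_continuous f g) auto
  also have "proj f g \<rho> = fhat f g * ext \<rho> g"
    using proj_spow[OF f pos(1) g, of 1] pos(1) e by simp
  finally show ?thesis
    unfolding pos(3) using pos(1,2) X_SC g by (simp add: ext_smult smult_commute[of \<eta>])
next
  case van
  show ?thesis
  proof (cases "g = \<one>")
    case False
    then have "ext \<psi> g = 0" using ext_eps[OF g _ \<psi>] van by blast
    then show ?thesis using False van(1) proj_eps[OF g, of f] by simp
  next
    case True
    \<comment> \<open>An element at which the semicharacter vanishes is not \<open>\<one>\<close>,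
      so it provides a \<rho> in \<open>Pos\<close>. At \<open>\<one>\<close> the sequence in
      \<open>fhat_limit\<close> is constant, which identifies the mean of \<open>f\<close> over
      \<open>X\<close> with \<open>f eps\<close>.\<close>
    obtain s where "s \<in> M" "\<psi> s = 0" using van(2) unfolding nonvan_def by blast
    moreover from this have "s \<noteq> \<one>" using SC_one[OF \<psi>] by auto
    ultimately obtain \<rho> where \<rho>: "\<rho> \<in> Pos" using Pos_exists by blast
    have "(\<lambda>n. fhat f g) \<longlonglongrightarrow> f eps" using fhat_limit[OF f \<rho> g] True by simp
    then have "fhat f g = f eps" using LIMSEQ_unique tendsto_const by blast
    then show ?thesis using True van(1) proj_eps[OF g, of f] by simp
  qed
qed

text \<open>Each \<open>g\<close> in \<open>P\<close> occurs as a frequency, namely of the function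
  \<psi> \<mapsto> \<open>ext \<psi> g\<close>, and \<open>P\<close> is closed under products, so
  generating adds nothing.\<close>

lemma spectral_semigroup_eq: "spectral_semigroup S G \<mu> = G\<lparr>carrier := P\<rparr>"
proof -
  have "(\<Union>f\<in>boundary_algebra S. fourier_support S G \<mu> f) = P"
  proof (intro equalityI subsetI)
    fix g assume "g \<in> (\<Union>f\<in>boundary_algebra S. fourier_support S G \<mu> f)"
    then obtain f where "f \<in> gen_analytic_algebra S" "g \<in> fourier_support S G \<mu> (restrict f X)"
      unfolding boundary_algebra_def by blast
    then show "g \<in> P"
      using fhat_support[of f g] fourier_transform_eq[of g f] by (auto simp: GA_iff fourier_support_def)
  next
    fix g assume g: "g \<in> P"
    let ?f = "restrict (\<lambda>\<psi>. ext \<psi> g) SC"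
    have f: "?f \<in> gen_analytic_algebra S" unfolding restrict_GA by (rule GA_ext[OF g])
    have "fhat ?f g = (\<integral>\<eta>. ext \<eta> g * cnj (ext \<eta> g) \<partial>\<mu>)"
      unfolding fhat_def by (rule Bochner_Integration.integral_cong) (use X_SC in auto)
    also have "\<dots> = 1" using integral_ext_cnj[of g g] g by simp
    finally have "g \<in> fourier_support S G \<mu> (restrict ?f X)"
      using fourier_transform_eq[OF P_carrier[OF g], of ?f] P_carrier[OF g]
      unfolding fourier_support_def by (metis (mono_tags, lifting) mem_Collect_eq zero_neq_one)
    moreover have "restrict ?f X \<in> boundary_algebra S"
      unfolding boundary_algebra_def using f by blast
    ultimately show "g \<in> (\<Union>f\<in>boundary_algebra S. fourier_support S G \<mu> f)" by blast
  qed
  moreover have "generated_subsemigroup G P = P"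
  proof -
    have "subsemigroup G P" by (auto simp: subsemigroup_def)
    then show ?thesis unfolding generated_subsemigroup_def by blast
  qed
  ultimately show ?thesis by (simp add: spectral_semigroup_def)
qed

end

section \<open>Approximation by polynomials\<close>

context no_nontrivial_prime_ideals_haar
begin

lemma invc_invc: "\<eta> \<in> X \<Longrightarrow> invc (invc \<eta>) = \<eta>"
  by (rule extensionalityI[of _ M]) (auto simp: invc_def SC_ext X_SC)

text \<open>By compactness finitely many translates of a nonempty open set cover \<open>X\<close>.
  They all have the same measure, which cannot be 0 as \<open>X\<close> has measure 1.\<close>

lemma emeasure_open_nonzero:
  assumes Y: "openin (top_of_set X) Y" "Y \<noteq> {}" shows "emeasure \<mu> Y \<noteq> 0"
proof
  assume 0: "emeasure \<mu> Y = 0"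
  have YX: "Y \<subseteq> X" using openin_imp_subset[OF Y(1)] .
  have op: "openin (top_of_set X) (smult \<eta> ` Y)" if \<eta>: "\<eta> \<in> X" for \<eta>
  proof -
    have "openin (top_of_set X) (X \<inter> smult (invc \<eta>) -` Y)"
      using \<eta> by (intro continuous_openin_preimage[OF continuous_smult_const _ Y(1)]) auto
    then show ?thesis using smult_vimage[OF invc_X[OF \<eta>] YX] by (simp add: invc_invc[OF \<eta>] Int_commute)
  qed
  obtain y where y: "y \<in> Y" using Y by blast
  have "X \<subseteq> \<Union>((\<lambda>\<eta>. smult \<eta> ` Y) ` X)"
  proof
    fix x assume x: "x \<in> X"
    have "x = smult (smult x (invc y)) y"
      using x y YX X_SC by (simp add: smult_assoc subset_iff)
    moreover have "smult x (invc y) \<in> X" using x y YX by auto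
    ultimately show "x \<in> \<Union>((\<lambda>\<eta>. smult \<eta> ` Y) ` X)" using y by blast
  qed
  then obtain D where D: "D \<subseteq> (\<lambda>\<eta>. smult \<eta> ` Y) ` X" "finite D" "X \<subseteq> \<Union>D"
    using compact_X op unfolding compact_eq_openin_cover
    by (metis (no_types, lifting) imageE)
  have "A \<in> null_sets \<mu>" if A: "A \<in> D" for A
  proof -
    obtain \<eta> where \<eta>: "\<eta> \<in> X" "A = smult \<eta> ` Y" using D A by blast
    then have "emeasure \<mu> A = 0" using haar_invariant[OF \<eta>(1) openin_sets[OF Y(1)]] 0 by simp
    then show ?thesis using openin_sets[OF op[OF \<eta>(1)]] \<eta> by auto
  qed
  then have N: "(\<Union>A\<in>D. A) \<in> null_sets \<mu>" using D(2) by (intro null_sets.finite_UN) auto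
  then have "emeasure \<mu> X \<le> emeasure \<mu> (\<Union>A\<in>D. A)" using D(3) by (intro emeasure_mono) auto
  also have "\<dots> = 0" using N by (rule null_setsD1)
  finally show False by (simp add: emeasure_haar)
qed

text \<open>The values are conjugated to match the integrand of \<open>proj\<close>: integrating a
  translate of \<open>f\<close> against such a function gives a combination of projections.\<close>

definition trig_poly :: "(('a \<Rightarrow> complex) \<Rightarrow> complex) \<Rightarrow> bool" where
  "trig_poly \<phi> \<longleftrightarrow> (\<exists>ks. snd ` set ks \<subseteq> carrier G \<and> (\<forall>\<eta>\<in>X. \<phi> \<eta> = peval ks (\<lambda>g. cnj (ext \<eta> g))))"

lemma trig_poly_term: "g \<in> carrier G \<Longrightarrow> trig_poly (\<lambda>\<eta>. c * ext \<eta> g)"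
  unfolding trig_poly_def
  by (rule exI[of _ "[(c, inv g)]"]) (auto simp: ext_cnj)

lemma trig_poly_const: "trig_poly (\<lambda>\<eta>. c)"
  using trig_poly_term[of \<one> c] by simp

lemma trig_poly_add:
  assumes "trig_poly \<phi>" "trig_poly \<theta>" shows "trig_poly (\<lambda>\<eta>. \<phi> \<eta> + \<theta> \<eta>)"
proof -
  obtain ks ls where "snd ` set ks \<subseteq> carrier G" "\<forall>\<eta>\<in>X. \<phi> \<eta> = peval ks (\<lambda>g. cnj (ext \<eta> g))"
    "snd ` set ls \<subseteq> carrier G" "\<forall>\<eta>\<in>X. \<theta> \<eta> = peval ls (\<lambda>g. cnj (ext \<eta> g))"
    using assms unfolding trig_poly_def by blast
  then show ?thesis unfolding trig_poly_def by (intro exI[of _ "ks @ ls"]) auto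
qed

lemma trig_poly_mult:
  assumes "trig_poly \<phi>" "trig_poly \<theta>" shows "trig_poly (\<lambda>\<eta>. \<phi> \<eta> * \<theta> \<eta>)"
proof -
  obtain ks ls where *: "snd ` set ks \<subseteq> carrier G" "\<forall>\<eta>\<in>X. \<phi> \<eta> = peval ks (\<lambda>g. cnj (ext \<eta> g))"
    "snd ` set ls \<subseteq> carrier G" "\<forall>\<eta>\<in>X. \<theta> \<eta> = peval ls (\<lambda>g. cnj (ext \<eta> g))"
    using assms unfolding trig_poly_def by blast
  have "peval (pmul G ks ls) (\<lambda>g. cnj (ext \<eta> g))
      = peval ks (\<lambda>g. cnj (ext \<eta> g)) * peval ls (\<lambda>g. cnj (ext \<eta> g))" if "\<eta> \<in> X" for \<eta>
    by (rule peval_pmul[where P = "carrier G"]) (use * that X_SC X_nonvan in \<open>auto simp: ext_mult\<close>)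
  moreover have "snd ` set (pmul G ks ls) \<subseteq> carrier G"
    unfolding snd_pmul using *(1,3) by auto
  ultimately show ?thesis using * unfolding trig_poly_def by (intro exI[of _ "pmul G ks ls"]) simp
qed

lemma trig_poly_prod:
  assumes "finite I" "\<And>s. s \<in> I \<Longrightarrow> trig_poly (\<phi> s)" shows "trig_poly (\<lambda>\<eta>. \<Prod>s\<in>I. \<phi> s \<eta>)"
  using assms by (induction I) (auto intro: trig_poly_const trig_poly_mult)

lemma trig_poly_power: "trig_poly \<phi> \<Longrightarrow> trig_poly (\<lambda>\<eta>. \<phi> \<eta> ^ n)"
  by (induction n) (auto intro: trig_poly_const trig_poly_mult)

lemma trig_poly_cong: "trig_poly \<phi> \<Longrightarrow> (\<And>\<eta>. \<eta> \<in> X \<Longrightarrow> \<phi> \<eta> = \<theta> \<eta>) \<Longrightarrow> trig_poly \<theta>"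
  unfolding trig_poly_def by metis

lemma onec_neighbourhood:
  assumes "open U" "onec \<in> U"
  obtains I \<delta> where "finite I" "I \<subseteq> M" "\<delta> > 0"
    "\<And>\<eta>. \<eta> \<in> X \<Longrightarrow> (\<And>s. s \<in> I \<Longrightarrow> cmod (\<eta> s - 1) < \<delta>) \<Longrightarrow> \<eta> \<in> U"
proof -
  have "openin (product_topology (\<lambda>i. euclidean) UNIV) U"
    using assms(1) by (simp add: euclidean_product_topology)
  from product_topology_open_contains_basis[OF this assms(2)]
  obtain V where V: "onec \<in> Pi\<^sub>E UNIV V" "\<And>i. open (V i)" "finite {i. V i \<noteq> UNIV}" "Pi\<^sub>E UNIV V \<subseteq> U"
    by auto
  define I where "I = {i. V i \<noteq> UNIV} \<inter> M"
  have V1: "onec i \<in> V i" for i using V(1) by (auto simp: PiE_iff)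
  have "\<exists>d>0. ball 1 d \<subseteq> V s" if "s \<in> M" for s
    using V(2)[of s] V1[of s] that open_contains_ball by (auto simp: onec_def)
  then obtain d where d: "\<And>s. s \<in> M \<Longrightarrow> d s > 0" "\<And>s. s \<in> M \<Longrightarrow> ball 1 (d s) \<subseteq> V s" by metis
  \<comment> \<open>The extra element 1 keeps the minimum meaningful when \<open>I\<close> is
    empty.\<close>
  define \<delta> where "\<delta> = Min (insert 1 (d ` I))"
  have fin: "finite I" using V(3) by (simp add: I_def)
  have \<delta>: "\<delta> > 0" "\<And>s. s \<in> I \<Longrightarrow> \<delta> \<le> d s"
    using fin d(1) by (auto simp: \<delta>_def I_def)
  show ?thesis
  proof (rule that[OF fin _ \<delta>(1)])
    show "I \<subseteq> M" by (simp add: I_def)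
    fix \<eta> assume \<eta>: "\<eta> \<in> X" and close: "\<And>s. s \<in> I \<Longrightarrow> cmod (\<eta> s - 1) < \<delta>"
    have "\<eta> i \<in> V i" for i
    proof (cases "i \<in> M")
      case False
      then have "\<eta> i = onec i"
        using extensional_arb[OF SC_ext[OF X_SC[OF \<eta>]]] by (simp add: onec_def)
      then show ?thesis using V1 by simp
    next
      case True
      show ?thesis
      proof (cases "V i = UNIV")
        case False
        then have "i \<in> I" using True by (simp add: I_def)
        then have "\<eta> i \<in> ball 1 (d i)"
          using close[of i] \<delta>(2)[of i] by (simp add: dist_norm norm_minus_commute)
        then show ?thesis using d(2)[OF True] by blast
      qed simp
    qed
    then show "\<eta> \<in> U" using V(4) by (auto simp: PiE_iff)
  qed
qed

text \<open>The kernel is a normalized high power of the product of the functions \<open>(1 + Re \<eta>(s)) / 2\<close>.\<close>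

lemma concentrated_kernel:
  assumes I: "finite I" "I \<subseteq> M" and \<delta>: "\<delta> > 0" and e: "e > 0"
  obtains K :: "('a \<Rightarrow> complex) \<Rightarrow> real" where
    "\<And>\<eta>. \<eta> \<in> X \<Longrightarrow> 0 \<le> K \<eta>" "continuous_on X K" "(\<integral>\<eta>. K \<eta> \<partial>\<mu>) = 1"
    "\<And>\<eta> s. \<eta> \<in> X \<Longrightarrow> s \<in> I \<Longrightarrow> \<delta> \<le> cmod (\<eta> s - 1) \<Longrightarrow> K \<eta> \<le> e"
    "trig_poly (\<lambda>\<eta>. of_real (K \<eta>))"
proof -
  define w where "w \<eta> s = (1 + Re (\<eta> s)) / 2" for \<eta> :: "'a \<Rightarrow> complex" and s
  define h where "h \<eta> = (\<Prod>s\<in>I. w \<eta> s)" for \<eta>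
  \<comment> \<open>For unimodular \<eta>(s) the square of |\<eta>(s) - 1| is 2 - 2 Re \<eta>(s), so
    at distance at least \<delta> the factor \<open>w\<close> is at most 1 - \<delta>^2/4. The
    maximum with 0 covers large \<delta>.\<close>
  define q where "q = max 0 (1 - \<delta>\<^sup>2 / 4)"
  \<comment> \<open>A level strictly between \<open>q\<close> and the value 1 of \<open>h\<close> at
    the trivial character: \<open>h\<close> exceeds it on an open set of positive measure
    \<open>m\<close>, so the integral of \<open>h ^ N\<close> is at least
    \<open>q' ^ N * m\<close>.\<close>
  define q' where "q' = (1 + q) / 2"
  have q: "0 \<le> q" "q < 1" "q < q'" "0 < q'" "q' < 1" using \<delta> by (auto simp: q_def q'_def)
  have w01: "0 \<le> w \<eta> s" "w \<eta> s \<le> 1" if "\<eta> \<in> X" "s \<in> I" for \<eta> s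
    using abs_Re_le_cmod[of "\<eta> s"] X_cmod[OF that(1), of s] that(2) I by (auto simp: w_def)
  have h01: "0 \<le> h \<eta>" if "\<eta> \<in> X" for \<eta>
    unfolding h_def using w01 that by (intro prod_nonneg) auto
  have hq: "h \<eta> \<le> q" if \<eta>: "\<eta> \<in> X" "s \<in> I" "\<delta> \<le> cmod (\<eta> s - 1)" for \<eta> s
  proof -
    have c1: "cmod (\<eta> s) = 1" using X_cmod \<eta> I by blast
    have "(cmod (\<eta> s - 1))\<^sup>2 = (Re (\<eta> s) - 1)\<^sup>2 + (Im (\<eta> s))\<^sup>2" by (simp add: cmod_power2)
    also have "\<dots> = (cmod (\<eta> s))\<^sup>2 + 1 - 2 * Re (\<eta> s)"
      unfolding cmod_power2 by (simp add: power2_eq_square algebra_simps)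
    finally have "(cmod (\<eta> s - 1))\<^sup>2 = 2 - 2 * Re (\<eta> s)" using c1 by simp
    moreover have "\<delta>\<^sup>2 \<le> (cmod (\<eta> s - 1))\<^sup>2" using \<eta>(3) \<delta> by (intro power_mono) auto
    ultimately have "w \<eta> s \<le> 1 - \<delta>\<^sup>2 / 4" by (simp add: w_def)
    moreover have "h \<eta> = w \<eta> s * (\<Prod>t\<in>I - {s}. w \<eta> t)"
      unfolding h_def using I(1) \<eta>(2) by (rule prod.remove)
    moreover have "(\<Prod>t\<in>I - {s}. w \<eta> t) \<le> 1" using w01 \<eta>(1) by (intro prod_le_1) auto
    then have "w \<eta> s * (\<Prod>t\<in>I - {s}. w \<eta> t) \<le> w \<eta> s * 1"
      using w01[OF \<eta>(1,2)] by (intro mult_left_mono) auto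
    ultimately show ?thesis by (simp add: q_def)
  qed
  have hc: "continuous_on X h" unfolding h_def w_def by (intro continuous_intros) auto
  define Y where "Y = X \<inter> h -` {q'<..}"
  have Yop: "openin (top_of_set X) Y"
    unfolding Y_def by (rule continuous_openin_preimage_gen[OF hc]) simp
  have "h onec = 1" using I by (simp add: h_def w_def onec_def subset_iff)
  then have "onec \<in> Y" using q by (simp add: Y_def)
  then have "emeasure \<mu> Y \<noteq> 0" using emeasure_open_nonzero[OF Yop] by blast
  then have m: "measure \<mu> Y > 0" by (simp add: emeasure_eq_measure less_le)
  define m where "m = measure \<mu> Y"
  have "q / q' < 1" using q by simp
  \<comment> \<open>After normalization the kernel is at most \<open>q ^ N / (q' ^ N * m)\<close>
    where some \<eta>(s) is at distance at least \<delta> from 1; this \<open>N\<close> brings it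
    below \<open>e\<close>.\<close>
  then obtain N where N: "(q / q') ^ N < e * m"
    using real_arch_pow_inv[of "e * m" "q / q'"] e m by (auto simp: m_def)
  define c where "c = (\<integral>\<eta>. h \<eta> ^ N \<partial>\<mu>)"
  have hNint: "integrable \<mu> (\<lambda>\<eta>. h \<eta> ^ N)" by (intro continuous_integrable continuous_intros hc)
  have "q' ^ N * m = (\<integral>\<eta>. q' ^ N * indicator Y \<eta> \<partial>\<mu>)"
    using openin_sets[OF Yop] openin_imp_subset[OF Yop] by (simp add: m_def Int_absorb2)
  also have "\<dots> \<le> c"
    unfolding c_def
  proof (rule integral_mono[OF _ hNint])
    show "integrable \<mu> (\<lambda>\<eta>. q' ^ N * indicator Y \<eta>)"
      using openin_sets[OF Yop] by (simp add: emeasure_eq_measure)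
    fix \<eta> assume "\<eta> \<in> space \<mu>"
    then have \<eta>: "\<eta> \<in> X" by simp
    show "q' ^ N * indicator Y \<eta> \<le> h \<eta> ^ N"
    proof (cases "\<eta> \<in> Y")
      case True
      then have "q' ^ N \<le> h \<eta> ^ N" using q by (intro power_mono) (auto simp: Y_def)
      then show ?thesis using True by simp
    qed (use h01[OF \<eta>] in simp)
  qed
  finally have c: "q' ^ N * m \<le> c" .
  have "0 < q' ^ N * m" using q m by (simp add: m_def)
  with c have c0: "c > 0" by linarith
  show ?thesis
  proof (rule that[of "\<lambda>\<eta>. h \<eta> ^ N / c"])
    show "0 \<le> h \<eta> ^ N / c" if "\<eta> \<in> X" for \<eta> using h01[OF that] c0 by simp
    show "continuous_on X (\<lambda>\<eta>. h \<eta> ^ N / c)" using c0 by (intro continuous_intros hc) auto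
    show "(\<integral>\<eta>. h \<eta> ^ N / c \<partial>\<mu>) = 1" using c0 by (simp add: c_def)
    show "h \<eta> ^ N / c \<le> e" if \<eta>: "\<eta> \<in> X" "s \<in> I" "\<delta> \<le> cmod (\<eta> s - 1)" for \<eta> s
    proof -
      have "h \<eta> ^ N \<le> q ^ N" using hq[OF \<eta>] h01[OF \<eta>(1)] by (intro power_mono) auto
      also have "\<dots> = (q / q') ^ N * q' ^ N" using q by (simp add: power_divide)
      also have "\<dots> \<le> (e * m) * q' ^ N" using N q by (intro mult_right_mono) auto
      also have "\<dots> \<le> e * c" using c e by (simp add: mult.assoc mult.commute[of m])
      finally show ?thesis using c0 by (simp add: divide_le_eq)
    qed
    have "trig_poly (\<lambda>\<eta>. of_real (w \<eta> s))" if s: "s \<in> I" for s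
    proof (rule trig_poly_cong)
      have sM: "s \<in> carrier G" using s I by auto
      show "trig_poly (\<lambda>\<eta>. 1/2 + (1/4 * ext \<eta> s + 1/4 * ext \<eta> (inv s)))"
        using sM by (intro trig_poly_add trig_poly_const trig_poly_term) auto
      fix \<eta> assume \<eta>: "\<eta> \<in> X"
      have "ext \<eta> s + cnj (ext \<eta> s) = of_real (2 * Re (\<eta> s))"
        using complex_add_cnj[of "\<eta> s"] \<eta> s I X_SC by (simp add: subset_iff)
      then show "1/2 + (1/4 * ext \<eta> s + 1/4 * ext \<eta> (inv s)) = of_real (w \<eta> s)"
        using ext_cnj[OF \<eta> sM] by (simp add: w_def field_simps)
    qed
    then have "trig_poly (\<lambda>\<eta>. of_real (1 / c) * (\<Prod>s\<in>I. of_real (w \<eta> s)) ^ N)"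
      using I by (intro trig_poly_mult trig_poly_const trig_poly_power trig_poly_prod)
    then show "trig_poly (\<lambda>\<eta>. of_real (h \<eta> ^ N / c))"
      by (rule trig_poly_cong) (simp add: h_def)
  qed
qed

text \<open>Term by term the integral is a projection, a multiple of \<open>ext \<psi> g\<close>.
  Terms with \<open>g\<close> outside \<open>P\<close> have coefficient 0 by
  \<open>fhat_support\<close> and are dropped from the list.\<close>

lemma integral_trig_poly:
  assumes f: "GA f" and ks: "snd ` set ks \<subseteq> carrier G"
  obtains xs where "snd ` set xs \<subseteq> P"
    "\<And>\<psi>. \<psi> \<in> SC \<Longrightarrow>
      (\<integral>\<eta>. f (smult \<psi> \<eta>) * peval ks (\<lambda>g. cnj (ext \<eta> g)) \<partial>\<mu>) = peval xs (ext \<psi>)"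
proof -
  have "\<exists>xs. snd ` set xs \<subseteq> P \<and> (\<forall>\<psi>\<in>SC.
      integrable \<mu> (\<lambda>\<eta>. f (smult \<psi> \<eta>) * peval ks (\<lambda>g. cnj (ext \<eta> g))) \<and>
      (\<integral>\<eta>. f (smult \<psi> \<eta>) * peval ks (\<lambda>g. cnj (ext \<eta> g)) \<partial>\<mu>) = peval xs (ext \<psi>))"
    using ks
  proof (induction ks)
    case Nil
    show ?case by (intro exI[of _ "[]"]) auto
  next
    case (Cons k ks)
    obtain c g where k: "k = (c, g)" by (cases k)
    have g: "g \<in> carrier G" using Cons.prems k by simp
    obtain xs where xs: "snd ` set xs \<subseteq> P"
      "\<And>\<psi>. \<psi> \<in> SC \<Longrightarrow> integrable \<mu> (\<lambda>\<eta>. f (smult \<psi> \<eta>) * peval ks (\<lambda>g. cnj (ext \<eta> g)))"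
      "\<And>\<psi>. \<psi> \<in> SC \<Longrightarrow>
        (\<integral>\<eta>. f (smult \<psi> \<eta>) * peval ks (\<lambda>g. cnj (ext \<eta> g)) \<partial>\<mu>) = peval xs (ext \<psi>)"
      using Cons by auto
    define ys where "ys = (if g \<in> P then [(c * fhat f g, g)] else [])"
    have int: "integrable \<mu> (\<lambda>\<eta>. f (smult \<psi> \<eta>) * cnj (ext \<eta> g))" if "\<psi> \<in> SC" for \<psi>
      by (intro continuous_integrable continuous_proj_integrand GA_continuous f g that)
    have ys: "c * proj f g \<psi> = peval ys (ext \<psi>)" if "\<psi> \<in> SC" for \<psi>
      using proj_eq[OF f g that] fhat_support[OF f g] by (auto simp: ys_def)
    have split: "(\<lambda>\<eta>. f (smult \<psi> \<eta>) * peval (k # ks) (\<lambda>g. cnj (ext \<eta> g)))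
      = (\<lambda>\<eta>. c * (f (smult \<psi> \<eta>) * cnj (ext \<eta> g)) + f (smult \<psi> \<eta>) * peval ks (\<lambda>g. cnj (ext \<eta> g)))" for \<psi>
      by (auto simp: k algebra_simps)
    show ?case
    proof (intro exI[of _ "ys @ xs"] conjI ballI)
      show "snd ` set (ys @ xs) \<subseteq> P" using xs(1) by (auto simp: ys_def)
      fix \<psi> assume \<psi>: "\<psi> \<in> SC"
      show "integrable \<mu> (\<lambda>\<eta>. f (smult \<psi> \<eta>) * peval (k # ks) (\<lambda>g. cnj (ext \<eta> g)))"
        unfolding split using int[OF \<psi>] xs(2)[OF \<psi>] by simp
      show "(\<integral>\<eta>. f (smult \<psi> \<eta>) * peval (k # ks) (\<lambda>g. cnj (ext \<eta> g)) \<partial>\<mu>) = peval (ys @ xs) (ext \<psi>)"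
        unfolding split using int[OF \<psi>] xs(2,3)[OF \<psi>] ys[OF \<psi>]
        by (simp add: proj_def)
    qed
  qed
  then show ?thesis using that by blast
qed

text \<open>The approximant is the average of \<open>f\<close> over translates by characters,
  weighted with a kernel of integral 1. Close to the trivial character the translates are close to
  \<open>f\<close>; elsewhere the kernel is small. As the kernel is a trigonometric polynomial, the
  average is a polynomial over \<open>P\<close>.\<close>

lemma polynomial_approximation:
  assumes f: "GA f" and e: "e > 0"
  obtains xs where "snd ` set xs \<subseteq> P" "\<And>\<psi>. \<psi> \<in> SC \<Longrightarrow> cmod (f \<psi> - peval xs (ext \<psi>)) < e"
proof -
  have fc: "continuous_on SC f" by (rule GA_continuous[OF f])
  obtain B where B: "0 \<le> B" "\<And>\<psi>. \<psi> \<in> SC \<Longrightarrow> cmod (f \<psi>) \<le> B" using bounded_on_SC[OF fc] by blast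
  have c: "continuous_on (X \<times> SC) (\<lambda>p. f (smult (fst p) (snd p)))"
    by (rule continuous_on_compose2[OF fc])
      (use X_SC in \<open>auto intro!: continuous_smult continuous_on_fst continuous_on_snd continuous_on_id\<close>)
  have "e / 4 > 0" using e by simp
  \<comment> \<open>Compactness of \<open>SC\<close> gives one neighbourhood of the trivial
    character that works for all \<psi> simultaneously.\<close>
  from continuous_on_prod_compactE[OF c compact_SC onec_X this]
  obtain U where U: "onec \<in> U" "open U"
    "\<forall>\<eta>\<in>U \<inter> X. \<forall>\<psi>\<in>SC. dist (f (smult \<eta> \<psi>)) (f (smult onec \<psi>)) \<le> e / 4"
    unfolding fst_conv snd_conv by metis
  obtain I \<delta> where I: "finite I" "I \<subseteq> M" "\<delta> > 0"
    "\<And>\<eta>. \<eta> \<in> X \<Longrightarrow> (\<And>s. s \<in> I \<Longrightarrow> cmod (\<eta> s - 1) < \<delta>) \<Longrightarrow> \<eta> \<in> U"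
    using onec_neighbourhood[OF U(2,1)] by blast
  \<comment> \<open>Off the neighbourhood the difference of two values of \<open>f\<close> is at
    most \<open>2 * B\<close>, so this height of the kernel contributes at most
    \<open>e / 4\<close>; the denominator uses \<open>B + 1\<close> in case
    \<open>B = 0\<close>.\<close>
  define e' where "e' = e / (8 * (B + 1))"
  have e': "e' > 0" "2 * B * e' \<le> e / 4" using e B(1) by (auto simp: e'_def field_simps)
  obtain K where K: "\<And>\<eta>. \<eta> \<in> X \<Longrightarrow> 0 \<le> K \<eta>" "continuous_on X K" "(\<integral>\<eta>. K \<eta> \<partial>\<mu>) = 1"
    "\<And>\<eta> s. \<eta> \<in> X \<Longrightarrow> s \<in> I \<Longrightarrow> \<delta> \<le> cmod (\<eta> s - 1) \<Longrightarrow> K \<eta> \<le> e'"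
    "trig_poly (\<lambda>\<eta>. of_real (K \<eta>))"
    using concentrated_kernel[OF I(1-3) e'(1)] by blast
  obtain ks where ks: "snd ` set ks \<subseteq> carrier G"
    "\<And>\<eta>. \<eta> \<in> X \<Longrightarrow> of_real (K \<eta>) = peval ks (\<lambda>g. cnj (ext \<eta> g))"
    using K(5) unfolding trig_poly_def by blast
  obtain xs where xs: "snd ` set xs \<subseteq> P" "\<And>\<psi>. \<psi> \<in> SC \<Longrightarrow>
      (\<integral>\<eta>. f (smult \<psi> \<eta>) * peval ks (\<lambda>g. cnj (ext \<eta> g)) \<partial>\<mu>) = peval xs (ext \<psi>)"
    using integral_trig_poly[OF f ks(1)] by blast
  show ?thesis
  proof (rule that[OF xs(1)])
    fix \<psi> assume \<psi>: "\<psi> \<in> SC"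
    have Kc: "continuous_on X (\<lambda>\<eta>. complex_of_real (K \<eta>))" by (intro continuous_intros K)
    have fK: "integrable \<mu> (\<lambda>\<eta>. f (smult \<psi> \<eta>) * of_real (K \<eta>))"
      by (intro continuous_integrable continuous_on_mult continuous_translate fc \<psi> Kc)
    have fK': "integrable \<mu> (\<lambda>\<eta>. f \<psi> * of_real (K \<eta>))"
      by (intro continuous_integrable continuous_on_mult continuous_on_const Kc)
    have "peval xs (ext \<psi>) = (\<integral>\<eta>. f (smult \<psi> \<eta>) * of_real (K \<eta>) \<partial>\<mu>)"
      unfolding xs(2)[OF \<psi>, symmetric]
      by (rule Bochner_Integration.integral_cong) (use ks(2) in auto)
    moreover have "f \<psi> = (\<integral>\<eta>. f \<psi> * of_real (K \<eta>) \<partial>\<mu>)"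
      using K(3) by simp
    ultimately have "f \<psi> - peval xs (ext \<psi>) =
        (\<integral>\<eta>. f \<psi> * of_real (K \<eta>) - f (smult \<psi> \<eta>) * of_real (K \<eta>) \<partial>\<mu>)"
      using Bochner_Integration.integral_diff[OF fK' fK] by simp
    also have "cmod \<dots> \<le> (\<integral>\<eta>. cmod (f \<psi> * of_real (K \<eta>) - f (smult \<psi> \<eta>) * of_real (K \<eta>)) \<partial>\<mu>)"
      by (rule integral_norm_bound)
    also have "\<dots> \<le> (\<integral>\<eta>. e / 4 * K \<eta> + 2 * B * e' \<partial>\<mu>)"
    proof (rule integral_mono)
      show "integrable \<mu> (\<lambda>\<eta>. cmod (f \<psi> * of_real (K \<eta>) - f (smult \<psi> \<eta>) * of_real (K \<eta>)))"
        using fK fK' by (intro integrable_norm Bochner_Integration.integrable_diff)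
      show "integrable \<mu> (\<lambda>\<eta>. e / 4 * K \<eta> + 2 * B * e')"
        by (intro continuous_integrable continuous_intros K)
      fix \<eta> assume "\<eta> \<in> space \<mu>"
      then have \<eta>: "\<eta> \<in> X" by simp
      have "f \<psi> * of_real (K \<eta>) - f (smult \<psi> \<eta>) * of_real (K \<eta>) = (f \<psi> - f (smult \<psi> \<eta>)) * of_real (K \<eta>)"
        by (simp add: algebra_simps)
      then have n: "cmod (f \<psi> * of_real (K \<eta>) - f (smult \<psi> \<eta>) * of_real (K \<eta>))
        = cmod (f \<psi> - f (smult \<psi> \<eta>)) * K \<eta>"
        using K(1)[OF \<eta>] by (simp add: norm_mult)
      show "cmod (f \<psi> * of_real (K \<eta>) - f (smult \<psi> \<eta>) * of_real (K \<eta>)) \<le> e / 4 * K \<eta> + 2 * B * e'"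
      proof (cases "\<eta> \<in> U")
        case True
        have "dist (f (smult \<eta> \<psi>)) (f (smult onec \<psi>)) \<le> e / 4" using U(3) True \<eta> \<psi> by blast
        then have "cmod (f \<psi> - f (smult \<psi> \<eta>)) \<le> e / 4"
          using \<psi> by (simp add: dist_norm norm_minus_commute smult_commute[of \<eta>])
        then have "cmod (f \<psi> - f (smult \<psi> \<eta>)) * K \<eta> \<le> e / 4 * K \<eta>"
          using K(1)[OF \<eta>] by (intro mult_right_mono)
        moreover have "0 \<le> 2 * B * e'" using B(1) e' by simp
        ultimately show ?thesis unfolding n by linarith
      next
        case False
        then obtain s where "s \<in> I" "\<not> cmod (\<eta> s - 1) < \<delta>" using I(4)[OF \<eta>] by blast
        then have Ke: "K \<eta> \<le> e'" using K(4)[OF \<eta>] by simp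
        have "cmod (f \<psi> - f (smult \<psi> \<eta>)) \<le> 2 * B"
          using norm_triangle_ineq4[of "f \<psi>" "f (smult \<psi> \<eta>)"] B(2)[OF \<psi>]
            B(2)[of "smult \<psi> \<eta>"] \<psi> X_SC[OF \<eta>] by simp
        then have "cmod (f \<psi> - f (smult \<psi> \<eta>)) * K \<eta> \<le> 2 * B * e'"
          using Ke K(1)[OF \<eta>] B(1) by (intro mult_mono) auto
        moreover have "0 \<le> e / 4 * K \<eta>" using K(1)[OF \<eta>] e by simp
        ultimately show ?thesis unfolding n by linarith
      qed
    qed
    also have "\<dots> = (\<integral>\<eta>. e / 4 * K \<eta> \<partial>\<mu>) + (\<integral>\<eta>. 2 * B * e' \<partial>\<mu>)"
      by (intro Bochner_Integration.integral_add continuous_integrable continuous_intros K)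
    also have "\<dots> = e / 4 + 2 * B * e'" using K(3) by simp
    also have "\<dots> < e" using e' e by linarith
    finally show "cmod (f \<psi> - peval xs (ext \<psi>)) < e" .
  qed
qed

end

section \<open>The Arens-Singer algebra and the Gelfand spectrum\<close>

lemma peval_cong: "(\<And>g. g \<in> snd ` set xs \<Longrightarrow> \<xi> g = \<zeta> g) \<Longrightarrow> peval xs \<xi> = peval xs \<zeta>"
  by (induction xs) auto

lemma le_sup_norm:
  assumes "compact K" "continuous_on K f" "x \<in> K"
  shows "cmod (f x) \<le> sup_norm K f"
proof -
  have "compact ((\<lambda>x. cmod (f x)) ` K)"
    using assms by (intro compact_continuous_image continuous_intros)
  then have "bdd_above ((\<lambda>x. cmod (f x)) ` K)"
    by (simp add: bounded_imp_bdd_above compact_imp_bounded)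
  then show ?thesis unfolding sup_norm_def using assms(3) by (rule cSUP_upper[rotated])
qed

lemma sup_norm_le: "K \<noteq> {} \<Longrightarrow> (\<And>x. x \<in> K \<Longrightarrow> cmod (f x) \<le> B) \<Longrightarrow> sup_norm K f \<le> B"
  unfolding sup_norm_def by (rule cSUP_least)

context no_nontrivial_prime_ideals_haar
begin

section \<open>Semicharacters of the spectral semigroup\<close>

definition S1 :: "'a monoid" where "S1 = G\<lparr>carrier := P\<rparr>"

abbreviation "SC1 \<equiv> semicharacters S1"
abbreviation "GAlg \<equiv> gen_analytic_algebra S"

lemma S1_simps [simp]: "carrier S1 = P" "\<one>\<^bsub>S1\<^esub> = \<one>" "x \<otimes>\<^bsub>S1\<^esub> y = x \<otimes> y"
  by (simp_all add: S1_def)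

lemma SC1_mult: "\<xi> \<in> SC1 \<Longrightarrow> g \<in> P \<Longrightarrow> h \<in> P \<Longrightarrow> \<xi> (g \<otimes> h) = \<xi> g * \<xi> h"
  and SC1_le: "\<xi> \<in> SC1 \<Longrightarrow> g \<in> P \<Longrightarrow> cmod (\<xi> g) \<le> 1"
  and SC1_ext: "\<xi> \<in> SC1 \<Longrightarrow> \<xi> \<in> extensional P"
  by (auto simp: semicharacters_def)

lemma SC1_one:
  assumes "\<xi> \<in> SC1" shows "\<xi> \<one> = 1"
proof -
  obtain s where s: "s \<in> P" "\<xi> s \<noteq> 0" using assms by (auto simp: semicharacters_def)
  then show ?thesis using SC1_mult[OF assms one_P s(1)] by simp
qed

lemma SC1_I:
  assumes "\<xi> \<in> extensional P" "\<And>g. g \<in> P \<Longrightarrow> cmod (\<xi> g) \<le> 1"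
    "\<And>g h. g \<in> P \<Longrightarrow> h \<in> P \<Longrightarrow> \<xi> (g \<otimes> h) = \<xi> g * \<xi> h" "\<xi> \<one> = 1"
  shows "\<xi> \<in> SC1"
  using assms by (auto simp: semicharacters_def intro!: bexI[of _ \<one>])

lemma compact_SC1: "compact SC1"
  by (rule compact_semicharacters) auto

definition E :: "('a \<Rightarrow> complex) \<Rightarrow> 'a \<Rightarrow> complex" where
  "E \<psi> = restrict (ext \<psi>) P"

lemma E_SC1: "\<psi> \<in> SC \<Longrightarrow> E \<psi> \<in> SC1"
  by (rule SC1_I) (auto simp: E_def ext_P_le ext_P_mult)

lemma SC1_nonempty: "SC1 \<noteq> {}"
  using E_SC1[OF eps_SC] by blast

lemma M_in_P: "s \<in> M \<Longrightarrow> s \<in> P"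
  using M_P by blast

lemma restrict_E: "\<psi> \<in> SC \<Longrightarrow> restrict (E \<psi>) M = \<psi>"
  by (rule extensionalityI[of _ M]) (auto simp: SC_ext E_def M_in_P)

lemma restrict_SC: "\<xi> \<in> SC1 \<Longrightarrow> restrict \<xi> M \<in> SC"
  by (rule SC_I) (auto simp: SC1_le SC1_mult SC1_one M_in_P)

lemma E_smult: "\<psi> \<in> SC \<Longrightarrow> \<phi> \<in> SC \<Longrightarrow> semichar_mult S1 (E \<psi>) (E \<phi>) = E (smult \<psi> \<phi>)"
  by (rule extensionalityI[of _ P]) (auto simp: semichar_mult_def[of S1] E_def ext_smult)

lemma continuous_E: "continuous_on SC E"
proof (rule continuous_on_coordinatewise_then_product)
  fix g
  show "continuous_on SC (\<lambda>\<psi>. E \<psi> g)"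
    by (cases "g \<in> P") (simp_all add: E_def continuous_ext)
qed

lemma continuous_restrict: "continuous_on A (\<lambda>\<xi>. restrict \<xi> M :: 'a \<Rightarrow> complex)"
proof (rule continuous_on_coordinatewise_then_product)
  fix s
  show "continuous_on A (\<lambda>\<xi>. restrict \<xi> M s :: complex)"
    by (cases "s \<in> M") (simp_all add: continuous_on_coordinate)
qed

lemma peval_E: "snd ` set xs \<subseteq> P \<Longrightarrow> peval xs (E \<psi>) = peval xs (ext \<psi>)"
  by (rule peval_cong) (auto simp: E_def subset_iff)

lemma continuous_peval: "continuous_on A (\<lambda>\<xi>. peval xs \<xi>)"
proof (induction xs)
  case (Cons x xs)
  obtain c g where x: "x = (c, g)" by (cases x)
  show ?case unfolding x peval_Cons by (intro continuous_intros Cons.IH)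
qed simp

text \<open>The bound of the coefficients by the supremum over \<open>X\<close> feeds the power
  argument, so the characters of \<open>S\<close> already determine the norm of a polynomial on all
  of \<open>SC1\<close>.\<close>

lemma peval_SC1_le:
  assumes xs: "snd ` set xs \<subseteq> P" and B: "\<And>\<eta>. \<eta> \<in> X \<Longrightarrow> cmod (peval xs (ext \<eta>)) \<le> B"
    and \<xi>: "\<xi> \<in> SC1"
  shows "cmod (peval xs \<xi>) \<le> B"
proof (rule multiplicative_le_sup[where P = P and X = "ext ` X"])
  show "P \<subseteq> carrier G" by auto
  show "0 \<le> B" using B[OF onec_X] norm_ge_zero order_trans by blast
  show "cmod (coef xs g) \<le> b"
    if "snd ` set xs \<subseteq> P" "\<And>\<eta>. \<eta> \<in> ext ` X \<Longrightarrow> cmod (peval xs \<eta>) \<le> b" for xs b g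
    by (rule coef_le_sup) (use that in auto)
qed (use xs B \<xi> X_SC in \<open>auto simp: SC1_mult SC1_one SC1_le ext_P_mult\<close>)

section \<open>The Arens-Singer algebra as the uniform closure of the polynomials\<close>

definition AP :: "(('a \<Rightarrow> complex) \<Rightarrow> complex) set" where
  "AP = {F \<in> extensional SC1. continuous_on SC1 F \<and>
    (\<forall>e>0. \<exists>xs. snd ` set xs \<subseteq> P \<and> (\<forall>\<xi>\<in>SC1. cmod (F \<xi> - peval xs \<xi>) < e))}"

lemma AP_I:
  assumes "F \<in> extensional SC1" "continuous_on SC1 F"
    "\<And>e. e > 0 \<Longrightarrow> \<exists>xs. snd ` set xs \<subseteq> P \<and> (\<forall>\<xi>\<in>SC1. cmod (F \<xi> - peval xs \<xi>) < e)"
  shows "F \<in> AP"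
  using assms by (simp add: AP_def)

lemma AP_ext: "F \<in> AP \<Longrightarrow> F \<in> extensional SC1"
  and AP_continuous: "F \<in> AP \<Longrightarrow> continuous_on SC1 F"
  by (auto simp: AP_def)

lemma AP_approx:
  assumes "F \<in> AP" "e > 0"
  obtains xs where "snd ` set xs \<subseteq> P" "\<And>\<xi>. \<xi> \<in> SC1 \<Longrightarrow> cmod (F \<xi> - peval xs \<xi>) < e"
proof -
  have "\<exists>xs. snd ` set xs \<subseteq> P \<and> (\<forall>\<xi>\<in>SC1. cmod (F \<xi> - peval xs \<xi>) < e)"
    using assms by (simp add: AP_def)
  then show ?thesis using that by metis
qed

lemma continuous_restrict_SC1:
  "continuous_on SC1 F \<Longrightarrow> continuous_on SC1 (restrict F SC1)"
  by (simp cong: continuous_on_cong)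

lemma AP_peval: "snd ` set xs \<subseteq> P \<Longrightarrow> restrict (peval xs) SC1 \<in> AP"
  by (rule AP_I) (auto intro!: continuous_restrict_SC1 continuous_peval exI[of _ xs])

lemma AP_gen:
  assumes "g \<in> P" shows "(\<lambda>\<xi>\<in>SC1. \<xi> g) \<in> AP"
proof -
  have "restrict (peval [(1, g)]) SC1 = (\<lambda>\<xi>\<in>SC1. \<xi> g)" by (rule restrict_ext) simp
  then show ?thesis using AP_peval[of "[(1, g)]"] assms by simp
qed

lemma AP_add:
  assumes "F \<in> AP" "F' \<in> AP" shows "pw_add SC1 F F' \<in> AP"
proof (rule AP_I)
  show "pw_add SC1 F F' \<in> extensional SC1" by (simp add: pw_add_def)
  show "continuous_on SC1 (pw_add SC1 F F')"
    unfolding pw_add_def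
    by (intro continuous_restrict_SC1 continuous_on_add AP_continuous assms)
  fix e :: real assume "e > 0"
  then have e: "e / 2 > 0" by simp
  obtain xs where xs: "snd ` set xs \<subseteq> P" "\<And>\<xi>. \<xi> \<in> SC1 \<Longrightarrow> cmod (F \<xi> - peval xs \<xi>) < e / 2"
    using AP_approx[OF assms(1) e] by blast
  obtain ys where ys: "snd ` set ys \<subseteq> P" "\<And>\<xi>. \<xi> \<in> SC1 \<Longrightarrow> cmod (F' \<xi> - peval ys \<xi>) < e / 2"
    using AP_approx[OF assms(2) e] by blast
  have "cmod (pw_add SC1 F F' \<xi> - peval (xs @ ys) \<xi>) < e" if \<xi>: "\<xi> \<in> SC1" for \<xi>
  proof -
    have "pw_add SC1 F F' \<xi> - peval (xs @ ys) \<xi> = (F \<xi> - peval xs \<xi>) + (F' \<xi> - peval ys \<xi>)"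
      using \<xi> by (simp add: pw_add_def)
    then show ?thesis
      using xs(2)[OF \<xi>] ys(2)[OF \<xi>] norm_triangle_ineq[of "F \<xi> - peval xs \<xi>" "F' \<xi> - peval ys \<xi>"]
      by (simp only:)
  qed
  then show "\<exists>xs. snd ` set xs \<subseteq> P \<and> (\<forall>\<xi>\<in>SC1. cmod (pw_add SC1 F F' \<xi> - peval xs \<xi>) < e)"
    using xs(1) ys(1) by (intro exI[of _ "xs @ ys"]) (simp add: image_Un)
qed

lemma AP_bounded:
  assumes "F \<in> AP" obtains B where "0 \<le> B" "\<And>\<xi>. \<xi> \<in> SC1 \<Longrightarrow> cmod (F \<xi>) \<le> B"
proof (rule that[of "sup_norm SC1 F"])
  show le: "cmod (F \<xi>) \<le> sup_norm SC1 F" if "\<xi> \<in> SC1" for \<xi>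
    by (rule le_sup_norm[OF compact_SC1 AP_continuous[OF assms] that])
  show "0 \<le> sup_norm SC1 F"
    using le[OF E_SC1[OF eps_SC]] norm_ge_zero order_trans by blast
qed

lemma products_P:
  assumes "A \<subseteq> P" "B \<subseteq> P" shows "(\<lambda>(g, h). g \<otimes> h) ` (A \<times> B) \<subseteq> P"
proof (rule image_subsetI)
  fix p assume "p \<in> A \<times> B"
  then have "fst p \<in> P" "snd p \<in> P" using assms by auto
  then show "(\<lambda>(g, h). g \<otimes> h) p \<in> P" by (simp add: split_beta)
qed

lemma AP_mult:
  assumes "F \<in> AP" "F' \<in> AP" shows "pw_mult SC1 F F' \<in> AP"
proof (rule AP_I)
  show "pw_mult SC1 F F' \<in> extensional SC1" by (simp add: pw_mult_def)
  show "continuous_on SC1 (pw_mult SC1 F F')"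
    unfolding pw_mult_def
    by (intro continuous_restrict_SC1 continuous_on_mult AP_continuous assms)
  fix e :: real assume e: "e > 0"
  obtain B where B: "0 \<le> B" "\<And>\<xi>. \<xi> \<in> SC1 \<Longrightarrow> cmod (F \<xi>) \<le> B" using AP_bounded[OF assms(1)] by blast
  obtain B' where B': "0 \<le> B'" "\<And>\<xi>. \<xi> \<in> SC1 \<Longrightarrow> cmod (F' \<xi>) \<le> B'" using AP_bounded[OF assms(2)] by blast
  \<comment> \<open>The error is split as (F - p) F' + p (F' - p'). The choice of \<open>d\<close>
    bounds the first part by \<open>e / 2\<close> and, as \<open>d\<close> is at most 1, the modulus
    of p by \<open>B + 1\<close>; the choice of \<open>d'\<close> below then bounds the second
    part.\<close>
  define d where "d = min 1 (e / (2 * (B' + 1)))"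
  have d: "d > 0" "d \<le> 1" "d * B' \<le> e / 2"
  proof -
    have "d * B' \<le> e / (2 * (B' + 1)) * B'" using B'(1) by (intro mult_right_mono) (auto simp: d_def)
    also have "\<dots> = (e / 2) * (B' / (B' + 1))" by simp
    also have "\<dots> \<le> (e / 2) * 1" using e B'(1) by (intro mult_left_mono) auto
    finally show "d * B' \<le> e / 2" by simp
  qed (use e B'(1) in \<open>auto simp: d_def\<close>)
  obtain xs where xs: "snd ` set xs \<subseteq> P" "\<And>\<xi>. \<xi> \<in> SC1 \<Longrightarrow> cmod (F \<xi> - peval xs \<xi>) < d"
    using AP_approx[OF assms(1) d(1)] by blast
  define d' where "d' = e / (2 * (B + 1))"
  have d': "d' > 0" "(B + 1) * d' = e / 2" using e B(1) by (auto simp: d'_def field_simps)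
  obtain ys where ys: "snd ` set ys \<subseteq> P" "\<And>\<xi>. \<xi> \<in> SC1 \<Longrightarrow> cmod (F' \<xi> - peval ys \<xi>) < d'"
    using AP_approx[OF assms(2) d'(1)] by blast
  have "cmod (pw_mult SC1 F F' \<xi> - peval (pmul G xs ys) \<xi>) < e" if \<xi>: "\<xi> \<in> SC1" for \<xi>
  proof -
    have "peval (pmul G xs ys) \<xi> = peval xs \<xi> * peval ys \<xi>"
      by (rule peval_pmul[where P = P]) (use \<xi> xs ys in \<open>auto simp: SC1_mult\<close>)
    then have eq: "pw_mult SC1 F F' \<xi> - peval (pmul G xs ys) \<xi>
        = (F \<xi> - peval xs \<xi>) * F' \<xi> + peval xs \<xi> * (F' \<xi> - peval ys \<xi>)"
      using \<xi> by (simp add: pw_mult_def algebra_simps)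
    have "cmod ((F \<xi> - peval xs \<xi>) * F' \<xi>) \<le> d * B'"
      unfolding norm_mult using xs(2)[OF \<xi>] B'(2)[OF \<xi>] d(1) by (intro mult_mono) auto
    moreover have p: "cmod (peval xs \<xi>) \<le> B + 1"
      using xs(2)[OF \<xi>] d(2) B(2)[OF \<xi>] norm_triangle_ineq3[of "F \<xi>" "peval xs \<xi>"] by linarith
    have "cmod (peval xs \<xi> * (F' \<xi> - peval ys \<xi>)) \<le> (B + 1) * cmod (F' \<xi> - peval ys \<xi>)"
      unfolding norm_mult using p by (intro mult_right_mono) auto
    moreover have "(B + 1) * cmod (F' \<xi> - peval ys \<xi>) < (B + 1) * d'"
      using ys(2)[OF \<xi>] B(1) by (intro mult_strict_left_mono) auto
    ultimately show ?thesis
      unfolding eq using d(3) d'(2)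
        norm_triangle_ineq[of "(F \<xi> - peval xs \<xi>) * F' \<xi>" "peval xs \<xi> * (F' \<xi> - peval ys \<xi>)"]
      by linarith
  qed
  moreover have "snd ` set (pmul G xs ys) \<subseteq> P" unfolding snd_pmul by (rule products_P[OF xs(1) ys(1)])
  ultimately show "\<exists>xs. snd ` set xs \<subseteq> P \<and> (\<forall>\<xi>\<in>SC1. cmod (pw_mult SC1 F F' \<xi> - peval xs \<xi>) < e)"
    by blast
qed

lemma AP_scale:
  assumes "F \<in> AP" shows "pw_scale SC1 c F \<in> AP"
proof -
  have "pw_scale SC1 c F = pw_mult SC1 (restrict (peval [(c, \<one>)]) SC1) F"
    by (rule extensionalityI[of _ SC1]) (auto simp: pw_scale_def pw_mult_def SC1_one)
  then show ?thesis using AP_mult[OF AP_peval assms, of "[(c, \<one>)]"] by simp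
qed

lemma AP_closed:
  assumes F: "F \<in> extensional SC1" "continuous_on SC1 F"
    and close: "\<And>e. e > 0 \<Longrightarrow> \<exists>F'\<in>AP. \<forall>\<xi>\<in>SC1. cmod (F \<xi> - F' \<xi>) < e"
  shows "F \<in> AP"
proof (rule AP_I[OF F])
  fix e :: real assume "e > 0"
  then have e: "e / 2 > 0" by simp
  then obtain F' where F': "F' \<in> AP" "\<And>\<xi>. \<xi> \<in> SC1 \<Longrightarrow> cmod (F \<xi> - F' \<xi>) < e / 2"
    using close by blast
  obtain xs where xs: "snd ` set xs \<subseteq> P" "\<And>\<xi>. \<xi> \<in> SC1 \<Longrightarrow> cmod (F' \<xi> - peval xs \<xi>) < e / 2"
    using AP_approx[OF F'(1) e] by blast
  have "cmod (F \<xi> - peval xs \<xi>) < e" if "\<xi> \<in> SC1" for \<xi>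
    using F'(2)[OF that] xs(2)[OF that] norm_triangle_ineq[of "F \<xi> - F' \<xi>" "F' \<xi> - peval xs \<xi>"] by simp
  with xs(1) show "\<exists>xs. snd ` set xs \<subseteq> P \<and> (\<forall>\<xi>\<in>SC1. cmod (F \<xi> - peval xs \<xi>) < e)" by blast
qed

lemma continuous_functions_S1:
  "continuous_functions (semichar_topology S1) = {F \<in> extensional SC1. continuous_on SC1 F}"
  by (auto simp: continuous_functions_def semichar_topology_eq)

lemma closed_subalgebra_AP: "closed_subalgebra (semichar_topology S1) AP"
  unfolding closed_subalgebra_def semichar_topology_eq[of S1, THEN arg_cong, of topspace] topspace_euclidean_subtopology
proof (intro conjI ballI allI impI)
  show "AP \<subseteq> continuous_functions (semichar_topology S1)"
    unfolding continuous_functions_S1 using AP_ext AP_continuous by blast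
  have "restrict (peval []) SC1 = (\<lambda>x\<in>SC1. 0)" by (rule restrict_ext) simp
  then show "(\<lambda>x\<in>SC1. 0) \<in> AP" using AP_peval[of "[]"] by simp
  fix F assume F: "F \<in> continuous_functions (semichar_topology S1)"
    and close: "\<forall>\<epsilon>>0. \<exists>g\<in>AP. sup_norm SC1 (\<lambda>x. F x - g x) < \<epsilon>"
  show "F \<in> AP"
  proof (rule AP_closed)
    show Fc: "F \<in> extensional SC1" "continuous_on SC1 F" using F unfolding continuous_functions_S1 by auto
    fix e :: real assume "e > 0"
    then obtain F' where F': "F' \<in> AP" "sup_norm SC1 (\<lambda>x. F x - F' x) < e" using close by blast
    have "cmod (F \<xi> - F' \<xi>) < e" if "\<xi> \<in> SC1" for \<xi>
      using le_sup_norm[OF compact_SC1 continuous_on_diff[OF Fc(2) AP_continuous[OF F'(1)]] that] F'(2)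
      by simp
    with F'(1) show "\<exists>F'\<in>AP. \<forall>\<xi>\<in>SC1. cmod (F \<xi> - F' \<xi>) < e" by blast
  qed
qed (auto intro: AP_add AP_mult AP_scale)

text \<open>Because \<open>P\<close> is closed under products, polynomials are linear combinations
  of the generators. Every competing closed subalgebra contains them and hence their uniform limits,
  and \<open>AP\<close> is itself a competitor.\<close>

lemma arens_singer_eq: "arens_singer_algebra S1 = AP"
proof
  show "arens_singer_algebra S1 \<subseteq> AP"
    unfolding arens_singer_algebra_def using closed_subalgebra_AP AP_gen by auto
  show "AP \<subseteq> arens_singer_algebra S1"
    unfolding arens_singer_algebra_def
  proof (intro subsetI InterI)
    fix F B assume F: "F \<in> AP"
      and "B \<in> {B. closed_subalgebra (semichar_topology S1) B \<and> (\<forall>a\<in>carrier S1. (\<lambda>\<xi>\<in>SC1. \<xi> a) \<in> B)}"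
    then have B: "closed_subalgebra (semichar_topology S1) B" "\<And>a. a \<in> P \<Longrightarrow> (\<lambda>\<xi>\<in>SC1. \<xi> a) \<in> B" by auto
    have top: "topspace (semichar_topology S1) = SC1" by (simp add: semichar_topology_eq)
    have B': "(\<lambda>x\<in>SC1. 0) \<in> B" "\<And>f g. f \<in> B \<Longrightarrow> g \<in> B \<Longrightarrow> pw_add SC1 f g \<in> B"
      "\<And>c f. f \<in> B \<Longrightarrow> pw_scale SC1 c f \<in> B"
      "\<And>f. f \<in> continuous_functions (semichar_topology S1) \<Longrightarrow>
        (\<And>e. e > 0 \<Longrightarrow> \<exists>g\<in>B. sup_norm SC1 (\<lambda>x. f x - g x) < e) \<Longrightarrow> f \<in> B"
      using B(1) unfolding closed_subalgebra_def top by blast+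
    have poly: "restrict (peval xs) SC1 \<in> B" if "snd ` set xs \<subseteq> P" for xs
      using that
    proof (induction xs)
      case Nil
      show ?case using B'(1) by (simp add: restrict_def)
    next
      case (Cons x xs)
      obtain c g where x: "x = (c, g)" by (cases x)
      have eq: "restrict (peval (x # xs)) SC1
          = pw_add SC1 (pw_scale SC1 c (\<lambda>\<xi>\<in>SC1. \<xi> g)) (restrict (peval xs) SC1)"
        unfolding x pw_add_def pw_scale_def by (rule restrict_ext) simp
      have "g \<in> P" "snd ` set xs \<subseteq> P" using Cons.prems x by auto
      then show ?case unfolding eq by (intro B'(2,3) B(2) Cons.IH)
    qed
    show "F \<in> B"
    proof (rule B'(4))
      show "F \<in> continuous_functions (semichar_topology S1)"
        unfolding continuous_functions_S1 using AP_ext AP_continuous F by blast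
      fix e :: real assume "e > 0"
      then obtain xs where xs: "snd ` set xs \<subseteq> P" "\<And>\<xi>. \<xi> \<in> SC1 \<Longrightarrow> cmod (F \<xi> - peval xs \<xi>) < e / 2"
        using AP_approx[OF F, of "e / 2"] by auto
      have "sup_norm SC1 (\<lambda>x. F x - restrict (peval xs) SC1 x) \<le> e / 2"
        by (rule sup_norm_le[OF SC1_nonempty]) (use xs(2) in \<open>auto intro: less_imp_le\<close>)
      then show "\<exists>g\<in>B. sup_norm SC1 (\<lambda>x. F x - g x) < e"
        using poly[OF xs(1)] \<open>e > 0\<close> by (intro bexI[of _ "restrict (peval xs) SC1"]) auto
    qed
  qed
qed

section \<open>Restriction to the semicharacters of \<open>S\<close> as an isometric
  isomorphism\<close>

definition \<Phi> :: "(('a \<Rightarrow> complex) \<Rightarrow> complex) \<Rightarrow> ('a \<Rightarrow> complex) \<Rightarrow> complex" where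
  "\<Phi> F = (\<lambda>\<psi>\<in>SC. F (E \<psi>))"

lemma \<Phi>_GAlg:
  assumes "F \<in> AP" shows "\<Phi> F \<in> GAlg"
  unfolding \<Phi>_def restrict_GA
proof (rule GA_limit)
  fix e :: real assume "e > 0"
  then obtain xs where xs: "snd ` set xs \<subseteq> P" "\<And>\<xi>. \<xi> \<in> SC1 \<Longrightarrow> cmod (F \<xi> - peval xs \<xi>) < e"
    using AP_approx[OF assms] by blast
  then have "\<forall>\<psi>\<in>SC. cmod (F (E \<psi>) - peval xs (ext \<psi>)) < e"
    using peval_E[OF xs(1)] E_SC1 by metis
  then show "\<exists>g. GA g \<and> (\<forall>\<psi>\<in>SC. cmod (F (E \<psi>) - g \<psi>) < e)" using GA_peval[OF xs(1)] by blast
qed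

text \<open>The polynomial estimate survives uniform limits at an arbitrarily small cost. Applied to
  differences it gives injectivity of \<Phi>, applied to a single function the isometry.\<close>

lemma AP_le:
  assumes F: "F \<in> AP" and B: "\<And>\<psi>. \<psi> \<in> SC \<Longrightarrow> cmod (F (E \<psi>)) \<le> B" and \<xi>: "\<xi> \<in> SC1"
  shows "cmod (F \<xi>) \<le> B"
proof (rule field_le_epsilon)
  fix e :: real assume "e > 0"
  then have "e / 2 > 0" by simp
  then obtain xs where xs: "snd ` set xs \<subseteq> P" "\<And>\<xi>. \<xi> \<in> SC1 \<Longrightarrow> cmod (F \<xi> - peval xs \<xi>) < e / 2"
    using AP_approx[OF F] by blast
  have "cmod (peval xs \<xi>) \<le> B + e / 2"
  proof (rule peval_SC1_le[OF xs(1) _ \<xi>])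
    fix \<eta> assume "\<eta> \<in> X"
    then have \<eta>: "\<eta> \<in> SC" by (rule X_SC)
    show "cmod (peval xs (ext \<eta>)) \<le> B + e / 2"
      using xs(2)[OF E_SC1[OF \<eta>]] B[OF \<eta>] norm_triangle_ineq3[of "F (E \<eta>)" "peval xs (E \<eta>)"]
      unfolding peval_E[OF xs(1)] by linarith
  qed
  then show "cmod (F \<xi>) \<le> B + e"
    using xs(2)[OF \<xi>] norm_triangle_ineq3[of "F \<xi>" "peval xs \<xi>"] by linarith
qed

lemma AP_diff:
  assumes "F \<in> AP" "F' \<in> AP" shows "(\<lambda>\<xi>\<in>SC1. F \<xi> - F' \<xi>) \<in> AP"
proof -
  have "(\<lambda>\<xi>\<in>SC1. F \<xi> - F' \<xi>) = pw_add SC1 F (pw_scale SC1 (-1) F')"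
    by (auto simp: pw_add_def pw_scale_def restrict_def)
  then show ?thesis using assms by (simp add: AP_add AP_scale)
qed

lemma AP_diff_le:
  assumes "F \<in> AP" "F' \<in> AP" "\<And>\<psi>. \<psi> \<in> SC \<Longrightarrow> cmod (F (E \<psi>) - F' (E \<psi>)) \<le> B" "\<xi> \<in> SC1"
  shows "cmod (F \<xi> - F' \<xi>) \<le> B"
  using AP_le[OF AP_diff[OF assms(1,2)], of B \<xi>] assms E_SC1 by simp

lemma \<Phi>_inj: "inj_on \<Phi> AP"
proof (rule inj_onI)
  fix F F' assume F: "F \<in> AP" "F' \<in> AP" "\<Phi> F = \<Phi> F'"
  have eq: "F (E \<psi>) = F' (E \<psi>)" if "\<psi> \<in> SC" for \<psi>
    using fun_cong[OF F(3), of \<psi>] that by (simp add: \<Phi>_def)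
  show "F = F'"
  proof (rule extensionalityI[OF AP_ext[OF F(1)] AP_ext[OF F(2)]])
    fix \<xi> assume \<xi>: "\<xi> \<in> SC1"
    have "cmod (F \<xi> - F' \<xi>) \<le> 0" by (rule AP_diff_le[OF F(1,2) _ \<xi>]) (simp add: eq)
    then show "F \<xi> = F' \<xi>" by simp
  qed
qed

text \<open>Polynomials approximating \<open>f\<close> on \<open>SC\<close> are uniformly Cauchy on
  \<open>X\<close>, hence on \<open>SC1\<close> by \<open>peval_SC1_le\<close>. Their limit on
  \<open>SC1\<close> is a preimage of \<open>f\<close>.\<close>

lemma \<Phi>_surj:
  assumes f: "f \<in> GAlg" obtains F where "F \<in> AP" "\<Phi> F = f"
proof -
  have fGA: "GA f" and fext: "f \<in> extensional SC" using f by (auto simp: GA_iff)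
  have "\<exists>xs. snd ` set xs \<subseteq> P \<and> (\<forall>\<psi>\<in>SC. cmod (f \<psi> - peval xs (ext \<psi>)) < inverse (real (Suc n)))" for n
    using polynomial_approximation[OF fGA, of "inverse (real (Suc n))"] by (metis inverse_positive_iff_positive of_nat_0_less_iff zero_less_Suc)
  then obtain xs where xs: "\<And>n. snd ` set (xs n) \<subseteq> P"
    "\<And>n \<psi>. \<psi> \<in> SC \<Longrightarrow> cmod (f \<psi> - peval (xs n) (ext \<psi>)) < inverse (real (Suc n))" by metis
  have small: "inverse (real (Suc n)) \<le> inverse (real (Suc N))" if "N \<le> n" for n N
    using that by simp
  have "uniformly_Cauchy_on SC1 (\<lambda>n. peval (xs n))"
    unfolding uniformly_Cauchy_on_def
  proof (intro allI impI)
    fix e :: real assume "e > 0"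
    then have "e / 2 > 0" by simp
    then obtain N where N: "inverse (real (Suc N)) < e / 2" using reals_Archimedean by blast
    have "dist (peval (xs m) \<xi>) (peval (xs n) \<xi>) < e" if \<xi>: "\<xi> \<in> SC1" and mn: "m \<ge> N" "n \<ge> N" for \<xi> m n
    proof -
      have "cmod (peval (xs m @ pscale (-1) (xs n)) \<xi>) \<le> 2 * inverse (real (Suc N))"
      proof (rule peval_SC1_le[OF _ _ \<xi>])
        show "snd ` set (xs m @ pscale (-1) (xs n)) \<subseteq> P"
          using xs(1) by (simp add: image_Un)
        fix \<eta> assume "\<eta> \<in> X"
        then have \<eta>: "\<eta> \<in> SC" by (rule X_SC)
        have eq: "peval (xs m @ pscale (-1) (xs n)) (ext \<eta>)
            = (f \<eta> - peval (xs n) (ext \<eta>)) - (f \<eta> - peval (xs m) (ext \<eta>))" by simp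
        show "cmod (peval (xs m @ pscale (-1) (xs n)) (ext \<eta>)) \<le> 2 * inverse (real (Suc N))"
          unfolding eq using norm_triangle_ineq4[of "f \<eta> - peval (xs n) (ext \<eta>)" "f \<eta> - peval (xs m) (ext \<eta>)"]
            xs(2)[OF \<eta>, of m] xs(2)[OF \<eta>, of n] small[OF mn(1)] small[OF mn(2)] by linarith
      qed
      then show ?thesis using N by (simp add: dist_norm)
    qed
    then show "\<exists>N. \<forall>\<xi>\<in>SC1. \<forall>m\<ge>N. \<forall>n\<ge>N. dist (peval (xs m) \<xi>) (peval (xs n) \<xi>) < e" by blast
  qed
  then have "uniformly_convergent_on SC1 (\<lambda>n. peval (xs n))"
    by (rule Cauchy_uniformly_convergent)
  then obtain F0 where F0: "uniform_limit SC1 (\<lambda>n. peval (xs n)) F0 sequentially"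
    unfolding uniformly_convergent_on_def by blast
  define F where "F = restrict F0 SC1"
  have F0c: "continuous_on SC1 F0"
    by (rule uniform_limit_theorem[OF _ F0]) (auto intro: always_eventually continuous_peval)
  have "F \<in> AP"
  proof (rule AP_I)
    show "F \<in> extensional SC1" by (simp add: F_def)
    show "continuous_on SC1 F" unfolding F_def by (rule continuous_restrict_SC1[OF F0c])
    fix e :: real assume "e > 0"
    then have "\<forall>\<^sub>F n in sequentially. \<forall>\<xi>\<in>SC1. dist (peval (xs n) \<xi>) (F0 \<xi>) < e"
      using F0 by (simp add: uniform_limit_iff)
    then obtain n where "\<forall>\<xi>\<in>SC1. dist (peval (xs n) \<xi>) (F0 \<xi>) < e"
      using eventually_sequentially by auto
    then show "\<exists>xs. snd ` set xs \<subseteq> P \<and> (\<forall>\<xi>\<in>SC1. cmod (F \<xi> - peval xs \<xi>) < e)"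
      using xs(1)[of n] by (intro exI[of _ "xs n"]) (auto simp: F_def dist_norm norm_minus_commute)
  qed
  moreover have "\<Phi> F = f"
  proof (rule extensionalityI[of _ SC])
    fix \<psi> assume \<psi>: "\<psi> \<in> SC"
    have "(\<lambda>n. peval (xs n) (E \<psi>)) \<longlonglongrightarrow> F0 (E \<psi>)"
      by (rule tendsto_uniform_limitI[OF F0 E_SC1[OF \<psi>]])
    then have 1: "(\<lambda>n. peval (xs n) (ext \<psi>)) \<longlonglongrightarrow> F0 (E \<psi>)" by (simp add: peval_E xs(1))
    have "(\<lambda>n. f \<psi> - peval (xs n) (ext \<psi>)) \<longlonglongrightarrow> 0"
      by (rule LIMSEQ_norm_0) (use xs(2)[OF \<psi>] in \<open>simp add: inverse_eq_divide\<close>)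
    then have "(\<lambda>n. f \<psi> - (f \<psi> - peval (xs n) (ext \<psi>))) \<longlonglongrightarrow> f \<psi> - 0"
      by (intro tendsto_intros)
    then have "(\<lambda>n. peval (xs n) (ext \<psi>)) \<longlonglongrightarrow> f \<psi>" by simp
    then show "\<Phi> F \<psi> = f \<psi>" using LIMSEQ_unique[OF 1] \<psi> E_SC1[OF \<psi>] by (simp add: \<Phi>_def F_def)
  qed (use fext in \<open>auto simp: \<Phi>_def\<close>)
  ultimately show ?thesis by (rule that)
qed

lemma \<Phi>_bij: "bij_betw \<Phi> AP GAlg"
  unfolding bij_betw_def
proof
  show "\<Phi> ` AP = GAlg"
  proof
    show "\<Phi> ` AP \<subseteq> GAlg" using \<Phi>_GAlg by blast
    show "GAlg \<subseteq> \<Phi> ` AP" using \<Phi>_surj by (metis image_eqI subsetI)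
  qed
qed (rule \<Phi>_inj)

lemma \<Phi>_add: "\<Phi> (pw_add SC1 F F') = pw_add SC (\<Phi> F) (\<Phi> F')"
  and \<Phi>_mult: "\<Phi> (pw_mult SC1 F F') = pw_mult SC (\<Phi> F) (\<Phi> F')"
  and \<Phi>_scale: "\<Phi> (pw_scale SC1 c F) = pw_scale SC c (\<Phi> F)"
  by (rule extensionalityI[of _ SC];
      simp add: \<Phi>_def pw_add_def pw_mult_def pw_scale_def E_SC1)+

lemma SC_nonempty: "SC \<noteq> {}"
  using eps_SC by blast

lemma \<Phi>_norm:
  assumes F: "F \<in> AP" shows "sup_norm SC (\<Phi> F) = sup_norm SC1 F"
proof (rule antisym)
  show "sup_norm SC (\<Phi> F) \<le> sup_norm SC1 F"
    by (rule sup_norm_le[OF SC_nonempty])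
      (use le_sup_norm[OF compact_SC1 AP_continuous[OF F]] E_SC1 in \<open>simp add: \<Phi>_def\<close>)
  show "sup_norm SC1 F \<le> sup_norm SC (\<Phi> F)"
  proof (rule sup_norm_le[OF SC1_nonempty], rule AP_le[OF F])
    fix \<psi> assume \<psi>: "\<psi> \<in> SC"
    have "continuous_on SC (\<Phi> F)" using \<Phi>_GAlg[OF F] by (simp add: GA_iff GA_def)
    from le_sup_norm[OF compact_SC this \<psi>] show "cmod (F (E \<psi>)) \<le> sup_norm SC (\<Phi> F)"
      using \<psi> by (simp add: \<Phi>_def)
  qed
qed

lemma \<Phi>_isometry: "isometric_algebra_iso SC1 AP SC GAlg \<Phi>"
  unfolding isometric_algebra_iso_def
  using \<Phi>_bij \<Phi>_add \<Phi>_mult \<Phi>_scale \<Phi>_norm by blast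

definition \<Psi> :: "(('a \<Rightarrow> complex) \<Rightarrow> complex) \<Rightarrow> ('a \<Rightarrow> complex) \<Rightarrow> complex" where
  "\<Psi> = inv_into AP \<Phi>"

lemma \<Psi>_AP: "f \<in> GAlg \<Longrightarrow> \<Psi> f \<in> AP" and \<Phi>_\<Psi>: "f \<in> GAlg \<Longrightarrow> \<Phi> (\<Psi> f) = f"
  and \<Psi>_\<Phi>: "F \<in> AP \<Longrightarrow> \<Psi> (\<Phi> F) = F"
  unfolding \<Psi>_def using \<Phi>_bij
  by (auto simp: bij_betw_def inv_into_into f_inv_into_f)

lemma \<Psi>_add: "f \<in> GAlg \<Longrightarrow> f' \<in> GAlg \<Longrightarrow> \<Psi> (pw_add SC f f') = pw_add SC1 (\<Psi> f) (\<Psi> f')"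
  by (metis AP_add \<Phi>_add \<Phi>_\<Psi> \<Psi>_AP \<Psi>_\<Phi>)

lemma \<Psi>_mult: "f \<in> GAlg \<Longrightarrow> f' \<in> GAlg \<Longrightarrow> \<Psi> (pw_mult SC f f') = pw_mult SC1 (\<Psi> f) (\<Psi> f')"
  by (metis AP_mult \<Phi>_mult \<Phi>_\<Psi> \<Psi>_AP \<Psi>_\<Phi>)

lemma \<Psi>_scale: "f \<in> GAlg \<Longrightarrow> \<Psi> (pw_scale SC c f) = pw_scale SC1 c (\<Psi> f)"
  by (metis AP_scale \<Phi>_scale \<Phi>_\<Psi> \<Psi>_AP \<Psi>_\<Phi>)

definition ghat :: "'a \<Rightarrow> ('a \<Rightarrow> complex) \<Rightarrow> complex" where
  "ghat g = (\<lambda>\<psi>\<in>SC. ext \<psi> g)"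

lemma \<Phi>_gen: "g \<in> P \<Longrightarrow> \<Phi> (\<lambda>\<xi>\<in>SC1. \<xi> g) = ghat g"
  by (rule extensionalityI[of _ SC]) (simp_all add: \<Phi>_def ghat_def E_SC1, simp add: E_def)

end

section \<open>The Gelfand spectrum\<close>

context no_nontrivial_prime_ideals_haar
begin

lemma ghat_GAlg: "g \<in> P \<Longrightarrow> ghat g \<in> GAlg"
  unfolding ghat_def restrict_GA by (rule GA_ext)

lemma \<Psi>_ghat: "g \<in> P \<Longrightarrow> \<xi> \<in> SC1 \<Longrightarrow> \<Psi> (ghat g) \<xi> = \<xi> g"
  using \<Psi>_\<Phi>[OF AP_gen, of g] \<Phi>_gen[of g] by simp

lemma ghat_mult: "g \<in> P \<Longrightarrow> h \<in> P \<Longrightarrow> ghat (g \<otimes> h) = pw_mult SC (ghat g) (ghat h)"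
  by (rule extensionalityI[of _ SC]) (simp_all add: ghat_def pw_mult_def ext_P_mult)

lemma GAlg_pw:
  assumes "f \<in> GAlg"
  shows "pw_scale SC c f \<in> GAlg" "f' \<in> GAlg \<Longrightarrow> pw_add SC f f' \<in> GAlg"
    "f' \<in> GAlg \<Longrightarrow> pw_mult SC f f' \<in> GAlg"
  using assms GA_mult[OF GA_const] GA_add GA_mult
  unfolding pw_scale_def pw_add_def pw_mult_def restrict_GA by (simp_all add: GA_iff)

text \<open>The value at \<open>\<xi>\<close> of the unique function in \<open>AP\<close> that
  restricts to \<open>f\<close>; for \<open>f\<close> in the algebra this carries point evaluations
  over from \<open>SC1\<close>.\<close>

definition \<Gamma> :: "('a \<Rightarrow> complex) \<Rightarrow> (('a \<Rightarrow> complex) \<Rightarrow> complex) \<Rightarrow> complex" where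
  "\<Gamma> \<xi> = (\<lambda>f\<in>GAlg. \<Psi> f \<xi>)"

lemma \<Gamma>_hom:
  assumes \<xi>: "\<xi> \<in> SC1" shows "\<Gamma> \<xi> \<in> complex_homs SC GAlg"
proof -
  have "\<Gamma> \<xi> (ghat \<one>) \<noteq> 0" "ghat \<one> \<in> GAlg"
    using \<xi> by (simp_all add: \<Gamma>_def ghat_GAlg \<Psi>_ghat SC1_one)
  moreover have "\<Gamma> \<xi> (pw_add SC f f') = \<Gamma> \<xi> f + \<Gamma> \<xi> f'"
    "\<Gamma> \<xi> (pw_mult SC f f') = \<Gamma> \<xi> f * \<Gamma> \<xi> f'"
    "\<Gamma> \<xi> (pw_scale SC c f) = c * \<Gamma> \<xi> f" if "f \<in> GAlg" "f' \<in> GAlg" for f f' c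
    using that \<xi> GAlg_pw
    by (simp_all add: \<Gamma>_def \<Psi>_add \<Psi>_mult \<Psi>_scale pw_add_def[of SC1] pw_mult_def[of SC1] pw_scale_def[of SC1])
  moreover have "\<Gamma> \<xi> \<in> extensional GAlg" by (simp add: \<Gamma>_def)
  ultimately show ?thesis unfolding complex_homs_def by blast
qed

text \<open>If \<open>m f > B\<close>, then \<open>k = f / (m f - f)\<close> is in the algebra and satisfies \<open>m k = 1 + m k\<close>.\<close>

lemma complex_hom_le:
  assumes m: "m \<in> complex_homs SC GAlg" and f: "f \<in> GAlg"
    and B: "\<And>\<psi>. \<psi> \<in> SC \<Longrightarrow> cmod (f \<psi>) \<le> B"
  shows "cmod (m f) \<le> B"
proof (rule ccontr)
  have mr: "m (pw_add SC f f') = m f + m f'" "m (pw_mult SC f f') = m f * m f'"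
    "m (pw_scale SC c f) = c * m f" if "f \<in> GAlg" "f' \<in> GAlg" for f f' c
    using m that unfolding complex_homs_def by blast+
  assume "\<not> cmod (m f) \<le> B"
  then have gt: "B < cmod (m f)" by simp
  have B0: "0 \<le> B" using B[OF eps_SC] norm_ge_zero order_trans by blast
  define a where "a = m f"
  have a: "a \<noteq> 0" using gt B0 by (auto simp: a_def)
  define f1 where "f1 = pw_scale SC (inverse a) f"
  have f1: "f1 \<in> GAlg" unfolding f1_def by (rule GAlg_pw[OF f])
  have mf1: "m f1 = 1" unfolding f1_def using mr(3)[OF f f] a by (simp add: a_def)
  have nz: "1 - f1 \<psi> \<noteq> 0" if "\<psi> \<in> SC" for \<psi>
  proof
    assume "1 - f1 \<psi> = 0"
    then have "f \<psi> = a" using that a by (simp add: f1_def pw_scale_def field_simps)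
    then show False using B[OF that] gt by (simp add: a_def)
  qed
  define k where "k = (\<lambda>\<psi>\<in>SC. f1 \<psi> / (1 - f1 \<psi>))"
  have k: "k \<in> GAlg"
  proof -
    have "GA f1" using f1 by (simp add: GA_iff)
    then have "GA (\<lambda>\<psi>. 1 + (-1) * f1 \<psi>)" by (intro GA_add GA_mult GA_const)
    then have "GA (\<lambda>\<psi>. 1 - f1 \<psi>)" by simp
    then show ?thesis unfolding k_def restrict_GA using \<open>GA f1\<close> nz by (intro GA_divide)
  qed
  have "k = pw_add SC f1 (pw_mult SC f1 k)"
  proof (rule extensionalityI[of _ SC])
    fix \<psi> assume \<psi>: "\<psi> \<in> SC"
    show "k \<psi> = pw_add SC f1 (pw_mult SC f1 k) \<psi>"
      using nz[OF \<psi>] \<psi> by (simp add: k_def pw_add_def pw_mult_def field_simps)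
  qed (auto simp: k_def pw_add_def)
  then have "m k = m (pw_add SC f1 (pw_mult SC f1 k))" by simp
  also have "\<dots> = m f1 + m f1 * m k"
    using mr(1)[OF f1 GAlg_pw(3)[OF f1 k]] mr(2)[OF f1 k] by simp
  finally show False using mf1 by simp
qed

text \<open>The values of \<open>m\<close> at the functions \<open>ghat g\<close> form a
  semicharacter \<xi> of \<open>P\<close>, and \<open>m\<close> agrees with \<Gamma> \<xi> on
  polynomials. Homomorphisms carry no continuity assumption; \<open>complex_hom_le\<close> supplies
  the bound that extends the agreement to uniform limits.\<close>

lemma \<Gamma>_surj:
  assumes m: "m \<in> complex_homs SC GAlg"
  obtains \<xi> where "\<xi> \<in> SC1" "\<Gamma> \<xi> = m"
proof -
  have mr: "m (pw_add SC f f') = m f + m f'" "m (pw_mult SC f f') = m f * m f'"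
    "m (pw_scale SC c f) = c * m f" if "f \<in> GAlg" "f' \<in> GAlg" for f f' c
    using m that unfolding complex_homs_def by blast+
  have mext: "m \<in> extensional GAlg" and "\<exists>f\<in>GAlg. m f \<noteq> 0"
    using m unfolding complex_homs_def by blast+
  then obtain f0 where f0: "f0 \<in> GAlg" "m f0 \<noteq> 0" by blast
  define \<xi> where "\<xi> = (\<lambda>g\<in>P. m (ghat g))"
  have "f0 = pw_mult SC (ghat \<one>) f0"
    using f0(1) by (intro extensionalityI[of _ SC]) (auto simp: GA_iff pw_mult_def ghat_def)
  then have "m f0 = m (ghat \<one>) * m f0" using mr(2)[OF ghat_GAlg[OF one_P] f0(1)] by simp
  then have m1: "m (ghat \<one>) = 1" using f0(2) by simp
  have \<xi>: "\<xi> \<in> SC1"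
  proof (rule SC1_I)
    show "cmod (\<xi> g) \<le> 1" if "g \<in> P" for g
      using complex_hom_le[OF m ghat_GAlg[OF that], of 1] that ext_P_le by (simp add: \<xi>_def ghat_def)
    show "\<xi> (g \<otimes> h) = \<xi> g * \<xi> h" if "g \<in> P" "h \<in> P" for g h
      using that by (simp add: \<xi>_def ghat_mult mr(2) ghat_GAlg)
  qed (simp_all add: \<xi>_def m1)
  have poly: "restrict (\<lambda>\<psi>. peval xs (ext \<psi>)) SC \<in> GAlg \<and> m (restrict (\<lambda>\<psi>. peval xs (ext \<psi>)) SC) = peval xs \<xi>"
    if "snd ` set xs \<subseteq> P" for xs
    using that
  proof (induction xs)
    case Nil
    have "restrict (\<lambda>\<psi>. peval [] (ext \<psi>)) SC = pw_scale SC 0 (ghat \<one>)"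
      by (rule extensionalityI[of _ SC]) (auto simp: pw_scale_def)
    then show ?case
      using mr(3)[OF ghat_GAlg[OF one_P] ghat_GAlg[OF one_P]] GAlg_pw(1)[OF ghat_GAlg[OF one_P]] by simp
  next
    case (Cons x xs)
    obtain c g where x: "x = (c, g)" by (cases x)
    have g: "g \<in> P" and xs: "snd ` set xs \<subseteq> P" using Cons.prems x by auto
    let ?f = "restrict (\<lambda>\<psi>. peval xs (ext \<psi>)) SC"
    have f: "?f \<in> GAlg" "m ?f = peval xs \<xi>" using Cons.IH[OF xs] by blast+
    have s: "pw_scale SC c (ghat g) \<in> GAlg" by (rule GAlg_pw[OF ghat_GAlg[OF g]])
    have eq: "restrict (\<lambda>\<psi>. peval (x # xs) (ext \<psi>)) SC = pw_add SC (pw_scale SC c (ghat g)) ?f"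
      by (rule extensionalityI[of _ SC]) (auto simp: x pw_scale_def pw_add_def ghat_def)
    have "m (pw_add SC (pw_scale SC c (ghat g)) ?f) = peval (x # xs) \<xi>"
      using mr(1)[OF s f(1)] mr(3)[OF ghat_GAlg[OF g] f(1), of c] f(2) g by (simp add: x \<xi>_def)
    then show ?case unfolding eq using GAlg_pw(2)[OF s f(1)] by blast
  qed
  have "m f = \<Psi> f \<xi>" if f: "f \<in> GAlg" for f
  proof -
    have fGA: "GA f" using f by (simp add: GA_iff)
    have "cmod (m f - \<Psi> f \<xi>) \<le> 0 + e" if e: "e > 0" for e
    proof -
      have "e / 2 > 0" using e by simp
      then obtain xs where xs: "snd ` set xs \<subseteq> P" "\<And>\<psi>. \<psi> \<in> SC \<Longrightarrow> cmod (f \<psi> - peval xs (ext \<psi>)) < e / 2"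
        using polynomial_approximation[OF fGA] by blast
      let ?p = "restrict (\<lambda>\<psi>. peval xs (ext \<psi>)) SC"
      have p: "?p \<in> GAlg" "m ?p = peval xs \<xi>" using poly[OF xs(1)] by blast+
      let ?d = "pw_add SC f (pw_scale SC (-1) ?p)"
      have s: "pw_scale SC (-1) ?p \<in> GAlg" by (rule GAlg_pw[OF p(1)])
      have "cmod (m ?d) \<le> e / 2"
        by (rule complex_hom_le[OF m GAlg_pw(2)[OF f s]])
          (use xs(2) in \<open>auto simp: pw_add_def pw_scale_def intro: less_imp_le\<close>)
      moreover have "m ?d = m f - peval xs \<xi>"
        using mr(1)[OF f s] mr(3)[OF p(1) p(1), of "-1"] p(2) by simp
      ultimately have 1: "cmod (m f - peval xs \<xi>) \<le> e / 2" by simp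
      have "cmod (\<Psi> f \<xi> - restrict (peval xs) SC1 \<xi>) \<le> e / 2"
      proof (rule AP_diff_le[OF \<Psi>_AP[OF f] AP_peval[OF xs(1)] _ \<xi>])
        fix \<psi> assume \<psi>: "\<psi> \<in> SC"
        have "\<Psi> f (E \<psi>) = f \<psi>" using fun_cong[OF \<Phi>_\<Psi>[OF f], of \<psi>] \<psi> by (simp add: \<Phi>_def)
        then show "cmod (\<Psi> f (E \<psi>) - restrict (peval xs) SC1 (E \<psi>)) \<le> e / 2"
          using xs(2)[OF \<psi>] E_SC1[OF \<psi>] peval_E[OF xs(1)] by simp
      qed
      then have 2: "cmod (peval xs \<xi> - \<Psi> f \<xi>) \<le> e / 2" using \<xi> by (simp add: norm_minus_commute)
      show ?thesis
        using 1 2 norm_triangle_ineq[of "m f - peval xs \<xi>" "peval xs \<xi> - \<Psi> f \<xi>"] by simp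
    qed
    then have "cmod (m f - \<Psi> f \<xi>) \<le> 0" by (rule field_le_epsilon)
    then show ?thesis by simp
  qed
  then have "\<Gamma> \<xi> = m"
    using mext by (intro extensionalityI[of _ GAlg]) (auto simp: \<Gamma>_def)
  with \<xi> show ?thesis by (rule that)
qed

lemma \<Gamma>_inj: "inj_on \<Gamma> SC1"
proof (rule inj_onI)
  fix \<xi> \<xi>' assume *: "\<xi> \<in> SC1" "\<xi>' \<in> SC1" "\<Gamma> \<xi> = \<Gamma> \<xi>'"
  show "\<xi> = \<xi>'"
  proof (rule extensionalityI[OF SC1_ext[OF *(1)] SC1_ext[OF *(2)]])
    fix g assume g: "g \<in> P"
    have "\<Gamma> \<xi> (ghat g) = \<Gamma> \<xi>' (ghat g)" using *(3) by simp
    then show "\<xi> g = \<xi>' g" using g * by (simp add: \<Gamma>_def ghat_GAlg \<Psi>_ghat)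
  qed
qed

text \<open>A continuous bijection from a compact space onto a Hausdorff space; continuity of each
  coordinate is the continuity of the corresponding function in \<open>AP\<close>.\<close>

lemma \<Gamma>_homeomorphic: "homeomorphic_map (semichar_topology S1) (gelfand_spectrum SC GAlg) \<Gamma>"
proof (rule continuous_imp_homeomorphic_map)
  have ext: "complex_homs SC GAlg \<subseteq> extensional GAlg" unfolding complex_homs_def by blast
  have top: "topspace (gelfand_spectrum SC GAlg) = complex_homs SC GAlg"
    using ext by (auto simp: gelfand_spectrum_def PiE_def)
  show "compact_space (semichar_topology S1)"
    by (simp add: semichar_topology_eq compact_space_subtopology compact_SC1)
  show "Hausdorff_space (gelfand_spectrum SC GAlg)"
    unfolding gelfand_spectrum_def
    by (intro Hausdorff_space_subtopology) (simp add: Hausdorff_space_product_topology)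
  show "inj_on \<Gamma> (topspace (semichar_topology S1))"
    using \<Gamma>_inj by (simp add: semichar_topology_eq)
  show "\<Gamma> ` topspace (semichar_topology S1) = topspace (gelfand_spectrum SC GAlg)"
    unfolding top semichar_topology_eq topspace_euclidean_subtopology
  proof
    show "\<Gamma> ` SC1 \<subseteq> complex_homs SC GAlg" using \<Gamma>_hom by blast
    show "complex_homs SC GAlg \<subseteq> \<Gamma> ` SC1" using \<Gamma>_surj by (metis image_eqI subsetI)
  qed
  have "continuous_map (top_of_set SC1) euclidean (\<lambda>\<xi>. \<Gamma> \<xi> f)" if f: "f \<in> GAlg" for f
    using AP_continuous[OF \<Psi>_AP[OF f]] f by (simp add: \<Gamma>_def)
  moreover have "\<Gamma> \<in> SC1 \<rightarrow> extensional GAlg" by (simp add: \<Gamma>_def)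
  ultimately show "continuous_map (semichar_topology S1) (gelfand_spectrum SC GAlg) \<Gamma>"
    using \<Gamma>_hom unfolding gelfand_spectrum_def semichar_topology_eq
    by (auto simp: continuous_map_in_subtopology continuous_map_componentwise)
qed

section \<open>The copy of the semicharacters of \<open>S\<close> inside those of the spectral
  semigroup\<close>

definition H :: "('a \<Rightarrow> complex) set" where "H = E ` SC"

lemma restrict_inj_H: "bij_betw (\<lambda>\<xi>. restrict \<xi> M) H SC"
  unfolding H_def
  by (rule bij_betw_byWitness[where f' = E]) (auto simp: restrict_E)

text \<open>The final statement describes the embedding of \<open>SC\<close> only as the inverse of
  restriction on \<open>H\<close>; this identifies it with \<open>E\<close>, and hence the map of
  algebras with \<Phi>.\<close>

lemma inv_into_H: "\<psi> \<in> SC \<Longrightarrow> inv_into H (\<lambda>\<xi>. restrict \<xi> M) \<psi> = E \<psi>"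
  using restrict_inj_H by (intro inv_into_f_eq) (auto simp: bij_betw_def H_def restrict_E)

lemma H_SC1: "H \<subseteq> SC1"
  using E_SC1 by (auto simp: H_def)

lemma H_subsemigroup: "subsemigroup (semichar_monoid S1) H"
  unfolding subsemigroup_def semichar_monoid_def
proof (intro conjI ballI)
  fix \<xi> \<zeta> assume "\<xi> \<in> H" "\<zeta> \<in> H"
  then show "\<xi> \<otimes>\<^bsub>\<lparr>carrier = SC1, monoid.mult = semichar_mult S1, one = \<lambda>s\<in>carrier S1. 1\<rparr>\<^esub> \<zeta> \<in> H"
    unfolding H_def using E_smult smult_SC by auto
qed (use H_SC1 in simp)

lemma restrict_iso:
  "(\<lambda>\<xi>. restrict \<xi> M) \<in> iso ((semichar_monoid S1)\<lparr>carrier := H\<rparr>) (semichar_monoid S)"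
proof (rule isoI)
  show "(\<lambda>\<xi>. restrict \<xi> M) \<in> hom ((semichar_monoid S1)\<lparr>carrier := H\<rparr>) (semichar_monoid S)"
  proof (rule homI)
    fix \<xi> assume "\<xi> \<in> carrier ((semichar_monoid S1)\<lparr>carrier := H\<rparr>)"
    then show "restrict \<xi> M \<in> carrier (semichar_monoid S)"
      using H_SC1 restrict_SC by (auto simp: semichar_monoid_def)
    fix \<zeta>
    show "restrict (\<xi> \<otimes>\<^bsub>(semichar_monoid S1)\<lparr>carrier := H\<rparr>\<^esub> \<zeta>) M
        = restrict \<xi> M \<otimes>\<^bsub>semichar_monoid S\<^esub> restrict \<zeta> M"
      using M_P by (simp add: semichar_monoid_def semichar_mult_def restrict_def fun_eq_iff subset_iff)
  qed
  show "bij_betw (\<lambda>\<xi>. restrict \<xi> M) (carrier ((semichar_monoid S1)\<lparr>carrier := H\<rparr>)) (carrier (semichar_monoid S))"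
    using restrict_inj_H by (simp add: semichar_monoid_def)
qed

lemma restrict_homeomorphic:
  "homeomorphic_map (subtopology (semichar_topology S1) H) (semichar_topology S) (\<lambda>\<xi>. restrict \<xi> M)"
proof -
  have "subtopology (semichar_topology S1) H = top_of_set H"
    using H_SC1 by (simp add: semichar_topology_eq subtopology_subtopology Int_absorb1)
  moreover have "homeomorphic_maps (top_of_set H) (top_of_set SC) (\<lambda>\<xi>. restrict \<xi> M) E"
    unfolding homeomorphic_maps_def
    by (auto simp: continuous_restrict continuous_E H_def restrict_E)
  ultimately show ?thesis
    by (auto simp: homeomorphic_map_maps semichar_topology_eq)
qed

lemma main_conclusion:
  fixes r :: "('a \<Rightarrow> complex) \<Rightarrow> 'a \<Rightarrow> complex"
  defines "r \<equiv> \<lambda>\<xi>. restrict \<xi> M"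
  shows "subsemigroup (semichar_monoid S1) H \<and>
    r \<in> iso ((semichar_monoid S1)\<lparr>carrier := H\<rparr>) (semichar_monoid S) \<and>
    homeomorphic_map (subtopology (semichar_topology S1) H) (semichar_topology S) r \<and>
    (\<exists>\<Phi>. \<Phi> = (\<lambda>f. \<lambda>\<psi>\<in>SC. f (inv_into H r \<psi>)) \<and>
       isometric_algebra_iso SC1 (arens_singer_algebra S1) SC GAlg \<Phi> \<and>
       homeomorphic_map (semichar_topology S1) (gelfand_spectrum SC GAlg)
         (\<lambda>\<xi>. \<lambda>f\<in>GAlg. (inv_into (arens_singer_algebra S1) \<Phi> f) \<xi>))"
proof -
  have "\<Phi> = (\<lambda>f. \<lambda>\<psi>\<in>SC. f (inv_into H r \<psi>))"
    unfolding \<Phi>_def r_def by (intro HOL.ext restrict_ext) (simp add: inv_into_H)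
  moreover have "(\<lambda>\<xi>. \<lambda>f\<in>GAlg. (inv_into AP \<Phi> f) \<xi>) = \<Gamma>"
    unfolding \<Gamma>_def \<Psi>_def ..
  ultimately show ?thesis
    using H_subsemigroup restrict_iso restrict_homeomorphic \<Phi>_isometry \<Gamma>_homeomorphic
    unfolding r_def arens_singer_eq by metis
qed

end

theorem mainTheorem3:
  fixes S G S\<^sub>1 :: "'a monoid" and \<mu> :: "('a \<Rightarrow> complex) measure"
    and r :: "('a \<Rightarrow> complex) \<Rightarrow> ('a \<Rightarrow> complex)"
  assumes S: "comm_monoid_cancel S"
    and no_nontrivial_prime_ideals:
      "\<And>I. semigroup_prime_ideal S I \<Longrightarrow> I = carrier S - {\<one>\<^bsub>S\<^esub>}"
    and not_nontrivial_group: "Units S = carrier S \<Longrightarrow> carrier S = {\<one>\<^bsub>S\<^esub>}"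
    and G: "group_of_quotients S G"
    and haar: "normalized_haar_measure S \<mu>"
    and S1: "S\<^sub>1 = spectral_semigroup S G \<mu>"
    and r: "r = (\<lambda>\<xi>. restrict \<xi> (carrier S))"
  shows "(\<lambda>a. inv\<^bsub>G\<^esub> a) ` carrier S\<^sub>1 \<inter> carrier S\<^sub>1 = {\<one>\<^bsub>G\<^esub>} \<and>
    carrier S \<subseteq> carrier S\<^sub>1 \<and>
    (\<exists>H. subsemigroup (semichar_monoid S\<^sub>1) H \<and>
       r \<in> iso ((semichar_monoid S\<^sub>1)\<lparr>carrier := H\<rparr>) (semichar_monoid S) \<and>
       homeomorphic_map (subtopology (semichar_topology S\<^sub>1) H) (semichar_topology S) r \<and>
       (\<exists>\<Phi>. \<Phi> = (\<lambda>f. \<lambda>\<psi>\<in>semicharacters S. f (inv_into H r \<psi>)) \<and>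
          isometric_algebra_iso
            (semicharacters S\<^sub>1) (arens_singer_algebra S\<^sub>1)
            (semicharacters S) (gen_analytic_algebra S) \<Phi> \<and>
          homeomorphic_map
            (semichar_topology S\<^sub>1)
            (gelfand_spectrum (semicharacters S) (gen_analytic_algebra S))
            (\<lambda>\<xi>. \<lambda>f\<in>gen_analytic_algebra S.
               (inv_into (arens_singer_algebra S\<^sub>1) \<Phi> f) \<xi>)))"
proof -
  interpret no_nontrivial_prime_ideals_haar S G \<mu>
    by (intro no_nontrivial_prime_ideals_haar.intro no_nontrivial_prime_ideals.intro
        no_nontrivial_prime_ideals_haar_axioms.intro) (fact assms)+
  have eq: "S\<^sub>1 = S1"
    unfolding S1 spectral_semigroup_eq S1_def ..
  have "(\<lambda>a. inv\<^bsub>G\<^esub> a) ` carrier S1 \<inter> carrier S1 = {\<one>\<^bsub>G\<^esub>}" "carrier S \<subseteq> carrier S1"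
    using P_inv M_P by simp_all
  then show ?thesis
    unfolding eq r using main_conclusion by blast
qed

end
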